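(* Let $1\le p_0<\infty$ and let $\mathcal F$ be a collection of pairs $(f,g)$ of nonnegative measurable functions on $\mathbb{R}^n$. Assume that for every $(f,g)\in \mathcal F$ and every $u\in A_{p_0}$ we have $$\|g\|_{L^{p_0}(u)}\le C \|f\|_{L^{p_0}(u)},\qquad ( * )$$ where $C$ does not depend on the pair $(f,g)$ and it depends on $u$ only in terms of $[u]_{A_{p_0}}$. Let $1<p<\infty$, let $\lambda=(\lambda_1,\lambda_2)\in\mathbb{R}^2$ with $\lambda_1 + \lambda_2<n$, and let $\beta>-n$ be such that $$\max(0, \beta-n(p-1))<\lambda_1 + \lambda_2 (1+\beta/n)<n+\beta.$$ Then for all $(f,g)\in\mathcal F$ $$\|g\|_{\mathcal L^{p,\lambda}(|x|^\beta)}\le C \|f\|_{\mathcal L^{p,\lambda}(|x|^\beta)},\qquad ( ** )$$ with $C$ independent of the pair $(f,g)$. If $( * )$ holds for $p_0=1$, then the conclusion $( ** )$ is also satisfied for $p=1$ (under the same conditions on $\lambda_1,\lambda_2,\beta$ with $p=1$).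
   Context: For a weight (locally integrable, a.e. positive function) $v$ on $\mathbb{R}^n$, $v(E)=\int_E v$; $|E|$ is Lebesgue measure and $B(x,r)$ the Euclidean ball; $\|f\|_{L^p(v)}=(\int|f|^pv)^{1/p}$. For $0<p<\infty$ and $\lambda=(\lambda_1,\lambda_2)\in\mathbb{R}^2$, $$\|f\|_{\mathcal L^{p,\lambda}(v)} := \sup_{x\in \mathbb{R}^n,\, r>0}\left(\frac 1{r^{\lambda_1}\, v(B(x,r))^{\lambda_2/n}}\int_{B(x,r)}|f|^p v\right)^{1/p}.$$ $|x|^\beta$ denotes the power weight $x\mapsto|x|^\beta$. $u\in A_p$ ($1<p<\infty$) means $[u]_{A_p}:=\sup_B \frac{u(B)}{|B|}\left(\frac{u^{1-p'}(B)}{|B|}\right)^{p-1}<\infty$ over all balls; $u\in A_1$ means $u(B)/|B|\le c\,u(x)$ for a.e. $x\in B$, for all balls $B$, and $[u]_{A_1}$ is the smallest such $c$. *)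

theory Defs
  imports "HOL-Analysis.Analysis"
begin

(* The power x^a of an extended nonnegative number.  It is used only for exponents a > 0,
   where the power of infinity is infinity. *)
definition epowr :: "ennreal \<Rightarrow> real \<Rightarrow> ennreal" where
  "epowr x a = (if x = top then top else ennreal (enn2real x powr a))"

definition weight :: "(real ^ 'n \<Rightarrow> real) \<Rightarrow> bool" where
  "weight v \<longleftrightarrow> (\<forall>K. compact K \<longrightarrow> set_integrable lebesgue K v) \<and> (AE x in lebesgue. 0 < v x)"

(* v(E), as an extended number: it is also applied to powers of weights, which need not be
   locally integrable. *)
definition wmeas :: "(real ^ 'n \<Rightarrow> real) \<Rightarrow> (real ^ 'n) set \<Rightarrow> ennreal" where
  "wmeas v E = (\<integral>\<^sup>+ x \<in> E. ennreal (v x) \<partial>lebesgue)"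

definition wLp_norm :: "real \<Rightarrow> (real ^ 'n \<Rightarrow> real) \<Rightarrow> (real ^ 'n \<Rightarrow> ennreal) \<Rightarrow> ennreal" where
  "wLp_norm p v f = epowr (\<integral>\<^sup>+ x. epowr (f x) p * ennreal (v x) \<partial>lebesgue) (1 / p)"

(* Meant for weights v, so that v(B) is positive and finite for every ball B and the
   normalising factor is a positive real for both signs of the exponents. *)
definition morrey_norm ::
  "real \<Rightarrow> real \<Rightarrow> real \<Rightarrow> (real ^ 'n \<Rightarrow> real) \<Rightarrow> (real ^ 'n \<Rightarrow> ennreal) \<Rightarrow> ennreal" where
  "morrey_norm p l1 l2 v f =
     (SUP (x, r) \<in> UNIV \<times> {0<..}.
        epowr ((\<integral>\<^sup>+ y \<in> ball x r. epowr (f y) p * ennreal (v y) \<partial>lebesgue)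
                 / ennreal (r powr l1 * enn2real (wmeas v (ball x r)) powr (l2 / real CARD('n))))
              (1 / p))"

definition A1_bound :: "(real ^ 'n \<Rightarrow> real) \<Rightarrow> ennreal \<Rightarrow> bool" where
  "A1_bound u c \<longleftrightarrow>
     (\<forall>x. \<forall>r > 0. AE y in lebesgue. y \<in> ball x r \<longrightarrow>
        wmeas u (ball x r) / emeasure lebesgue (ball x r) \<le> c * ennreal (u y))"

definition Ap_const :: "real \<Rightarrow> (real ^ 'n \<Rightarrow> real) \<Rightarrow> ennreal" where
  "Ap_const p u =
     (if p = 1 then Inf {c. A1_bound u c}
      else (SUP (x, r) \<in> UNIV \<times> {0<..}.
              wmeas u (ball x r) / emeasure lebesgue (ball x r) *
              epowr (wmeas (\<lambda>y. u y powr (1 - p / (p - 1))) (ball x r)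
                       / emeasure lebesgue (ball x r)) (p - 1)))"

definition Ap :: "real \<Rightarrow> (real ^ 'n \<Rightarrow> real) set" where
  "Ap p = {u. weight u \<and> (if p = 1 then \<exists>c < top. A1_bound u c else Ap_const p u < top)}"

end

theory Submission
  imports Defs "HOL-Real_Asymp.Real_Asymp"
begin

text \<open>To bound the integral of \<open>g\<^sup>p |x|\<^sup>\<beta>\<close> over a ball \<open>B\<close>, choose a test weight \<open>w\<close> in \<open>A\<^sub>p\<close>, with constant
  independent of \<open>B\<close>, that dominates \<open>|x|\<^sup>\<beta>\<close> on \<open>B\<close> and decays away from \<open>B\<close> fast enough for the integral of
  \<open>f\<^sup>p w\<close> over the whole space to be controlled by the Morrey norm of \<open>f\<close> and the normalising factor
  of \<open>B\<close>. The weighted inequality for \<open>w\<close> then gives the estimate on \<open>B\<close>. For balls comparable to a ball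
  centred at the origin, \<open>w\<close> is a truncated power of \<open>|x|\<close>; for balls \<open>B(z, r)\<close> far from the origin it is
  \<open>min(1, (r / |x - z|)\<^sup>s)\<close> with a correction at the origin. The hypotheses on \<open>\<lambda>\<close> and \<open>\<beta>\<close> say exactly
  that admissible exponents exist.

  The inequality for \<open>p\<close> follows from the one for \<open>p\<^sub>0\<close> by Rubio de Francia extrapolation: if \<open>F\<close> and
  \<open>H\<close> are \<open>A\<^sub>1\<close> majorants of \<open>f\<close> and of \<open>g\<^sup>p\<^sup>-\<^sup>1 w\<close>, then \<open>F\<^sup>1\<^sup>-\<^sup>p\<^sup>0 H\<close> is an \<open>A\<close>-weight for the exponent
  \<open>p\<^sub>0\<close>. The majorants exist because the maximal operator is bounded on \<open>L\<^sup>p(w)\<close> and on the dual space.\<close>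

section \<open>Powers of extended nonnegative numbers\<close>

text \<open>Write l for \<lambda>1 + \<lambda>2 (1 + \<beta>/n) and \<mu> for \<lambda>1 +
  \<lambda>2. The normalising factor behaves like r^l on balls that reach the scale of the origin
  and like r^\<mu> |x|^(l-\<mu>) on balls far from it. Each hypothesis is therefore a convergence
  condition for an integral against a test weight: l > max(0, \<beta> - n(p-1)) at the origin, l < n
  + \<beta> at infinity, and \<mu> < n around the centre of a far ball. Every n comes from the fact
  that |x|^(-a) is an A_1 weight for 0 \<le> a < n.

  Extrapolation ends by absorbing half of the integral of g^p w, but nothing says that this integral
  is finite. So g is first truncated in height and in space, and monotone convergence removes the
  truncation. The estimate is then local on the left, which is all that Morrey norms ask for.

  Only the existence of constants matters, so Hoelder's, Young's and Minkowski's inequalities are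
  replaced by cruder bounds that hold directly for values in [0, infinity].\<close>

lemma epowr_top [simp]: "epowr top a = top"
  by (simp add: epowr_def)

lemma epowr_ennreal: "0 \<le> r \<Longrightarrow> epowr (ennreal r) a = ennreal (r powr a)"
  by (simp add: epowr_def)

lemma epowr_0 [simp]: "epowr 0 a = 0"
  by (simp add: epowr_def)

lemma epowr_1 [simp]: "epowr x 1 = x"
  by (cases x) (auto simp: epowr_def)

lemma epowr_mono: "x \<le> y \<Longrightarrow> 0 \<le> a \<Longrightarrow> epowr x a \<le> epowr y a"
  by (cases x; cases y) (auto simp: epowr_ennreal powr_mono2 top_unique)

text \<open>Holds for exponents of either sign because \<open>epowr\<close> fixes 0 and infinity
  whatever the exponent; \<open>epowr_epowr\<close> and \<open>epowr_add\<close> rest on the same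
  convention.\<close>

lemma epowr_mult: "epowr (x * y) a = epowr x a * epowr y a"
  by (cases x; cases y)
     (auto simp: epowr_def ennreal_mult_eq_top_iff ennreal_mult[symmetric] powr_mult
        ennreal_mult_top ennreal_top_mult)

lemma epowr_epowr: "epowr (epowr x a) b = epowr x (a * b)"
  by (cases x) (auto simp: epowr_ennreal powr_powr)

lemma epowr_add: "epowr x a * epowr x b = epowr x (a + b)"
  by (cases x) (auto simp: epowr_ennreal powr_add ennreal_mult)

lemma epowr_eq_0_iff [simp]: "epowr x a = 0 \<longleftrightarrow> x = 0"
  by (cases x) (auto simp: epowr_ennreal)

lemma epowr_eq_top_iff [simp]: "epowr x a = top \<longleftrightarrow> x = top"
  by (cases x) (auto simp: epowr_ennreal)

lemma epowr_less_top_iff [simp]: "epowr x a < top \<longleftrightarrow> x < top"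
  by (simp add: less_top[symmetric])

lemma epowr_le_iff:
  assumes "0 < a" shows "epowr x a \<le> y \<longleftrightarrow> x \<le> epowr y (1 / a)"
proof
  assume "epowr x a \<le> y"
  from epowr_mono[OF this, of "1 / a"] assms show "x \<le> epowr y (1 / a)"
    by (simp add: epowr_epowr)
next
  assume "x \<le> epowr y (1 / a)"
  from epowr_mono[OF this, of a] assms show "epowr x a \<le> y"
    by (simp add: epowr_epowr)
qed

text \<open>By \<open>epowr_le_iff\<close> a positive power is an order automorphism of
  [0, infinity] with the power \<open>1 / a\<close> as inverse, hence it preserves suprema.\<close>

lemma epowr_SUP:
  assumes "0 < a" "I \<noteq> {}" shows "epowr (SUP i\<in>I. x i) a = (SUP i\<in>I. epowr (x i) a)"
proof (rule antisym)
  show "epowr (SUP i\<in>I. x i) a \<le> (SUP i\<in>I. epowr (x i) a)"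
    unfolding epowr_le_iff[OF assms(1)]
    by (intro SUP_least) (auto simp: epowr_le_iff[OF assms(1), symmetric] intro: SUP_upper)
  show "(SUP i\<in>I. epowr (x i) a) \<le> epowr (SUP i\<in>I. x i) a"
    using assms by (intro SUP_least epowr_mono SUP_upper) auto
qed

lemma epowr_mult_ennreal: "0 \<le> c \<Longrightarrow> epowr (ennreal c * x) a = ennreal (c powr a) * epowr x a"
  by (simp add: epowr_mult epowr_ennreal)

lemma measurable_epowr [measurable]:
  assumes [measurable]: "f \<in> borel_measurable M"
  shows "(\<lambda>x. epowr (f x) a) \<in> borel_measurable M"
  unfolding epowr_def by measurable

section \<open>Volumes of balls and one-dimensional power integrals\<close>

lemma sigma_finite_finite_balls:
  fixes \<mu> :: "'a::euclidean_space measure"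
  assumes sets: "sets \<mu> = sets lebesgue" and fin: "\<And>r. emeasure \<mu> (ball 0 r) < top"
  shows "sigma_finite_measure \<mu>"
proof
  have sp: "space \<mu> = UNIV"
    using sets_eq_imp_space_eq[OF sets] by simp
  show "\<exists>A. countable A \<and> A \<subseteq> sets \<mu> \<and> \<Union> A = space \<mu> \<and> (\<forall>a\<in>A. emeasure \<mu> a \<noteq> \<infinity>)"
  proof (intro exI conjI)
    show "countable (range (\<lambda>n::nat. ball (0::'a) n))" by simp
    show "range (\<lambda>n::nat. ball (0::'a) n) \<subseteq> sets \<mu>" unfolding sets by auto
    show "\<Union> (range (\<lambda>n::nat. ball (0::'a) n)) = space \<mu>"
      unfolding sp by (auto simp: reals_Archimedean2)
    show "\<forall>a\<in>range (\<lambda>n::nat. ball (0::'a) n). emeasure \<mu> a \<noteq> \<infinity>"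
      using fin by (auto simp: less_top)
  qed
qed

lemma emeasure_lborel_ball:
  fixes c :: "'a::euclidean_space"
  assumes "0 \<le> r"
  shows "emeasure lborel (ball c r) = ennreal (measure lborel (ball (0::'a) 1) * r ^ DIM('a))"
  using assms emeasure_ball[of r c] content_ball[of 1 "0::'a"]
  by simp

lemma emeasure_lborel_ball_less_top: "emeasure lborel (ball (c::'a::euclidean_space) r) < top"
  using emeasure_lborel_ball[of r c] by (cases "0 \<le> r") (auto simp: not_le ball_empty)

lemma emeasure_lborel_ball_pos:
  "0 < r \<Longrightarrow> 0 < emeasure lborel (ball (c::'a::euclidean_space) r)"
  by (simp add: emeasure_lborel_ball)

lemma emeasure_lborel_ball_scale:
  fixes c :: "'a::euclidean_space"
  assumes "0 \<le> r" "0 \<le> t"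
  shows "emeasure lborel (ball c (t * r)) = ennreal (t ^ DIM('a)) * emeasure lborel (ball (c'::'a) r)"
  using assms by (simp add: emeasure_lborel_ball power_mult_distrib ennreal_mult[symmetric] mult_ac)

lemma sigma_finite_lebesgue: "sigma_finite_measure (lebesgue :: 'a::euclidean_space measure)"
  by (intro sigma_finite_finite_balls) (simp_all add: emeasure_lborel_ball_less_top)

lemma nn_integral_powr_0_c:
  assumes "-1 < a" "0 \<le> c"
  shows "(\<integral>\<^sup>+t. ennreal (t powr a) * indicator {0<..<c} t \<partial>lborel) = ennreal (c powr (a + 1) / (a + 1))"
proof -
  have "(\<integral>\<^sup>+t. ennreal (t powr a) * indicator {0<..<c} t \<partial>lborel) =
      (\<integral>\<^sup>+t. ennreal (t powr a) * indicator {0..c} t \<partial>lborel)"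
    using AE_lborel_singleton[of 0] AE_lborel_singleton[of c]
    by (intro nn_integral_cong_AE) (elim AE_mp, auto simp: indicator_def)
  also have "\<dots> = ennreal (c powr (a + 1) / (a + 1))"
    using has_integral_powr_from_0[OF assms]
    by (intro nn_integral_has_integral_lebesgue') auto
  finally show ?thesis .
qed

lemma nn_integral_powr_c_inf:
  assumes "a < -1" "0 < c"
  shows "(\<integral>\<^sup>+t. ennreal (t powr a) * indicator {c<..} t \<partial>lborel) = ennreal (c powr (a + 1) / - (a + 1))"
proof -
  have "(\<integral>\<^sup>+t. ennreal (t powr a) * indicator {c<..} t \<partial>lborel) =
      (\<integral>\<^sup>+t. ennreal (t powr a) * indicator {c..} t \<partial>lborel)"
    using AE_lborel_singleton[of c]
    by (intro nn_integral_cong_AE) (elim AE_mp, auto simp: indicator_def)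
  also have "\<dots> = ennreal (c powr (a + 1) / - (a + 1))"
    using has_integral_powr_to_inf[OF assms]
    by (intro nn_integral_has_integral_lebesgue') (simp_all add: minus_divide_right)
  finally show ?thesis .
qed

text \<open>The pointwise layer cake formula. Writing the range of integration as a set defined by
  \<open>x\<close> includes \<open>x = top\<close>, where the integral diverges at infinity.\<close>

lemma epowr_eq_nn_integral:
  assumes "0 < a"
  shows "epowr x a = (\<integral>\<^sup>+t. ennreal (a * t powr (a - 1)) * indicator {t. 0 < t \<and> ennreal t < x} t \<partial>lborel)"
proof (cases x)
  case (real r)
  have eq: "{t. 0 < t \<and> ennreal t < x} = {0<..<r}"
    using real by (auto simp: ennreal_less_iff)
  have "(\<integral>\<^sup>+t. ennreal (a * t powr (a - 1)) * indicator {0<..<r} t \<partial>lborel) =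
      (\<integral>\<^sup>+t. ennreal a * (ennreal (t powr (a - 1)) * indicator {0<..<r} t) \<partial>lborel)"
    using assms by (simp add: ennreal_mult mult.assoc)
  also have "\<dots> = ennreal a * ennreal (r powr a / a)"
    using nn_integral_powr_0_c[of "a - 1" r] assms real
    by (subst nn_integral_cmult) auto
  also have "\<dots> = epowr x a"
    using assms real by (simp add: ennreal_mult[symmetric] epowr_ennreal)
  finally show ?thesis unfolding eq ..
next
  case top
  have eq: "{t. 0 < t \<and> ennreal t < x} = {0<..}"
    using top by (auto)
  \<comment> \<open>The integral over (0, infinity) exceeds the one over (0, n), which is n^a;
    letting n grow shows that it is infinite.\<close>
  have "ennreal (real n powr a) \<le> (\<integral>\<^sup>+t. ennreal (a * t powr (a - 1)) * indicator {0<..} t \<partial>lborel)" for n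
  proof -
    have "ennreal (real n powr a) = ennreal a * ennreal (real n powr a / a)"
      using assms by (simp add: ennreal_mult[symmetric])
    also have "\<dots> = (\<integral>\<^sup>+t. ennreal a * (ennreal (t powr (a - 1)) * indicator {0<..<real n} t) \<partial>lborel)"
      using nn_integral_powr_0_c[of "a - 1" n] assms
      by (subst nn_integral_cmult) auto
    also have "\<dots> \<le> (\<integral>\<^sup>+t. ennreal (a * t powr (a - 1)) * indicator {0<..} t \<partial>lborel)"
      using assms by (intro nn_integral_mono) (auto simp: ennreal_mult indicator_def)
    finally show ?thesis .
  qed
  moreover have "filterlim (\<lambda>n::nat. real n powr a) at_top sequentially"
    using assms by real_asymp
  then have "((\<lambda>n::nat. ennreal (real n powr a)) \<longlongrightarrow> top) sequentially"
    by (simp add: ennreal_tendsto_top_eq_at_top)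
  ultimately have "top \<le> (\<integral>\<^sup>+t. ennreal (a * t powr (a - 1)) * indicator {0<..} t \<partial>lborel)"
    by (intro LIMSEQ_le_const2[of _ top]) auto
  then show ?thesis unfolding eq using top by (simp add: top_unique)
qed

section \<open>The maximal operator of a doubling measure\<close>

text \<open>Tonelli's theorem in the shape needed by interpolation: it is used forwards with
  \<open>f = 1\<close> on the maximal function, and backwards on \<open>f\<close> itself after the
  weak type bound.\<close>

lemma layer_cake_exchange:
  assumes "sigma_finite_measure M"
  assumes [measurable]: "\<phi> \<in> borel_measurable borel" "f \<in> borel_measurable M" "h \<in> borel_measurable M"
  shows "(\<integral>\<^sup>+x. f x * (\<integral>\<^sup>+t. \<phi> t * indicator {t. 0 < t \<and> ennreal t < h x} t \<partial>lborel) \<partial>M) =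
    (\<integral>\<^sup>+t. \<phi> t * indicator {0<..} t * (\<integral>\<^sup>+x. f x * indicator {x. ennreal t < h x} x \<partial>M) \<partial>lborel)"
proof -
  interpret M: sigma_finite_measure M by fact
  interpret pair_sigma_finite lborel M ..
  have eq: "indicator {t. 0 < t \<and> ennreal t < h x} t = (indicator {t. 0 < t} t * indicator {x. ennreal t < h x} x :: ennreal)" for x t
    by (auto simp: indicator_def)
  have [measurable]: "Measurable.pred (lborel \<Otimes>\<^sub>M M) (\<lambda>x. ennreal (fst x) < h (snd x))"
    by measurable
  have "(\<integral>\<^sup>+x. f x * (\<integral>\<^sup>+t. \<phi> t * indicator {t. 0 < t \<and> ennreal t < h x} t \<partial>lborel) \<partial>M) =
    (\<integral>\<^sup>+x. (\<integral>\<^sup>+t. f x * (\<phi> t * (indicator {t. 0 < t} t * indicator {x. ennreal t < h x} x)) \<partial>lborel) \<partial>M)"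
    unfolding eq by (subst nn_integral_cmult) auto
  also have "\<dots> = (\<integral>\<^sup>+t. (\<integral>\<^sup>+x. f x * (\<phi> t * (indicator {t. 0 < t} t * indicator {x. ennreal t < h x} x)) \<partial>M) \<partial>lborel)"
    by (rule Fubini') measurable
  also have "\<dots> = (\<integral>\<^sup>+t. (\<integral>\<^sup>+x. \<phi> t * indicator {0<..} t * (f x * indicator {x. ennreal t < h x} x) \<partial>M) \<partial>lborel)"
    by (intro nn_integral_cong) (auto simp: indicator_def mult_ac)
  also have "\<dots> = (\<integral>\<^sup>+t. \<phi> t * indicator {0<..} t * (\<integral>\<^sup>+x. f x * indicator {x. ennreal t < h x} x \<partial>M) \<partial>lborel)"
    by (subst nn_integral_cmult) auto
  finally show ?thesis .
qed

text \<open>Positivity and finiteness on balls are part of the notion, so that the quotients in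
  \<open>maxop\<close> are genuine averages.\<close>

definition doubling :: "real \<Rightarrow> 'a::euclidean_space measure \<Rightarrow> bool" where
  "doubling D \<mu> \<longleftrightarrow> 0 \<le> D \<and> sets \<mu> = sets lebesgue \<and>
     (\<forall>c r. 0 < r \<longrightarrow> 0 < emeasure \<mu> (ball c r) \<and> emeasure \<mu> (ball c r) < top \<and>
        emeasure \<mu> (ball c (2 * r)) \<le> ennreal D * emeasure \<mu> (ball c r))"

text \<open>The uncentred Hardy-Littlewood maximal operator with respect to \<open>\<mu>\<close>.
  Being uncentred, it has open superlevel sets, and one average bounds it from below at every point
  of the ball.\<close>

definition maxop :: "'a::euclidean_space measure \<Rightarrow> ('a \<Rightarrow> ennreal) \<Rightarrow> 'a \<Rightarrow> ennreal" where
  "maxop \<mu> f x = (SUP (c, r) \<in> {(c, r). x \<in> ball c r}.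
     (\<integral>\<^sup>+y\<in>ball c r. f y \<partial>\<mu>) / emeasure \<mu> (ball c r))"

lemma maxop_upper:
  "x \<in> ball c r \<Longrightarrow> (\<integral>\<^sup>+y\<in>ball c r. f y \<partial>\<mu>) / emeasure \<mu> (ball c r) \<le> maxop \<mu> f x"
  unfolding maxop_def by (rule SUP_upper2[of "(c, r)"]) auto

lemma maxop_least:
  "(\<And>c r. 0 < r \<Longrightarrow> x \<in> ball c r \<Longrightarrow> (\<integral>\<^sup>+y\<in>ball c r. f y \<partial>\<mu>) / emeasure \<mu> (ball c r) \<le> b) \<Longrightarrow> maxop \<mu> f x \<le> b"
  unfolding maxop_def by (rule SUP_least) (auto, metis dist_not_less_zero le_less_trans linorder_not_less mem_ball)

lemma less_maxop_iff:
  "t < maxop \<mu> f x \<longleftrightarrow> (\<exists>c r. x \<in> ball c r \<and> t < (\<integral>\<^sup>+y\<in>ball c r. f y \<partial>\<mu>) / emeasure \<mu> (ball c r))"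
  unfolding maxop_def by (auto simp: less_SUP_iff)

text \<open>A superlevel set is the union of the balls whose average exceeds \<open>t\<close>; this
  is the source of the measurability of \<open>maxop \<mu> f\<close>.\<close>

lemma open_maxop_greater: "open {x. t < maxop \<mu> f x}"
proof -
  have "{x. t < maxop \<mu> f x} =
      \<Union> {ball c r |c r. t < (\<integral>\<^sup>+y\<in>ball c r. f y \<partial>\<mu>) / emeasure \<mu> (ball c r)}"
    unfolding less_maxop_iff by blast
  then show ?thesis by auto
qed

lemma open_in_sets_lebesgue: "open S \<Longrightarrow> S \<in> sets lebesgue"
  by (simp add: sets_completionI_sets)

lemma measurable_maxop [measurable]: "maxop \<mu> f \<in> borel_measurable lebesgue"
  by (rule borel_measurableI_greater) (simp add: open_in_sets_lebesgue open_maxop_greater)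

lemma doubling_sigma_finite: "doubling D \<mu> \<Longrightarrow> sigma_finite_measure \<mu>"
  unfolding doubling_def
  by (rule sigma_finite_finite_balls, blast)
     (metis ball_empty emeasure_empty ennreal_zero_less_top linorder_not_less)

lemma doubling_ball_5:
  assumes "doubling D \<mu>" "0 < r"
  shows "emeasure \<mu> (ball c (5 * r)) \<le> ennreal (D ^ 3) * emeasure \<mu> (ball c r)"
proof -
  have D: "0 \<le> D" and sets: "sets \<mu> = sets lebesgue"
    using assms unfolding doubling_def by auto
  have step: "emeasure \<mu> (ball c (2 * s)) \<le> ennreal D * emeasure \<mu> (ball c s)" if "0 < s" for s
    using assms that unfolding doubling_def by auto
  have "emeasure \<mu> (ball c (5 * r)) \<le> emeasure \<mu> (ball c (2 * (2 * (2 * r))))"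
    using assms(2) by (intro emeasure_mono) (auto simp: sets)
  also have "\<dots> \<le> ennreal D * (ennreal D * (ennreal D * emeasure \<mu> (ball c r)))"
    using assms(2) by (intro order_trans[OF step] mult_left_mono) auto
  also have "\<dots> = ennreal (D ^ 3) * emeasure \<mu> (ball c r)"
  proof -
    have "ennreal (D ^ 3) = ennreal D * (ennreal D * ennreal D)"
      using D by (simp add: power3_eq_cube ennreal_mult mult.assoc)
    then show ?thesis by (simp add: mult.assoc)
  qed
  finally show ?thesis .
qed

text \<open>Vitali's lemma selects disjoint balls whose fivefold dilates cover the union. Each
  dilate costs \<open>D ^ 3\<close>, and the integrals over disjoint balls add up to at most the
  full integral. The covering lemma wants bounded radii, hence \<open>R\<close>.\<close>

lemma weak_type_bounded_radii:
  fixes \<mu> :: "'a::euclidean_space measure" and t :: ennreal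
  assumes \<mu>: "doubling D \<mu>" and [measurable]: "f \<in> borel_measurable \<mu>"
  defines "K R \<equiv> {(c, r). 0 < r \<and> r \<le> R \<and> t * emeasure \<mu> (ball c r) \<le> (\<integral>\<^sup>+y\<in>ball c r. f y \<partial>\<mu>)}"
  shows "t * emeasure \<mu> (\<Union>(c, r)\<in>K R. ball c r) \<le> ennreal (D ^ 3) * (\<integral>\<^sup>+y. f y \<partial>\<mu>)"
proof -
  have D: "0 \<le> D" and sets [measurable_cong]: "sets \<mu> = sets lebesgue"
    using \<mu> unfolding doubling_def by auto
  have b [measurable]: "ball c r \<in> sets \<mu>" for c r by (simp add: sets)
  obtain C where C: "countable C" "C \<subseteq> K R"
    and disj: "pairwise (\<lambda>i j. disjnt (ball (fst i) (snd i)) (ball (fst j) (snd j))) C"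
    and cov: "(\<Union>(c, r)\<in>K R. ball c r) \<subseteq> (\<Union>i\<in>C. ball (fst i) (5 * snd i))"
  proof (rule Vitali_covering_lemma_balls[where S = "\<Union>(c, r)\<in>K R. ball c r" and K = "K R" and a = fst and r = snd and B = R])
    show "(\<Union>(c, r)\<in>K R. ball c r) \<subseteq> (\<Union>i\<in>K R. ball (fst i) (snd i))" by auto
    show "0 < snd i \<and> snd i \<le> R" if "i \<in> K R" for i using that by (auto simp: K_def)
  qed (rule that)
  have djf: "disjoint_family_on (\<lambda>i. ball (fst i) (snd i)) C"
    using disj by (auto simp: disjoint_family_on_def pairwise_def disjnt_def)
  have "t * emeasure \<mu> (\<Union>(c, r)\<in>K R. ball c r) \<le> t * emeasure \<mu> (\<Union>i\<in>C. ball (fst i) (5 * snd i))"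
    using cov C by (intro mult_left_mono emeasure_mono sets.countable_UN') auto
  also have "emeasure \<mu> (\<Union>i\<in>C. ball (fst i) (5 * snd i)) =
      (\<integral>\<^sup>+y. indicator (\<Union>i\<in>C. ball (fst i) (5 * snd i)) y \<partial>\<mu>)"
    using C by (subst nn_integral_indicator) auto
  \<comment> \<open>Countable subadditivity, written with integrals over
    \<open>count_space C\<close> so that sum and integral can be exchanged.\<close>
  also have "\<dots> \<le> (\<integral>\<^sup>+y. \<integral>\<^sup>+i. indicator (ball (fst i) (5 * snd i)) y \<partial>count_space C \<partial>\<mu>)"
  proof (intro nn_integral_mono)
    fix y
    show "indicator (\<Union>i\<in>C. ball (fst i) (5 * snd i)) y \<le>
        (\<integral>\<^sup>+i. indicator (ball (fst i) (5 * snd i)) y \<partial>count_space C :: ennreal)"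
    proof (cases "y \<in> (\<Union>i\<in>C. ball (fst i) (5 * snd i))")
      case True
      then obtain i where i: "i \<in> C" "y \<in> ball (fst i) (5 * snd i)" by blast
      have "indicator (\<Union>i\<in>C. ball (fst i) (5 * snd i)) y =
          (indicator (ball (fst i) (5 * snd i)) y :: ennreal)"
        by (simp only: indicator_simps(1)[OF True] indicator_simps(1)[OF i(2)])
      also have "\<dots> \<le> (\<integral>\<^sup>+i. indicator (ball (fst i) (5 * snd i)) y \<partial>count_space C)"
        using i(1) by (rule nn_integral_ge_point)
      finally show ?thesis .
    qed auto
  qed
  also have "\<dots> = (\<integral>\<^sup>+i. \<integral>\<^sup>+y. indicator (ball (fst i) (5 * snd i)) y \<partial>\<mu> \<partial>count_space C)"
    by (rule nn_integral_count_space_nn_integral) (use C in auto)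
  also have "\<dots> \<le> (\<integral>\<^sup>+i. ennreal (D ^ 3) * emeasure \<mu> (ball (fst i) (snd i)) \<partial>count_space C)"
    using C doubling_ball_5[OF \<mu>] by (intro nn_integral_mono) (auto simp: K_def)
  finally have "t * emeasure \<mu> (\<Union>(c, r)\<in>K R. ball c r) \<le>
     t * (\<integral>\<^sup>+i. ennreal (D ^ 3) * emeasure \<mu> (ball (fst i) (snd i)) \<partial>count_space C)"
    by (simp add: mult_left_mono)
  also have "\<dots> = ennreal (D ^ 3) * (\<integral>\<^sup>+i. t * emeasure \<mu> (ball (fst i) (snd i)) \<partial>count_space C)"
    by (simp add: nn_integral_cmult mult_ac)
  also have "\<dots> \<le> ennreal (D ^ 3) * (\<integral>\<^sup>+i. emeasure (density \<mu> f) (ball (fst i) (snd i)) \<partial>count_space C)"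
    using C by (intro mult_left_mono nn_integral_mono) (auto simp: K_def emeasure_density)
  also have "(\<integral>\<^sup>+i. emeasure (density \<mu> f) (ball (fst i) (snd i)) \<partial>count_space C) =
      emeasure (density \<mu> f) (\<Union>i\<in>C. ball (fst i) (snd i))"
    by (rule emeasure_UN_countable[symmetric]) (use C djf in auto)
  also have "\<dots> \<le> emeasure (density \<mu> f) (space \<mu>)"
    by (metis emeasure_space space_density)
  also have "\<dots> = (\<integral>\<^sup>+y. f y \<partial>\<mu>)"
    by (subst emeasure_density) (auto intro!: nn_integral_cong)
  finally show ?thesis by (simp add: mult_left_mono)
qed

text \<open>Every ball with a large average belongs to some \<open>K (real n)\<close>, so continuity
  from below along \<open>S n\<close> removes the bound on the radii.\<close>

lemma weak_type_maxop:
  fixes \<mu> :: "'a::euclidean_space measure"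
  assumes \<mu>: "doubling D \<mu>" and f [measurable]: "f \<in> borel_measurable \<mu>"
  shows "t * emeasure \<mu> {x. t < maxop \<mu> f x} \<le> ennreal (D ^ 3) * (\<integral>\<^sup>+y. f y \<partial>\<mu>)"
proof -
  define K where "K R = {(c, r). 0 < r \<and> r \<le> R \<and> t * emeasure \<mu> (ball c r) \<le> (\<integral>\<^sup>+y\<in>ball c r. f y \<partial>\<mu>)}" for R
  define S where "S n = (\<Union>(c, r)\<in>K (real n). ball c r)" for n
  have D: "0 \<le> D" and sets: "sets \<mu> = sets lebesgue"
    and ball: "\<And>c r. 0 < r \<Longrightarrow> 0 < emeasure \<mu> (ball c r) \<and> emeasure \<mu> (ball c r) < top"
    using \<mu> unfolding doubling_def by auto
  have S: "S n \<in> sets \<mu>" for n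
    unfolding S_def sets by (intro open_in_sets_lebesgue) auto
  have "emeasure \<mu> {x. t < maxop \<mu> f x} \<le> emeasure \<mu> (\<Union>n. S n)"
  proof (intro emeasure_mono)
    show "{x. t < maxop \<mu> f x} \<subseteq> (\<Union>n. S n)"
    proof
      fix x assume "x \<in> {x. t < maxop \<mu> f x}"
      then obtain c r where cr: "x \<in> ball c r" "t < (\<integral>\<^sup>+y\<in>ball c r. f y \<partial>\<mu>) / emeasure \<mu> (ball c r)"
        by (auto simp: less_maxop_iff)
      have r: "0 < r" using cr(1) by (metis ball_empty empty_iff not_le)
      have "t * emeasure \<mu> (ball c r) \<le> (\<integral>\<^sup>+y\<in>ball c r. f y \<partial>\<mu>) / emeasure \<mu> (ball c r) * emeasure \<mu> (ball c r)"
        using cr(2) by (intro mult_right_mono) auto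
      also have "\<dots> = (\<integral>\<^sup>+y\<in>ball c r. f y \<partial>\<mu>)"
        using ball[OF r, of c] by (simp add: ennreal_divide_times less_imp_neq[symmetric])
      finally have "(c, r) \<in> K (real (nat \<lceil>r\<rceil>))"
        using r by (auto simp: K_def)
      then show "x \<in> (\<Union>n. S n)" unfolding S_def using cr(1) by blast
    qed
    show "(\<Union>n. S n) \<in> sets \<mu>" using S by auto
  qed
  also have "\<dots> = (SUP n. emeasure \<mu> (S n))"
    using S by (intro SUP_emeasure_incseq[symmetric]) (force simp: incseq_def S_def K_def)+
  finally have "t * emeasure \<mu> {x. t < maxop \<mu> f x} \<le> (SUP n. t * emeasure \<mu> (S n))"
    by (simp add: SUP_mult_left_ennreal[symmetric] mult_left_mono)
  also have "\<dots> \<le> ennreal (D ^ 3) * (\<integral>\<^sup>+y. f y \<partial>\<mu>)"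
    unfolding S_def K_def by (intro SUP_least weak_type_bounded_radii[OF \<mu> f])
  finally show ?thesis .
qed

text \<open>The average of a constant is at most that constant. In the interpolation argument
  \<open>g\<close> is the part of \<open>f\<close> above a level and \<open>b\<close> bounds the
  rest.\<close>

lemma maxop_le_add_const:
  assumes f [measurable]: "f \<in> borel_measurable lebesgue" and g [measurable]: "g \<in> borel_measurable lebesgue"
    and sets [measurable_cong]: "sets \<mu> = sets lebesgue"
    and le: "\<And>x. f x \<le> g x + b"
  shows "maxop \<mu> f x \<le> maxop \<mu> g x + b"
proof (rule maxop_least)
  fix c r assume x: "x \<in> ball c r"
  have [measurable]: "ball c r \<in> sets \<mu>" by (simp add: sets)
  have "(\<integral>\<^sup>+y\<in>ball c r. f y \<partial>\<mu>) \<le> (\<integral>\<^sup>+y. g y * indicator (ball c r) y + b * indicator (ball c r) y \<partial>\<mu>)"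
    by (intro nn_integral_mono) (use le in \<open>auto simp: indicator_def\<close>)
  also have "\<dots> = (\<integral>\<^sup>+y\<in>ball c r. g y \<partial>\<mu>) + b * emeasure \<mu> (ball c r)"
    by (subst nn_integral_add) (auto simp: nn_integral_cmult)
  finally have "(\<integral>\<^sup>+y\<in>ball c r. f y \<partial>\<mu>) / emeasure \<mu> (ball c r) \<le>
      (\<integral>\<^sup>+y\<in>ball c r. g y \<partial>\<mu>) / emeasure \<mu> (ball c r) + b * emeasure \<mu> (ball c r) / emeasure \<mu> (ball c r)"
    by (simp only: add_divide_distrib_ennreal[symmetric] divide_right_mono_ennreal)
  also have "b * emeasure \<mu> (ball c r) / emeasure \<mu> (ball c r) \<le> b"
  proof (cases "emeasure \<mu> (ball c r) = 0 \<or> emeasure \<mu> (ball c r) = top")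
    case False
    then have "emeasure \<mu> (ball c r) / emeasure \<mu> (ball c r) = 1"
      by (intro ennreal_divide_self) (auto simp: less_top)
    then show ?thesis
      by (metis ennreal_times_divide mult.right_neutral order_refl)
  qed auto
  finally show "(\<integral>\<^sup>+y\<in>ball c r. f y \<partial>\<mu>) / emeasure \<mu> (ball c r) \<le> maxop \<mu> g x + b"
    using maxop_upper[OF x, where f = g and \<mu> = \<mu>] by (auto intro: order_trans add_mono)
qed

text \<open>Marcinkiewicz interpolation between weak type (1,1) and the trivial bound on bounded
  functions: at height \<open>t\<close> only the part of \<open>f\<close> above \<open>t / 2\<close>
  matters, and integration in \<open>t\<close> produces the factor 1/(q-1).\<close>

theorem strong_type_maxop:
  fixes \<mu> :: "'a::euclidean_space measure"
  assumes \<mu>: "doubling D \<mu>" and f: "f \<in> borel_measurable lebesgue" and q: "1 < q"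
  shows "(\<integral>\<^sup>+x. epowr (maxop \<mu> f x) q \<partial>\<mu>) \<le>
    ennreal (2 powr q * q * D ^ 3 / (q - 1)) * (\<integral>\<^sup>+x. epowr (f x) q \<partial>\<mu>)"
proof -
  have D: "0 \<le> D" and sets [measurable_cong]: "sets \<mu> = sets lebesgue"
    using \<mu> unfolding doubling_def by auto
  note [measurable] = f
  have weak: "ennreal (q * t powr (q - 1)) * indicator {0<..} t * (\<integral>\<^sup>+x. 1 * indicator {x. ennreal t < maxop \<mu> f x} x \<partial>\<mu>)
     \<le> ennreal (2 * q * D ^ 3 / (q - 1)) * (ennreal ((q - 1) * t powr (q - 1 - 1)) * indicator {0<..} t * (\<integral>\<^sup>+x. f x * indicator {x. ennreal t < 2 * f x} x \<partial>\<mu>))"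
    for t
  proof (cases "0 < t")
    case t: True
    let ?g = "\<lambda>x. f x * indicator {x. ennreal t < 2 * f x} x"
    have half: "ennreal t = ennreal (t/2) + ennreal (t/2)"
      using t by (simp flip: ennreal_plus)
    have le: "f x \<le> ?g x + ennreal (t / 2)" for x
    proof (cases "ennreal t < 2 * f x")
      case False
      then have "2 * f x \<le> 2 * ennreal (t/2)" using half by (simp add: mult_2)
      then have "f x \<le> ennreal (t/2)" by (subst (asm) ennreal_mult_le_mult_iff) auto
      then show ?thesis by (simp add: add_increasing)
    qed auto
    have [measurable]: "Measurable.pred lebesgue (\<lambda>x. ennreal t < 2 * f x)" by measurable
    have sub: "{x. ennreal t < maxop \<mu> f x} \<subseteq> {x. ennreal (t/2) < maxop \<mu> ?g x}"
    proof
      fix x assume "x \<in> {x. ennreal t < maxop \<mu> f x}"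
      moreover have "maxop \<mu> f x \<le> maxop \<mu> ?g x + ennreal (t / 2)"
        by (rule maxop_le_add_const[OF _ _ sets le]) measurable
      ultimately have *: "ennreal (t/2) + ennreal (t/2) < maxop \<mu> ?g x + ennreal (t / 2)"
        unfolding half[symmetric] by (auto intro: less_le_trans)
      have "\<not> maxop \<mu> ?g x \<le> ennreal (t/2)"
        using * add_right_mono[of "maxop \<mu> ?g x" "ennreal (t/2)" "ennreal (t/2)"] by (meson leD)
      then show "x \<in> {x. ennreal (t/2) < maxop \<mu> ?g x}"
        by (simp add: not_le)
    qed
    have op: "{x. s < maxop \<mu> h x} \<in> sets \<mu>" for s h
      unfolding sets by (intro open_in_sets_lebesgue open_maxop_greater)
    have "ennreal (t/2) * emeasure \<mu> {x. ennreal t < maxop \<mu> f x} \<le>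
        ennreal (t/2) * emeasure \<mu> {x. ennreal (t/2) < maxop \<mu> ?g x}"
      using sub op by (intro mult_left_mono emeasure_mono) auto
    also have "\<dots> \<le> ennreal (D ^ 3) * (\<integral>\<^sup>+x. ?g x \<partial>\<mu>)"
      by (rule weak_type_maxop[OF \<mu>]) measurable
    finally have *: "ennreal (t/2) * emeasure \<mu> {x. ennreal t < maxop \<mu> f x} \<le> ennreal (D ^ 3) * (\<integral>\<^sup>+x. ?g x \<partial>\<mu>)" .
    \<comment> \<open>Dividing the weak bound by t/2 lowers the exponent of \<open>t\<close> from q
      - 1 to q - 2, which is the one in the layer cake formula for the power q - 1.\<close>
    have "q * t powr (q - 1) = (2 * q * t powr (q - 1 - 1)) * (t / 2)"
      using t by (simp add: powr_diff field_simps power2_eq_square)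
    then have "ennreal (q * t powr (q - 1)) = ennreal (2 * q * t powr (q - 1 - 1)) * ennreal (t / 2)"
      using q t by (metis ennreal_mult' mult_nonneg_nonneg less_le powr_ge_zero zero_le_numeral zero_less_one le_less_trans)
    then have "ennreal (q * t powr (q - 1)) * emeasure \<mu> {x. ennreal t < maxop \<mu> f x} =
        ennreal (2 * q * t powr (q - 1 - 1)) * (ennreal (t/2) * emeasure \<mu> {x. ennreal t < maxop \<mu> f x})"
      by (simp add: mult_ac)
    also have "\<dots> \<le> ennreal (2 * q * t powr (q - 1 - 1)) * (ennreal (D ^ 3) * (\<integral>\<^sup>+x. ?g x \<partial>\<mu>))"
      by (rule mult_left_mono[OF *]) auto
    also have "ennreal (2 * q * t powr (q - 1 - 1)) * (ennreal (D ^ 3) * (\<integral>\<^sup>+x. ?g x \<partial>\<mu>)) =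
       ennreal ((2 * q * D ^ 3 / (q - 1)) * ((q - 1) * t powr (q - 1 - 1))) * (\<integral>\<^sup>+x. ?g x \<partial>\<mu>)"
    proof -
      have "2 * q * t powr (q - 1 - 1) * D ^ 3 = (2 * q * D ^ 3 / (q - 1)) * ((q - 1) * t powr (q - 1 - 1))"
        using q by simp
      moreover have "ennreal (2 * q * t powr (q - 1 - 1)) * ennreal (D ^ 3) = ennreal (2 * q * t powr (q - 1 - 1) * D ^ 3)"
        using q D by (intro ennreal_mult[symmetric]) auto
      ultimately show ?thesis by (simp only: mult.assoc[symmetric])
    qed
    also have "\<dots> = ennreal (2 * q * D ^ 3 / (q - 1)) * (ennreal ((q - 1) * t powr (q - 1 - 1)) * (\<integral>\<^sup>+x. ?g x \<partial>\<mu>))"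
      using q D by (subst ennreal_mult) (auto simp: mult_ac)
    finally show ?thesis
      using t op[of "ennreal t" f] by (simp add: nn_integral_indicator)
  qed auto
  have "(\<integral>\<^sup>+x. epowr (maxop \<mu> f x) q \<partial>\<mu>) =
     (\<integral>\<^sup>+x. 1 * (\<integral>\<^sup>+t. ennreal (q * t powr (q - 1)) * indicator {t. 0 < t \<and> ennreal t < maxop \<mu> f x} t \<partial>lborel) \<partial>\<mu>)"
    using q by (simp add: epowr_eq_nn_integral)
  also have "\<dots> = (\<integral>\<^sup>+t. ennreal (q * t powr (q - 1)) * indicator {0<..} t * (\<integral>\<^sup>+x. 1 * indicator {x. ennreal t < maxop \<mu> f x} x \<partial>\<mu>) \<partial>lborel)"
    by (rule layer_cake_exchange[OF doubling_sigma_finite[OF \<mu>]]) measurable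
  also have "\<dots> \<le> (\<integral>\<^sup>+t. ennreal (2 * q * D ^ 3 / (q - 1)) * (ennreal ((q - 1) * t powr (q - 1 - 1)) * indicator {0<..} t * (\<integral>\<^sup>+x. f x * indicator {x. ennreal t < 2 * f x} x \<partial>\<mu>)) \<partial>lborel)"
    by (intro nn_integral_mono weak)
  also have "\<dots> = ennreal (2 * q * D ^ 3 / (q - 1)) * (\<integral>\<^sup>+t. (ennreal ((q - 1) * t powr (q - 1 - 1)) * indicator {0<..} t * (\<integral>\<^sup>+x. f x * indicator {x. ennreal t < 2 * f x} x \<partial>\<mu>)) \<partial>lborel)"
  proof (rule nn_integral_cmult)
    interpret sigma_finite_measure \<mu> by (rule doubling_sigma_finite[OF \<mu>])
    show "(\<lambda>t. ennreal ((q - 1) * t powr (q - 1 - 1)) * indicator {0<..} t * (\<integral>\<^sup>+x. f x * indicator {x. ennreal t < 2 * f x} x \<partial>\<mu>)) \<in> borel_measurable lborel"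
      by measurable
  qed
  also have "(\<integral>\<^sup>+t. (ennreal ((q - 1) * t powr (q - 1 - 1)) * indicator {0<..} t * (\<integral>\<^sup>+x. f x * indicator {x. ennreal t < 2 * f x} x \<partial>\<mu>)) \<partial>lborel) =
      (\<integral>\<^sup>+x. f x * (\<integral>\<^sup>+t. ennreal ((q - 1) * t powr (q - 1 - 1)) * indicator {t. 0 < t \<and> ennreal t < 2 * f x} t \<partial>lborel) \<partial>\<mu>)"
    by (rule layer_cake_exchange[OF doubling_sigma_finite[OF \<mu>], symmetric]) measurable
  \<comment> \<open>The layer cake formula for \<open>2 * f x\<close> with exponent q - 1; the
    remaining factor \<open>f x\<close> restores the power q.\<close>
  also have "\<dots> = (\<integral>\<^sup>+x. ennreal (2 powr (q - 1)) * epowr (f x) q \<partial>\<mu>)"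
  proof (intro nn_integral_cong)
    fix x
    have "f x * epowr (2 * f x) (q - 1) = ennreal (2 powr (q - 1)) * (epowr (f x) 1 * epowr (f x) (q - 1))"
      using epowr_mult_ennreal[of 2 "f x" "q - 1"] by (simp add: mult_ac)
    also have "\<dots> = ennreal (2 powr (q - 1)) * epowr (f x) q"
      by (simp only: epowr_add) simp
    finally show "f x * (\<integral>\<^sup>+t. ennreal ((q - 1) * t powr (q - 1 - 1)) * indicator {t. 0 < t \<and> ennreal t < 2 * f x} t \<partial>lborel) = ennreal (2 powr (q - 1)) * epowr (f x) q"
      using q by (subst epowr_eq_nn_integral[symmetric]) auto
  qed
  also have "\<dots> = ennreal (2 powr (q - 1)) * (\<integral>\<^sup>+x. epowr (f x) q \<partial>\<mu>)"
    by (rule nn_integral_cmult) measurable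
  also have "ennreal (2 * q * D ^ 3 / (q - 1)) * (ennreal (2 powr (q - 1)) * (\<integral>\<^sup>+x. epowr (f x) q \<partial>\<mu>)) =
     ennreal (2 powr q * q * D ^ 3 / (q - 1)) * (\<integral>\<^sup>+x. epowr (f x) q \<partial>\<mu>)"
  proof -
    have "2 * q * D ^ 3 / (q - 1) * 2 powr (q - 1) = 2 powr q * q * D ^ 3 / (q - 1)"
      using q by (simp add: powr_diff field_simps)
    moreover have "ennreal (2 * q * D ^ 3 / (q - 1)) * ennreal (2 powr (q - 1)) = ennreal (2 * q * D ^ 3 / (q - 1) * 2 powr (q - 1))"
      using q D by (intro ennreal_mult[symmetric]) auto
    ultimately show ?thesis by (simp only: mult.assoc[symmetric])
  qed
  finally show ?thesis .
qed

section \<open>Muckenhoupt's theorem\<close>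

lemma sets_lebesgue_ball [measurable]: "ball c r \<in> sets lebesgue"
  by simp

text \<open>Hoelder's inequality |E|^p \<le> w(E) \<sigma>(E)^(p-1) up to the factor 2^p.
  Integrating 1 \<le> s w + s^(-1/(p-1)) \<sigma> over \<open>E\<close> bounds |E| for each s > 0,
  and a suitable \<open>s\<close> makes the first term |E|/2.\<close>

lemma epowr_emeasure_le_dual:
  assumes [measurable]: "w \<in> borel_measurable M" "\<sigma> \<in> borel_measurable M" "E \<in> sets M"
    and p: "1 < p" and fin: "emeasure M E < top"
    and w: "AE x in M. x \<in> E \<longrightarrow> 0 < w x \<and> 0 < \<sigma> x \<and> 1 \<le> w x * \<sigma> x powr (p - 1)"
  shows "epowr (emeasure M E) p \<le> ennreal (2 powr p) *
    ((\<integral>\<^sup>+x\<in>E. ennreal (w x) \<partial>M) * epowr (\<integral>\<^sup>+x\<in>E. ennreal (\<sigma> x) \<partial>M) (p - 1))"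
    (is "_ \<le> _ * (?W * epowr ?S _)")
proof -
  have bound: "emeasure M E \<le> ennreal s * ?W + ennreal (s powr (- 1 / (p - 1))) * ?S" if s: "0 < s" for s
  proof -
    have "emeasure M E = (\<integral>\<^sup>+x. indicator E x \<partial>M)" by simp
    also have "\<dots> \<le> (\<integral>\<^sup>+x. ennreal s * (ennreal (w x) * indicator E x) + ennreal (s powr (- 1 / (p - 1))) * (ennreal (\<sigma> x) * indicator E x) \<partial>M)"
    proof (intro nn_integral_mono_AE, use w in eventually_elim)
      fix x assume x: "x \<in> E \<longrightarrow> 0 < w x \<and> 0 < \<sigma> x \<and> 1 \<le> w x * \<sigma> x powr (p - 1)"
      have "1 \<le> s * w x + s powr (- 1 / (p - 1)) * \<sigma> x" if "x \<in> E"
      proof (cases "1 \<le> s * w x")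
        case True
        moreover have "0 \<le> s powr (- 1 / (p - 1)) * \<sigma> x" using x that by simp
        ultimately show ?thesis by linarith
      next
        case False
        \<comment> \<open>If s w < 1, then w \<sigma>^(p-1) \<ge> 1 forces s \<le>
          \<sigma>^(p-1).\<close>
        have "s * 1 \<le> s * (w x * \<sigma> x powr (p - 1))" using x that s by (intro mult_left_mono) auto
        also have "\<dots> = (s * w x) * \<sigma> x powr (p - 1)" by simp
        also have "\<dots> \<le> 1 * \<sigma> x powr (p - 1)" using False by (intro mult_right_mono) auto
        finally have "s powr (1 / (p - 1)) \<le> (\<sigma> x powr (p - 1)) powr (1 / (p - 1))"
          using s p by (intro powr_mono2) auto
        also have "\<dots> = \<sigma> x" using x that p by (simp add: powr_powr)
        finally have "1 \<le> s powr (- 1 / (p - 1)) * \<sigma> x"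
          using s by (simp add: powr_minus field_simps)
        moreover have "0 \<le> s * w x" using x that s by simp
        ultimately show ?thesis by linarith
      qed
      then show "indicator E x \<le> ennreal s * (ennreal (w x) * indicator E x) + ennreal (s powr (- 1 / (p - 1))) * (ennreal (\<sigma> x) * indicator E x)"
        using x s by (auto simp: indicator_def ennreal_mult[symmetric] ennreal_plus[symmetric] simp del: ennreal_plus)
    qed
    also have "\<dots> = ennreal s * ?W + ennreal (s powr (- 1 / (p - 1))) * ?S"
      by (simp add: nn_integral_add nn_integral_cmult)
    finally show ?thesis .
  qed
  obtain e where e: "0 \<le> e" "emeasure M E = ennreal e"
    using fin by (auto simp: less_top_ennreal)
  show ?thesis
  proof (cases "e = 0 \<or> ?W = top \<or> ?S = top")
    case True
    \<comment> \<open>Both weights are positive on \<open>E\<close>, so a vanishing integral means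
      that \<open>E\<close> is null; if neither vanishes, an infinite factor makes the right side
      infinite.\<close>
    have "epowr (emeasure M E) p = 0" if "?W = 0 \<or> ?S = 0"
    proof -
      have "AE x in M. ennreal (w x) * indicator E x = 0 \<or> ennreal (\<sigma> x) * indicator E x = 0"
        using that by (subst (asm) nn_integral_0_iff_AE, measurable, subst (asm) nn_integral_0_iff_AE, measurable) auto
      then have "AE x in M. x \<notin> E"
        using w by eventually_elim (auto simp: indicator_def split: if_splits)
      then show ?thesis by (simp add: AE_iff_null_sets[symmetric] null_setsD1)
    qed
    moreover have "?W * epowr ?S (p - 1) = top" if "\<not> (?W = 0 \<or> ?S = 0)" "e \<noteq> 0"
      using that True unfolding ennreal_mult_eq_top_iff epowr_eq_top_iff epowr_eq_0_iff by blast
    ultimately show ?thesis using e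
      by (cases "?W = 0 \<or> ?S = 0"; cases "e = 0") (simp_all add: ennreal_mult_top)
  next
    case False
    from False have e0: "0 < e" using e by simp
    from False obtain W where W: "0 \<le> W" "?W = ennreal W" by (cases ?W) auto
    from False obtain S where S: "0 \<le> S" "?S = ennreal S" by (cases ?S) auto
    have b: "e \<le> s * W + s powr (- 1 / (p - 1)) * S" if "0 < s" for s
      using bound[OF that] that W S e by (simp add: ennreal_mult[symmetric] ennreal_plus[symmetric] del: ennreal_plus)
    have W0: "0 < W"
    proof (rule ccontr)
      assume "\<not> 0 < W"
      then have W: "W = 0" using W by simp
      \<comment> \<open>With \<open>W = 0\<close> this \<open>s\<close> makes the second term
        smaller than \<open>e / 2\<close>; the summand 1 avoids a division by 0.\<close>
      define s where "s = (e / (2 * (S + 1))) powr (- (p - 1))"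
      have "s powr (- 1 / (p - 1)) = e / (2 * (S + 1))"
      proof -
        have "- (p - 1) * (- 1 / (p - 1)) = 1" using p by (simp add: field_simps)
        then show ?thesis unfolding s_def powr_powr using e0 S by simp
      qed
      then have "e \<le> e / (2 * (S + 1)) * S"
        using b[of s] e0 S W by (auto simp: s_def)
      also have "\<dots> \<le> e / 2" using S e0 by (simp add: field_simps)
      finally show False using e0 by simp
    qed
    \<comment> \<open>Makes the first term equal to \<open>e / 2\<close>, so that the second one has
      to supply the other half.\<close>
    define s where "s = e / (2 * W)"
    have s: "0 < s" using e0 W0 by (simp add: s_def)
    have "e / 2 \<le> s powr (- 1 / (p - 1)) * S"
      using b[OF s] W0 by (simp add: s_def)
    then have "(e / 2) powr (p - 1) \<le> (s powr (- 1 / (p - 1)) * S) powr (p - 1)"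
      using e0 p by (intro powr_mono2) auto
    also have "\<dots> = s powr (- 1) * S powr (p - 1)"
      using p S by (simp add: powr_mult powr_powr)
    also have "\<dots> = 2 * W / e * S powr (p - 1)"
      using s e0 W0 by (simp add: powr_minus s_def)
    finally have "(e / 2) * (e / 2) powr (p - 1) \<le> W * S powr (p - 1)"
      using e0 by (simp add: field_simps)
    also have "(e / 2) * (e / 2) powr (p - 1) = (e/2) powr p"
      using e0 by (metis powr_mult_base less_eq_real_def add.commute diff_add_cancel half_gt_zero)
    also have "\<dots> = e powr p / 2 powr p" using e0 by (simp add: powr_divide)
    finally have "e powr p \<le> 2 powr p * (W * S powr (p - 1))"
      by (simp add: field_simps)
    then show ?thesis
      using e W S by (simp add: epowr_ennreal ennreal_mult[symmetric] )
  qed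
qed

lemma eq_powr_minusI: "w * s powr a = 1 \<Longrightarrow> w = s powr (- a)" for w s a :: real
  by (metis inverse_unique mult.commute powr_minus)

text \<open>\<open>\<sigma>\<close> is the dual weight w^(1-p'), carried as a second function so
  that duality becomes an exchange of arguments. The A_p condition is multiplied out, and positivity
  is required at every point rather than almost everywhere.\<close>

definition ap_pair :: "real \<Rightarrow> real \<Rightarrow> ('a::euclidean_space \<Rightarrow> real) \<Rightarrow> ('a \<Rightarrow> real) \<Rightarrow> bool" where
  "ap_pair p K w \<sigma> \<longleftrightarrow> 0 < K \<and> w \<in> borel_measurable lebesgue \<and> \<sigma> \<in> borel_measurable lebesgue \<and>
     (\<forall>x. 0 < w x \<and> 0 < \<sigma> x \<and> w x * \<sigma> x powr (p - 1) = 1) \<and>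
     (\<forall>c r. 0 < r \<longrightarrow>
        (\<integral>\<^sup>+x\<in>ball c r. ennreal (w x) \<partial>lebesgue) * epowr (\<integral>\<^sup>+x\<in>ball c r. ennreal (\<sigma> x) \<partial>lebesgue) (p - 1)
          \<le> ennreal K * epowr (emeasure lebesgue (ball c r)) p)"

text \<open>Raising the inequality to the power 1/(p-1) = p' - 1 exchanges the roles of the two
  weights.\<close>

lemma ap_pair_swap:
  assumes w: "ap_pair p K w \<sigma>" and p: "1 < p"
  shows "ap_pair (p / (p - 1)) (K powr (1 / (p - 1))) \<sigma> w"
proof -
  have p': "p / (p - 1) - 1 = 1 / (p - 1)" using p by (simp add: field_simps)
  have K: "0 < K" using w by (simp add: ap_pair_def)
  show ?thesis unfolding ap_pair_def p'
  proof (intro conjI allI impI)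
    fix x
    have "0 < w x \<and> 0 < \<sigma> x \<and> w x * \<sigma> x powr (p - 1) = 1" using w by (simp add: ap_pair_def)
    then show "0 < w x" "0 < \<sigma> x" and "\<sigma> x * w x powr (1 / (p - 1)) = 1"
    proof -
      assume a: "0 < w x \<and> 0 < \<sigma> x \<and> w x * \<sigma> x powr (p - 1) = 1"
      then have "w x = \<sigma> x powr (- (p - 1))" by (intro eq_powr_minusI) simp
      then have "w x powr (1 / (p - 1)) = \<sigma> x powr (- (p - 1) * (1 / (p - 1)))" by (simp only: powr_powr)
      also have "- (p - 1) * (1 / (p - 1)) = - 1" using p by (simp add: field_simps)
      finally have "w x powr (1 / (p - 1)) = \<sigma> x powr (-1)" .
      then show "\<sigma> x * w x powr (1 / (p - 1)) = 1" using a by (simp add: powr_minus)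
    qed auto
  next
    fix c :: 'a and r :: real assume r: "0 < r"
    let ?W = "\<integral>\<^sup>+x\<in>ball c r. ennreal (w x) \<partial>lebesgue"
    let ?S = "\<integral>\<^sup>+x\<in>ball c r. ennreal (\<sigma> x) \<partial>lebesgue"
    have "?S * epowr ?W (1 / (p - 1)) = epowr (?W * epowr ?S (p - 1)) (1 / (p - 1))"
      using p by (simp add: epowr_mult epowr_epowr mult.commute)
    also have "\<dots> \<le> epowr (ennreal K * epowr (emeasure lebesgue (ball c r)) p) (1 / (p - 1))"
      using w p r by (intro epowr_mono) (auto simp: ap_pair_def)
    also have "\<dots> = ennreal (K powr (1 / (p - 1))) * epowr (emeasure lebesgue (ball c r)) (p / (p - 1))"
      using K by (simp add: epowr_mult_ennreal epowr_epowr)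
    finally show "?S * epowr ?W (1 / (p - 1)) \<le> ennreal (K powr (1 / (p - 1))) * epowr (emeasure lebesgue (ball c r)) (p / (p - 1))" .
  qed (use w in \<open>auto simp: ap_pair_def\<close>)
qed

lemma nn_integral_pos_ball:
  fixes w :: "'a::euclidean_space \<Rightarrow> ennreal"
  assumes [measurable]: "w \<in> borel_measurable lebesgue" and "\<And>x. 0 < w x" "0 < r"
  shows "0 < (\<integral>\<^sup>+x\<in>ball c r. w x \<partial>lebesgue)"
proof (rule ccontr)
  have [measurable]: "(\<lambda>x. w x * indicator (ball c r) x) \<in> borel_measurable lebesgue" by measurable
  assume "\<not> ?thesis"
  then have "AE x in lebesgue. w x * indicator (ball c r) x = 0"
    by (subst nn_integral_0_iff_AE[symmetric]) simp_all
  then have "AE x in lebesgue. x \<notin> ball c r"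
    by eventually_elim (use assms(2) in \<open>auto simp: indicator_def less_le split: if_splits\<close>)
  then have "emeasure lebesgue (ball c r) = 0"
    by (subst (asm) AE_iff_null_sets[symmetric]) auto
  with emeasure_lborel_ball_pos[OF assms(3), of c] show False by simp
qed

text \<open>\<open>\<sigma>\<close> has positive mass on the ball, so an infinite mass of
  \<open>w\<close> would make the product infinite.\<close>

lemma ap_pair_finite:
  assumes w: "ap_pair p K w \<sigma>" and p: "1 < p" and r: "0 < r"
  shows "(\<integral>\<^sup>+x\<in>ball c r. ennreal (w x) \<partial>lebesgue) < top"
proof -
  let ?W = "\<integral>\<^sup>+x\<in>ball c r. ennreal (w x) \<partial>lebesgue"
  let ?S = "\<integral>\<^sup>+x\<in>ball c r. ennreal (\<sigma> x) \<partial>lebesgue"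
  have "0 < ?S" using w r by (intro nn_integral_pos_ball) (auto simp: ap_pair_def)
  moreover have "?W * epowr ?S (p - 1) \<le> ennreal K * epowr (emeasure lebesgue (ball c r)) p"
    using w r by (simp add: ap_pair_def)
  moreover have "\<dots> < top" using emeasure_lborel_ball_less_top[of c r]
    by (simp add: ennreal_mult_less_top)
  ultimately show ?thesis
    by (metis (no_types, lifting) ennreal_top_mult epowr_eq_0_iff leD less_irrefl less_top mult_zero_left)
qed

text \<open>The A_p condition bounds w(2B) \<sigma>(2B)^(p-1) by K |2B|^p, the dual inequality on
  \<open>B\<close> leads back to w(B) \<sigma>(B)^(p-1), and the finite positive factor
  \<sigma>(B)^(p-1) cancels. The factors of the constant come from \<open>K\<close>, from that dual
  inequality and from |2B| = 2^n |B|.\<close>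

lemma ap_pair_doubling:
  fixes w :: "'a::euclidean_space \<Rightarrow> real"
  assumes w: "ap_pair p K w \<sigma>" and p: "1 < p"
  shows "doubling (K * 2 powr p * (2 ^ DIM('a)) powr p) (density lebesgue (\<lambda>x. ennreal (w x)))"
proof -
  have meas [measurable]: "w \<in> borel_measurable lebesgue" "\<sigma> \<in> borel_measurable lebesgue"
    and K: "0 < K" and pos: "\<And>x. 0 < w x" "\<And>x. 0 < \<sigma> x" "\<And>x. w x * \<sigma> x powr (p - 1) = 1"
    using w by (auto simp: ap_pair_def)
  let ?W = "\<lambda>c r. \<integral>\<^sup>+x\<in>ball c r. ennreal (w x) \<partial>lebesgue"
  let ?S = "\<lambda>c r. \<integral>\<^sup>+x\<in>ball c r. ennreal (\<sigma> x) \<partial>lebesgue"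
  have em: "emeasure (density lebesgue (\<lambda>x. ennreal (w x))) (ball c r) = ?W c r" for c r
    by (subst emeasure_density) auto
  have "?W c (2 * r) \<le> ennreal (K * 2 powr p * (2 ^ DIM('a)) powr p) * ?W c r" if r: "0 < r" for c r
  proof -
    have S0: "0 < ?S c r" using pos r by (intro nn_integral_pos_ball) auto
    have Sfin: "?S c r < top" using ap_pair_finite[OF ap_pair_swap[OF w p]] p r by (simp add: field_simps)
    have le: "?S c r \<le> ?S c (2 * r)"
      using r by (intro nn_integral_mono) (auto simp: indicator_def)
    have "?W c (2 * r) * epowr (?S c r) (p - 1) \<le> ?W c (2 * r) * epowr (?S c (2 * r)) (p - 1)"
      using p by (intro mult_left_mono epowr_mono le) auto
    also have "\<dots> \<le> ennreal K * epowr (emeasure lebesgue (ball c (2 * r))) p"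
      using w r by (simp add: ap_pair_def)
    also have "emeasure lebesgue (ball c (2 * r)) = ennreal (2 ^ DIM('a)) * emeasure lebesgue (ball c r)"
      using emeasure_lborel_ball_scale[of r 2 c c] r by simp
    also have "epowr \<dots> p = ennreal ((2 ^ DIM('a)) powr p) * epowr (emeasure lebesgue (ball c r)) p"
      by (rule epowr_mult_ennreal) simp
    also have "ennreal K * (ennreal ((2 ^ DIM('a)) powr p) * epowr (emeasure lebesgue (ball c r)) p) \<le>
        ennreal K * (ennreal ((2 ^ DIM('a)) powr p) * (ennreal (2 powr p) * (?W c r * epowr (?S c r) (p - 1))))"
      using pos emeasure_lborel_ball_less_top[of c r]
      by (intro mult_left_mono epowr_emeasure_le_dual p) (auto intro!: AE_I2)
    also have "\<dots> = ennreal (K * 2 powr p * (2 ^ DIM('a)) powr p) * ?W c r * epowr (?S c r) (p - 1)"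
      using K by (simp add: ennreal_mult mult_ac)
    finally have "?W c (2 * r) * epowr (?S c r) (p - 1) \<le>
        ennreal (K * 2 powr p * (2 ^ DIM('a)) powr p) * ?W c r * epowr (?S c r) (p - 1)" .
    then show ?thesis
      using S0 Sfin by (subst (asm) (1 2) mult.commute, subst (asm) ennreal_mult_le_mult_iff) (auto simp: less_top)
  qed
  moreover have "0 < ?W c r" if r: "0 < r" for c r
    using pos that by (intro nn_integral_pos_ball) auto
  moreover have "?W c r < top" if r: "0 < r" for c r
    using ap_pair_finite[OF w p that] .
  ultimately show ?thesis unfolding doubling_def em using K by auto
qed

text \<open>Lerner's argument: with \<open>\<mu> = w dx\<close> and \<open>\<nu> = \<sigma> dx\<close>, the power \<open>(M f)\<^sup>p\<^sup>-\<^sup>1\<close> is pointwise bounded by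
  \<open>K M\<^sub>\<mu> (M\<^sub>\<nu> (f / \<sigma>)\<^sup>p\<^sup>-\<^sup>1 / w)\<close>, and the maximal operators of the doubling measures \<open>\<mu>\<close> and \<open>\<nu>\<close> are
  bounded by covering arguments.\<close>

theorem muckenhoupt:
  fixes w :: "'a::euclidean_space \<Rightarrow> real"
  assumes p: "1 < p"
  shows "\<exists>C>0. \<forall>w \<sigma> f. ap_pair p K w \<sigma> \<longrightarrow> f \<in> borel_measurable lebesgue \<longrightarrow>
    (\<integral>\<^sup>+x. epowr (maxop lebesgue f x) p * ennreal (w x) \<partial>(lebesgue::'a measure)) \<le>
      ennreal C * (\<integral>\<^sup>+x. epowr (f x) p * ennreal (w x) \<partial>lebesgue)"
proof -
  define p' where "p' = p / (p - 1)"
  have p': "1 < p'" "p' * (p - 1) = p" "p / p' = p - 1" using p by (auto simp: p'_def field_simps)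
  define A where "A = (\<lambda>q D::real. 2 powr q * q * D ^ 3 / (q - 1))"
  define D where "D = (\<lambda>K. K * 2 powr p * (2 ^ DIM('a)) powr p :: real)"
  define D' where "D' = (\<lambda>K. K powr (1 / (p - 1)) * 2 powr p' * (2 ^ DIM('a)) powr p' :: real)"
  \<comment> \<open>\<open>C\<close> is chosen before \<open>w\<close>. A pair exists only for
    \<open>K > 0\<close>; the value 1 fills the other case.\<close>
  define C where "C = (if 0 < K then K powr p' * A p' (D K) * A p (D' K) else 1)"
  show ?thesis
  proof (intro exI[of _ C] conjI allI impI)
    show "0 < C" using p p' by (auto simp: C_def A_def D_def D'_def)
    fix w \<sigma> :: "'a \<Rightarrow> real" and f :: "'a \<Rightarrow> ennreal"
    assume w: "ap_pair p K w \<sigma>" and f [measurable]: "f \<in> borel_measurable lebesgue"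
    have meas [measurable]: "w \<in> borel_measurable lebesgue" "\<sigma> \<in> borel_measurable lebesgue"
      and K: "0 < K" and pos: "\<And>x. 0 < w x" "\<And>x. 0 < \<sigma> x" "\<And>x. w x * \<sigma> x powr (p - 1) = 1"
      using w by (auto simp: ap_pair_def)
    define \<mu> where "\<mu> = density lebesgue (\<lambda>x. ennreal (w x))"
    define \<nu> where "\<nu> = density lebesgue (\<lambda>x. ennreal (\<sigma> x))"
    have d\<mu>: "doubling (D K) \<mu>"
      unfolding \<mu>_def D_def by (rule ap_pair_doubling[OF w p])
    have d\<nu>: "doubling (D' K) \<nu>"
      unfolding \<nu>_def D'_def p'_def using ap_pair_doubling[OF ap_pair_swap[OF w p]] p'(1) by (simp add: p'_def)
    have A0: "0 \<le> A p' (D K)" "0 \<le> A p (D' K)"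
      using p p' K by (auto simp: A_def D_def D'_def)
    \<comment> \<open>Division by \<open>\<sigma>\<close> turns Lebesgue integrals of
      \<open>f\<close> into \<open>\<nu>\<close>-integrals of \<open>\<phi>\<close>; for the same
      reason \<open>\<psi>\<close> is divided by \<open>w\<close> before it is integrated against
      \<open>\<mu>\<close>.\<close>
    define \<phi> where "\<phi> = (\<lambda>x. f x * ennreal (1 / \<sigma> x))"
    define \<psi> where "\<psi> = (\<lambda>x. epowr (maxop \<nu> \<phi> x) (p - 1) * ennreal (1 / w x))"
    have [measurable]: "\<phi> \<in> borel_measurable lebesgue" "\<psi> \<in> borel_measurable lebesgue"
      unfolding \<phi>_def \<psi>_def by measurable
    have int\<mu>: "(\<integral>\<^sup>+x. g x \<partial>\<mu>) = (\<integral>\<^sup>+x. ennreal (w x) * g x \<partial>lebesgue)" if "g \<in> borel_measurable lebesgue" for g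
      unfolding \<mu>_def by (rule nn_integral_density) (use that in auto)
    have int\<nu>: "(\<integral>\<^sup>+x. g x \<partial>\<nu>) = (\<integral>\<^sup>+x. ennreal (\<sigma> x) * g x \<partial>lebesgue)" if "g \<in> borel_measurable lebesgue" for g
      unfolding \<nu>_def by (rule nn_integral_density) (use that in auto)
    have pw: "epowr (maxop lebesgue f x) (p - 1) \<le> ennreal K * maxop \<mu> \<psi> x" for x
    proof -
      have "maxop lebesgue f x \<le> epowr (ennreal K * maxop \<mu> \<psi> x) (1 / (p - 1))"
      proof (rule maxop_least)
        fix c r assume r: "0 < r" and x: "x \<in> ball c r"
        let ?L = "emeasure lebesgue (ball c r)" and ?M = "emeasure \<mu> (ball c r)" and ?N = "emeasure \<nu> (ball c r)"
        have M: "0 < ?M" "?M < top" using d\<mu> r by (auto simp: doubling_def)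
        have N: "0 < ?N" "?N < top" using d\<nu> r by (auto simp: doubling_def)
        have L: "0 < ?L" "?L < top"
          using emeasure_lborel_ball_pos[OF r, of c] emeasure_lborel_ball_less_top[of c r] by auto
        let ?I = "\<integral>\<^sup>+y\<in>ball c r. f y \<partial>lebesgue"
        have I: "?I = (\<integral>\<^sup>+y\<in>ball c r. \<phi> y \<partial>\<nu>)"
        proof -
          have "ennreal (\<sigma> y) * (\<phi> y * indicator (ball c r) y) = f y * indicator (ball c r) y" for y
          proof -
            have "ennreal (1 / \<sigma> y) * ennreal (\<sigma> y) = 1"
              using pos(2)[of y] by (simp add: ennreal_mult'[symmetric])
            moreover have "ennreal (\<sigma> y) * (\<phi> y * indicator (ball c r) y) =
                f y * indicator (ball c r) y * (ennreal (1 / \<sigma> y) * ennreal (\<sigma> y))"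
              by (simp only: \<phi>_def mult_ac)
            ultimately show ?thesis by simp
          qed
          moreover have "(\<lambda>y. \<phi> y * indicator (ball c r) y) \<in> borel_measurable lebesgue"
            by measurable
          ultimately show ?thesis by (simp add: int\<nu>)
        qed
        \<comment> \<open>The \<open>\<nu>\<close>-average over the ball is a lower bound for
          \<open>maxop \<nu> \<phi>\<close> at each of its points; integrating this bound gives a
          \<open>\<mu>\<close>-integral of \<open>\<psi>\<close>.\<close>
        have "epowr (?I / ?N) (p - 1) * ?L = (\<integral>\<^sup>+y\<in>ball c r. epowr (?I / ?N) (p - 1) \<partial>lebesgue)"
          by (simp add: nn_integral_cmult)
        also have "\<dots> \<le> (\<integral>\<^sup>+y\<in>ball c r. epowr (maxop \<nu> \<phi> y) (p - 1) \<partial>lebesgue)"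
        proof (intro nn_integral_mono)
          fix y
          show "epowr (?I / ?N) (p - 1) * indicator (ball c r) y \<le> epowr (maxop \<nu> \<phi> y) (p - 1) * indicator (ball c r) y"
          proof (cases "y \<in> ball c r")
            case True
            then have "?I / ?N \<le> maxop \<nu> \<phi> y" unfolding I by (rule maxop_upper)
            then show ?thesis using p by (intro mult_right_mono epowr_mono) auto
          qed simp
        qed
        also have "\<dots> = (\<integral>\<^sup>+y\<in>ball c r. \<psi> y \<partial>\<mu>)"
        proof -
          have "ennreal (w y) * (\<psi> y * indicator (ball c r) y) = epowr (maxop \<nu> \<phi> y) (p - 1) * indicator (ball c r) y" for y
          proof -
            have "ennreal (1 / w y) * ennreal (w y) = 1"
              using pos(1)[of y] by (simp add: ennreal_mult'[symmetric])
            moreover have "ennreal (w y) * (\<psi> y * indicator (ball c r) y) =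
                epowr (maxop \<nu> \<phi> y) (p - 1) * indicator (ball c r) y * (ennreal (1 / w y) * ennreal (w y))"
              by (simp only: \<psi>_def mult_ac)
            ultimately show ?thesis by simp
          qed
          moreover have "(\<lambda>y. \<psi> y * indicator (ball c r) y) \<in> borel_measurable lebesgue"
            by measurable
          ultimately show ?thesis by (simp add: int\<mu>)
        qed
        also have "\<dots> = (\<integral>\<^sup>+y\<in>ball c r. \<psi> y \<partial>\<mu>) / ?M * ?M"
          using M by (auto simp: ennreal_divide_times)
        also have "\<dots> \<le> maxop \<mu> \<psi> x * ?M"
          by (intro mult_right_mono maxop_upper x) auto
        finally have 1: "epowr (?I / ?N) (p - 1) * ?L \<le> maxop \<mu> \<psi> x * ?M" .
        have 2: "?M * epowr ?N (p - 1) \<le> ennreal K * epowr ?L p"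
          using w r unfolding \<mu>_def \<nu>_def by (subst (1 2) emeasure_density) (auto simp: ap_pair_def)
        have "epowr ?I (p - 1) * ?L = epowr (?I / ?N * ?N) (p - 1) * ?L"
          using N by (auto simp: ennreal_divide_times)
        also have "\<dots> = epowr (?I / ?N) (p - 1) * ?L * epowr ?N (p - 1)"
          by (simp add: epowr_mult mult_ac)
        also have "\<dots> \<le> maxop \<mu> \<psi> x * ?M * epowr ?N (p - 1)"
          by (intro mult_right_mono 1) auto
        also have "\<dots> \<le> maxop \<mu> \<psi> x * (ennreal K * epowr ?L p)"
          unfolding mult.assoc by (intro mult_left_mono 2) auto
        also have "epowr ?L p = epowr ?L (p - 1) * ?L"
          using epowr_add[of ?L "p - 1" 1] by simp
        also have "maxop \<mu> \<psi> x * (ennreal K * (epowr ?L (p - 1) * ?L)) = ?L * (ennreal K * maxop \<mu> \<psi> x * epowr ?L (p - 1))"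
          by (simp add: mult_ac)
        finally have "?L * epowr ?I (p - 1) \<le> ?L * (ennreal K * maxop \<mu> \<psi> x * epowr ?L (p - 1))"
          by (simp add: mult_ac)
        then have "epowr ?I (p - 1) \<le> ennreal K * maxop \<mu> \<psi> x * epowr ?L (p - 1)"
          using L by (subst (asm) ennreal_mult_le_mult_iff) auto
        then have "?I \<le> epowr (ennreal K * maxop \<mu> \<psi> x * epowr ?L (p - 1)) (1 / (p - 1))"
          using p by (simp add: epowr_le_iff)
        also have "\<dots> = epowr (ennreal K * maxop \<mu> \<psi> x) (1 / (p - 1)) * ?L"
          using p by (simp add: epowr_mult epowr_epowr)
        finally show "?I / ?L \<le> epowr (ennreal K * maxop \<mu> \<psi> x) (1 / (p - 1))"
          using L by (metis divide_right_mono_ennreal ennreal_divide_self ennreal_times_divide less_irrefl mult.right_neutral)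
      qed
      then show ?thesis using p by (simp add: epowr_le_iff)
    qed
    \<comment> \<open>Since (p-1) p' = p, an L^p bound for the maximal function is an L^p' bound for
      its power p - 1.\<close>
    have "(\<integral>\<^sup>+x. epowr (maxop lebesgue f x) p * ennreal (w x) \<partial>lebesgue) = (\<integral>\<^sup>+x. epowr (epowr (maxop lebesgue f x) (p - 1)) p' \<partial>\<mu>)"
      using p' by (subst int\<mu>) (auto simp: epowr_epowr mult_ac)
    also have "\<dots> \<le> (\<integral>\<^sup>+x. ennreal (K powr p') * epowr (maxop \<mu> \<psi> x) p' \<partial>\<mu>)"
      using p' K pw by (intro nn_integral_mono) (auto simp: epowr_mult_ennreal[symmetric] intro!: epowr_mono)
    also have "\<dots> = ennreal (K powr p') * (\<integral>\<^sup>+x. epowr (maxop \<mu> \<psi> x) p' \<partial>\<mu>)"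
      by (rule nn_integral_cmult) (simp add: \<mu>_def)
    also have "\<dots> \<le> ennreal (K powr p') * (ennreal (A p' (D K)) * (\<integral>\<^sup>+x. epowr (\<psi> x) p' \<partial>\<mu>))"
      unfolding A_def by (intro mult_left_mono strong_type_maxop[OF d\<mu>] p') auto
    \<comment> \<open>The identity w w^(-p') = \<sigma> changes the measure from
      \<open>\<mu>\<close> to \<open>\<nu>\<close>.\<close>
    also have "(\<integral>\<^sup>+x. epowr (\<psi> x) p' \<partial>\<mu>) = (\<integral>\<^sup>+x. epowr (maxop \<nu> \<phi> x) p \<partial>\<nu>)"
    proof (subst int\<mu>, measurable, subst int\<nu>, measurable, intro nn_integral_cong)
      fix x
      have "w x = \<sigma> x powr (- (p - 1))" by (rule eq_powr_minusI[OF pos(3)])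
      moreover have "1 / w x = \<sigma> x powr (p - 1)" using pos(3)[of x] pos(1)[of x] by (simp add: field_simps)
      ultimately have "w x * (1 / w x) powr p' = \<sigma> x powr (- (p - 1)) * \<sigma> x powr ((p - 1) * p')"
        by (simp only: powr_powr)
      also have "\<dots> = \<sigma> x" using pos(2)[of x] p' by (simp add: powr_add[symmetric] mult.commute)
      finally have "ennreal (w x) * ennreal ((1 / w x) powr p') = ennreal (\<sigma> x)"
        using pos(1)[of x] by (simp add: ennreal_mult[symmetric])
      moreover have "epowr (\<psi> x) p' = epowr (maxop \<nu> \<phi> x) p * ennreal ((1 / w x) powr p')"
        using pos(1)[of x] p' by (simp add: \<psi>_def epowr_mult epowr_epowr epowr_ennreal mult.commute less_imp_le)
      ultimately show "ennreal (w x) * epowr (\<psi> x) p' = ennreal (\<sigma> x) * epowr (maxop \<nu> \<phi> x) p"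
        by (metis mult.assoc mult.commute)
    qed
    also have "ennreal (K powr p') * (ennreal (A p' (D K)) * (\<integral>\<^sup>+x. epowr (maxop \<nu> \<phi> x) p \<partial>\<nu>)) \<le>
        ennreal (K powr p') * (ennreal (A p' (D K)) * (ennreal (A p (D' K)) * (\<integral>\<^sup>+x. epowr (\<phi> x) p \<partial>\<nu>)))"
      unfolding A_def by (intro mult_left_mono strong_type_maxop[OF d\<nu>] p) auto
    also have "(\<integral>\<^sup>+x. epowr (\<phi> x) p \<partial>\<nu>) = (\<integral>\<^sup>+x. epowr (f x) p * ennreal (w x) \<partial>lebesgue)"
    proof (subst int\<nu>, measurable, intro nn_integral_cong)
      fix x
      have "\<sigma> x * (1 / \<sigma> x) powr p = \<sigma> x powr 1 * \<sigma> x powr (- p)"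
        using pos(2)[of x] by (simp add: powr_divide powr_minus inverse_eq_divide)
      also have "\<dots> = \<sigma> x powr (- (p - 1))" using pos(2)[of x] by (simp only: powr_add[symmetric]) simp
      also have "\<dots> = w x" by (rule eq_powr_minusI[OF pos(3), symmetric])
      finally have "ennreal (\<sigma> x) * ennreal ((1 / \<sigma> x) powr p) = ennreal (w x)"
        using pos(2)[of x] by (simp add: ennreal_mult[symmetric])
      moreover have "epowr (\<phi> x) p = epowr (f x) p * ennreal ((1 / \<sigma> x) powr p)"
        using pos(2)[of x] by (simp add: \<phi>_def epowr_mult epowr_ennreal less_imp_le)
      ultimately show "ennreal (\<sigma> x) * epowr (\<phi> x) p = epowr (f x) p * ennreal (w x)"
        by (metis mult.assoc mult.commute)
    qed
    also have "ennreal (K powr p') * (ennreal (A p' (D K)) * (ennreal (A p (D' K)) * (\<integral>\<^sup>+x. epowr (f x) p * ennreal (w x) \<partial>lebesgue))) =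
        ennreal C * (\<integral>\<^sup>+x. epowr (f x) p * ennreal (w x) \<partial>lebesgue)"
    proof -
      have "ennreal C = ennreal (K powr p') * ennreal (A p' (D K)) * ennreal (A p (D' K))"
        using K A0 by (simp add: C_def ennreal_mult)
      then show ?thesis by (simp only: mult.assoc)
    qed
    finally show "(\<integral>\<^sup>+x. epowr (maxop lebesgue f x) p * ennreal (w x) \<partial>lebesgue) \<le>
        ennreal C * (\<integral>\<^sup>+x. epowr (f x) p * ennreal (w x) \<partial>lebesgue)" .
  qed
qed

section \<open>Rubio de Francia iteration and factorization of weights\<close>

lemma power_powr: "0 \<le> x \<Longrightarrow> (x ^ k) powr a = (x powr a) ^ k" for x a :: real
  by (induction k) (simp_all add: powr_mult)

lemma suminf_half_powers_ennreal: "(\<Sum>k. ennreal ((1 / 2) ^ k)) = 2"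
proof -
  have "(\<lambda>k. (1 / 2 :: real) ^ k) sums 2"
    using geometric_sums[of "1/2 :: real"] by simp
  from suminf_ennreal_eq[OF _ this] have "(\<Sum>k. ennreal ((1 / 2) ^ k)) = ennreal 2"
    by fastforce
  then show ?thesis by (metis ennreal_numeral)
qed

text \<open>Countable sublinearity: averages commute with series of nonnegative terms, and each
  average is at most the maximal function.\<close>

lemma maxop_suminf_le:
  fixes h :: "nat \<Rightarrow> 'a::euclidean_space \<Rightarrow> ennreal"
  assumes [measurable]: "\<And>k. h k \<in> borel_measurable lebesgue"
  shows "maxop lebesgue (\<lambda>x. \<Sum>k. ennreal (c k) * h k x) x \<le> (\<Sum>k. ennreal (c k) * maxop lebesgue (h k) x)"
proof (rule maxop_least)
  fix z r assume x: "x \<in> ball z r"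
  let ?L = "emeasure lebesgue (ball z r)"
  have "(\<integral>\<^sup>+y\<in>ball z r. (\<Sum>k. ennreal (c k) * h k y) \<partial>lebesgue) =
      (\<integral>\<^sup>+y. (\<Sum>k. ennreal (c k) * (h k y * indicator (ball z r) y)) \<partial>lebesgue)"
    by (simp only: ennreal_suminf_multc[symmetric] mult.assoc)
  also have "\<dots> = (\<Sum>k. ennreal (c k) * (\<integral>\<^sup>+y\<in>ball z r. h k y \<partial>lebesgue))"
    by (subst nn_integral_suminf, measurable, subst nn_integral_cmult, measurable)
  finally have "(\<integral>\<^sup>+y\<in>ball z r. (\<Sum>k. ennreal (c k) * h k y) \<partial>lebesgue) / ?L =
      (\<Sum>k. ennreal (c k) * ((\<integral>\<^sup>+y\<in>ball z r. h k y \<partial>lebesgue) / ?L))"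
    by (simp only: ennreal_suminf_divide[symmetric] ennreal_times_divide)
  also have "\<dots> \<le> (\<Sum>k. ennreal (c k) * maxop lebesgue (h k) x)"
    by (intro suminf_le mult_left_mono maxop_upper x summableI) auto
  finally show "(\<integral>\<^sup>+y\<in>ball z r. (\<Sum>k. ennreal (c k) * h k y) \<partial>lebesgue) / ?L \<le> (\<Sum>k. ennreal (c k) * maxop lebesgue (h k) x)" .
qed

text \<open>The majorant is the series of the iterates of the maximal operator with weights
  \<open>(4 N) ^ - k\<close>. Bounding it by twice the supremum of the terms weighted with \<open>(2 N) ^ - k\<close>
  avoids Minkowski's inequality.\<close>

theorem rubio_de_francia:
  assumes p: "1 < p"
  shows "\<exists>C>0. \<forall>w \<sigma> f. ap_pair p K w \<sigma> \<longrightarrow> f \<in> borel_measurable lebesgue \<longrightarrow>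
    (\<exists>F \<in> borel_measurable (lebesgue :: 'a::euclidean_space measure).
      (\<forall>x. f x \<le> F x) \<and> (\<forall>x. maxop lebesgue F x \<le> ennreal C * F x) \<and>
      (\<integral>\<^sup>+x. epowr (F x) p * ennreal (w x) \<partial>lebesgue) \<le>
        ennreal C * (\<integral>\<^sup>+x. epowr (f x) p * ennreal (w x) \<partial>lebesgue))"
proof -
  obtain C0 where C0: "0 < C0" and muck: "\<And>w \<sigma> f. ap_pair p K w \<sigma> \<Longrightarrow> f \<in> borel_measurable lebesgue \<Longrightarrow>
    (\<integral>\<^sup>+x. epowr (maxop lebesgue f x) p * ennreal (w x) \<partial>(lebesgue::'a measure)) \<le>
      ennreal C0 * (\<integral>\<^sup>+x. epowr (f x) p * ennreal (w x) \<partial>lebesgue)"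
    using muckenhoupt[OF p] by blast
  \<comment> \<open>A bound for the norm of the maximal operator on L^p(w).\<close>
  define N where "N = C0 powr (1 / p)"
  have N: "0 < N" "N powr p = C0" using C0 p by (auto simp: N_def powr_powr)
  \<comment> \<open>The sum serves two purposes: \<open>4 * N\<close> is the A_1 constant of the
    majorant and \<open>2 * 2 powr p\<close> bounds the integral of its p-th power.\<close>
  define C where "C = 4 * N + 2 * 2 powr p"
  show ?thesis
  proof (intro exI[of _ C] conjI allI impI)
    show "0 < C" using N by (simp add: C_def add_pos_pos)
    fix w \<sigma> :: "'a \<Rightarrow> real" and f :: "'a \<Rightarrow> ennreal"
    assume w: "ap_pair p K w \<sigma>" and f [measurable]: "f \<in> borel_measurable lebesgue"
    have [measurable]: "w \<in> borel_measurable lebesgue"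
      using w by (auto simp: ap_pair_def)
    define m where "m k = (maxop lebesgue ^^ k) f" for k
    have m [measurable]: "m k \<in> borel_measurable lebesgue" for k
      by (cases k) (auto simp: m_def)
    have m_Suc: "m (Suc k) = maxop lebesgue (m k)" for k by (simp add: m_def)
    define F where "F = (\<lambda>x. \<Sum>k. ennreal ((1 / (4 * N)) ^ k) * m k x)"
    have [measurable]: "F \<in> borel_measurable lebesgue" unfolding F_def by measurable
    let ?Y = "\<integral>\<^sup>+x. epowr (f x) p * ennreal (w x) \<partial>lebesgue"
    have iter: "(\<integral>\<^sup>+x. epowr (m k x) p * ennreal (w x) \<partial>lebesgue) \<le> ennreal (C0 ^ k) * ?Y" for k
    proof (induction k)
      case 0 then show ?case by (simp add: m_def)
    next
      case (Suc k)
      have "(\<integral>\<^sup>+x. epowr (m (Suc k) x) p * ennreal (w x) \<partial>lebesgue) \<le>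
          ennreal C0 * (\<integral>\<^sup>+x. epowr (m k x) p * ennreal (w x) \<partial>lebesgue)"
        unfolding m_Suc by (rule muck[OF w m])
      also have "\<dots> \<le> ennreal C0 * (ennreal (C0 ^ k) * ?Y)"
        by (intro mult_left_mono Suc) auto
      also have "\<dots> = ennreal (C0 ^ Suc k) * ?Y"
        using C0 by (simp add: ennreal_mult mult.assoc)
      finally show ?case .
    qed
    have le: "f x \<le> F x" for x
      using sum_le_suminf[of "\<lambda>k. ennreal ((1 / (4 * N)) ^ k) * m k x" "{0}"]
      by (simp add: F_def m_def)
    have MF: "maxop lebesgue F x \<le> ennreal C * F x" for x
    proof -
      have "maxop lebesgue F x \<le> (\<Sum>k. ennreal ((1 / (4 * N)) ^ k) * m (Suc k) x)"
        unfolding F_def m_Suc by (rule maxop_suminf_le) measurable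
      \<comment> \<open>Shifting the index by one costs the factor \<open>4 * N\<close>; the shifted
        series lacks the term 0 of \<open>F\<close> and so stays below \<open>F\<close>.\<close>
      also have "\<dots> = (\<Sum>k. ennreal (4 * N) * (ennreal ((1 / (4 * N)) ^ Suc k) * m (Suc k) x))"
      proof (intro suminf_cong)
        fix k
        have "ennreal ((1 / (4 * N)) ^ k) = ennreal (4 * N) * ennreal ((1 / (4 * N)) ^ Suc k)"
          using N by (subst ennreal_mult[symmetric]) auto
        then show "ennreal ((1 / (4 * N)) ^ k) * m (Suc k) x = ennreal (4 * N) * (ennreal ((1 / (4 * N)) ^ Suc k) * m (Suc k) x)"
          by (simp only: mult.assoc)
      qed
      also have "\<dots> = ennreal (4 * N) * (\<Sum>k. ennreal ((1 / (4 * N)) ^ Suc k) * m (Suc k) x)"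
        by (rule ennreal_suminf_cmult)
      also have "\<dots> \<le> ennreal C * F x"
      proof (intro mult_mono)
        show "(\<Sum>k. ennreal ((1 / (4 * N)) ^ Suc k) * m (Suc k) x) \<le> F x"
          unfolding F_def using suminf_offset[of "\<lambda>k. ennreal ((1 / (4 * N)) ^ k) * m k x" 1]
          by (simp add: add_increasing)
        show "ennreal (4 * N) \<le> ennreal C" by (intro ennreal_leI) (simp add: C_def)
      qed auto
      finally show ?thesis .
    qed
    have pw: "epowr (F x) p \<le> ennreal (2 powr p) * (\<Sum>k. ennreal (((1 / (2 * N)) powr p) ^ k) * epowr (m k x) p)" for x
    proof -
      define b where "b k = ennreal ((1 / (2 * N)) ^ k) * m k x" for k
      have "F x = (\<Sum>k. ennreal ((1 / 2) ^ k) * b k)"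
      proof -
        have "ennreal ((1 / (4 * N)) ^ k) = ennreal ((1 / 2) ^ k) * ennreal ((1 / (2 * N)) ^ k)" for k
          using N by (subst ennreal_mult[symmetric]) (auto simp: power_mult_distrib[symmetric])
        then show ?thesis by (simp add: F_def b_def mult.assoc)
      qed
      also have "\<dots> \<le> (\<Sum>k. ennreal ((1 / 2) ^ k) * (SUP k. b k))"
        by (intro suminf_le mult_left_mono SUP_upper summableI) auto
      also have "\<dots> = 2 * (SUP k. b k)"
        by (simp only: ennreal_suminf_multc suminf_half_powers_ennreal)
      finally have "epowr (F x) p \<le> epowr (2 * (SUP k. b k)) p"
        using p by (intro epowr_mono) auto
      also have "\<dots> = ennreal (2 powr p) * (SUP k. epowr (b k) p)"
        using p epowr_mult_ennreal[of 2 "SUP k. b k" p] by (simp add: epowr_SUP)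
      also have "\<dots> \<le> ennreal (2 powr p) * (\<Sum>k. epowr (b k) p)"
      proof (intro mult_left_mono SUP_least)
        fix k show "epowr (b k) p \<le> (\<Sum>k. epowr (b k) p)"
          using sum_le_suminf[of "\<lambda>k. epowr (b k) p" "{k}"] by simp
      qed auto
      also have "(\<lambda>k. epowr (b k) p) = (\<lambda>k. ennreal (((1 / (2 * N)) powr p) ^ k) * epowr (m k x) p)"
      proof
        fix k
        have "((1 / (2 * N)) ^ k) powr p = ((1 / (2 * N)) powr p) ^ k"
          using N by (intro power_powr) auto
        then show "epowr (b k) p = ennreal (((1 / (2 * N)) powr p) ^ k) * epowr (m k x) p"
          using N unfolding b_def by (subst epowr_mult_ennreal) auto
      qed
      finally show ?thesis .
    qed
    have "(\<integral>\<^sup>+x. epowr (F x) p * ennreal (w x) \<partial>lebesgue) \<le>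
        (\<integral>\<^sup>+x. (\<Sum>k. ennreal (2 powr p) * (ennreal (((1 / (2 * N)) powr p) ^ k) * (epowr (m k x) p * ennreal (w x)))) \<partial>lebesgue)"
      using mult_right_mono[OF pw]
      by (intro nn_integral_mono) (simp only: ennreal_suminf_multc[symmetric] ennreal_suminf_cmult mult.assoc zero_le)
    also have "\<dots> = (\<Sum>k. ennreal (2 powr p) * (ennreal (((1 / (2 * N)) powr p) ^ k) * (\<integral>\<^sup>+x. epowr (m k x) p * ennreal (w x) \<partial>lebesgue)))"
      by (simp add: nn_integral_suminf nn_integral_cmult del: ennreal_suminf_cmult)
    also have "\<dots> \<le> (\<Sum>k. ennreal (2 powr p) * ?Y * ennreal ((1 / 2) ^ k))"
    proof (intro suminf_le summableI)
      fix k
      \<comment> \<open>As N^p = C0, the growth C0^k of the iterates cancels, and 2^(-pk) \<le>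
        2^(-k) is left.\<close>
      have e: "((1 / (2 * N)) powr p) ^ k * C0 ^ k \<le> (1 / 2) ^ k"
      proof -
        have "((1 / (2 * N)) powr p) ^ k * C0 ^ k = ((1/2) powr p) ^ k"
          using N C0 by (simp add: power_mult_distrib[symmetric] powr_divide powr_mult)
        also have "\<dots> \<le> (1 / 2) ^ k"
          using p powr_mono'[of 1 p "1/2"] by (intro power_mono) auto
        finally show ?thesis .
      qed
      have "ennreal (((1 / (2 * N)) powr p) ^ k) * (\<integral>\<^sup>+x. epowr (m k x) p * ennreal (w x) \<partial>lebesgue) \<le>
         ennreal (((1 / (2 * N)) powr p) ^ k) * (ennreal (C0 ^ k) * ?Y)"
        by (intro mult_left_mono iter) auto
      also have "\<dots> = ennreal (((1 / (2 * N)) powr p) ^ k * C0 ^ k) * ?Y"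
        using C0 by (subst ennreal_mult) (auto simp: mult.assoc)
      also have "\<dots> \<le> ennreal ((1 / 2) ^ k) * ?Y"
        using e by (intro mult_right_mono ennreal_leI) auto
      finally show "ennreal (2 powr p) * (ennreal (((1 / (2 * N)) powr p) ^ k) * (\<integral>\<^sup>+x. epowr (m k x) p * ennreal (w x) \<partial>lebesgue)) \<le>
          ennreal (2 powr p) * ?Y * ennreal ((1 / 2) ^ k)"
        unfolding mult.assoc by (intro mult_left_mono) (auto simp: mult.commute)
    qed
    also have "\<dots> = ennreal (2 powr p) * ?Y * 2"
      by (simp only: ennreal_suminf_cmult suminf_half_powers_ennreal)
    also have "\<dots> = ennreal (2 * 2 powr p) * ?Y"
      by (simp add: ennreal_mult mult_ac)
    also have "\<dots> \<le> ennreal C * ?Y"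
      using N by (intro mult_right_mono ennreal_leI) (auto simp: C_def)
    finally show "\<exists>F \<in> borel_measurable lebesgue. (\<forall>x. f x \<le> F x) \<and> (\<forall>x. maxop lebesgue F x \<le> ennreal C * F x) \<and>
      (\<integral>\<^sup>+x. epowr (F x) p * ennreal (w x) \<partial>lebesgue) \<le> ennreal C * ?Y"
      using le MF by (intro bexI[of _ F]) auto
  qed
qed

section \<open>A_1 weights and the factorization of A_p weights\<close>

text \<open>Some ball of integer radius about \<open>x\<close> meets the set where \<open>F\<close>
  is positive in positive measure. This makes the A_1 majorants positive at every point.\<close>

lemma maxop_pos:
  fixes F :: "'a::euclidean_space \<Rightarrow> ennreal"
  assumes [measurable]: "F \<in> borel_measurable lebesgue" and nz: "\<not> (AE x in lebesgue. F x = 0)"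
  shows "0 < maxop lebesgue F x"
proof (rule ccontr)
  assume "\<not> 0 < maxop lebesgue F x"
  then have 0: "maxop lebesgue F x = 0" by (simp add: not_gr_zero)
  have "AE y in lebesgue. y \<in> ball x (real n) \<longrightarrow> F y = 0" for n
  proof (cases "n = 0")
    case False
    then have "(\<integral>\<^sup>+y\<in>ball x n. F y \<partial>lebesgue) / emeasure lebesgue (ball x n) = 0"
      using maxop_upper[where x = x and c = x and r = "real n" and f = F and \<mu> = lebesgue] 0 by simp
    then have "(\<integral>\<^sup>+y\<in>ball x n. F y \<partial>lebesgue) = 0"
      using emeasure_lborel_ball_less_top[of x n] by auto
    then have "AE y in lebesgue. F y * indicator (ball x n) y = 0"
      by (subst (asm) nn_integral_0_iff_AE, measurable)
    then show ?thesis by eventually_elim (auto simp: indicator_def split: if_splits)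
  qed auto
  then have "AE y in lebesgue. \<forall>n::nat. y \<in> ball x (real n) \<longrightarrow> F y = 0"
    unfolding AE_all_countable by (rule allI)
  then have "AE y in lebesgue. F y = 0"
    by eventually_elim (auto simp: mem_ball reals_Archimedean2)
  with nz show False by simp
qed

lemma wmeas_cong_AE: "AE x in lebesgue. u x = v x \<Longrightarrow> wmeas u E = wmeas v E"
  unfolding wmeas_def by (intro nn_integral_cong_AE) auto

lemma A1_bound_cong_AE:
  fixes u v :: "real^'n \<Rightarrow> real"
  shows "AE x in lebesgue. u x = v x \<Longrightarrow> A1_bound u c \<Longrightarrow> A1_bound v c"
  unfolding A1_bound_def
proof (intro allI impI)
  fix x :: "real^'n" and r :: real
  assume uv: "AE x in lebesgue. u x = v x" and r: "0 < r" and
    "\<forall>x r. 0 < r \<longrightarrow> (AE y in lebesgue. y \<in> ball x r \<longrightarrow> wmeas u (ball x r) / emeasure lebesgue (ball x r) \<le> c * ennreal (u y))"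
  then have "AE y in lebesgue. y \<in> ball x r \<longrightarrow> wmeas u (ball x r) / emeasure lebesgue (ball x r) \<le> c * ennreal (u y)"
    by blast
  then show "AE y in lebesgue. y \<in> ball x r \<longrightarrow> wmeas v (ball x r) / emeasure lebesgue (ball x r) \<le> c * ennreal (v y)"
    using uv unfolding wmeas_cong_AE[OF uv] by eventually_elim simp
qed

text \<open>Passing to real values changes \<open>F\<close> only on a null set, which neither the
  averages nor an almost everywhere bound can detect.\<close>

lemma A1_bound_maxop:
  fixes F :: "real^'n \<Rightarrow> ennreal"
  assumes [measurable]: "F \<in> borel_measurable lebesgue"
    and MF: "\<And>x. maxop lebesgue F x \<le> c * F x" and fin: "AE x in lebesgue. F x < top"
  shows "A1_bound (\<lambda>x. enn2real (F x)) c"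
  unfolding A1_bound_def
proof (intro allI impI)
  fix x :: "real^'n" and r :: real assume "0 < r"
  have eq: "wmeas (\<lambda>x. enn2real (F x)) (ball x r) = (\<integral>\<^sup>+y\<in>ball x r. F y \<partial>lebesgue)"
    unfolding wmeas_def by (intro nn_integral_cong_AE, use fin in eventually_elim) auto
  show "AE y in lebesgue. y \<in> ball x r \<longrightarrow>
      wmeas (\<lambda>x. enn2real (F x)) (ball x r) / emeasure lebesgue (ball x r) \<le> c * ennreal (enn2real (F y))"
    using fin
  proof eventually_elim
    case (elim y)
    show ?case unfolding eq
      using maxop_upper[where x = y and c = x and r = r and f = F and \<mu> = lebesgue] MF[of y] elim by (auto intro: order_trans)
  qed
qed

lemma weightI:
  fixes u :: "real^'n \<Rightarrow> real"
  assumes [measurable]: "u \<in> borel_measurable lebesgue" and pos: "AE x in lebesgue. 0 < u x"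
    and fin: "\<And>R. 0 < R \<Longrightarrow> wmeas u (ball 0 R) < top"
  shows "weight u"
  unfolding weight_def
proof (intro conjI allI impI pos)
  fix K :: "(real^'n) set" assume K: "compact K"
  then have [measurable]: "K \<in> sets lebesgue" by (simp add: borel_compact)
  obtain R where R: "0 < R" "K \<subseteq> ball 0 R"
    using compact_imp_bounded[OF K] bounded_subset_ballD by blast
  have "(\<integral>\<^sup>+x. ennreal (norm (indicator K x *\<^sub>R u x)) \<partial>lebesgue) \<le> wmeas u (ball 0 R)"
    unfolding wmeas_def using pos R(2)
    by (intro nn_integral_mono_AE, elim eventually_mono) (auto simp: indicator_def)
  also have "\<dots> < \<infinity>" using fin[OF R(1)] by simp
  finally show "set_integrable lebesgue K u"
    unfolding set_integrable_def by (intro integrableI_bounded) measurable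
qed

text \<open>An infinite or a zero average would make the ball a null set, because the right side of
  the A_1 bound is finite and \<open>A\<close> is positive almost everywhere.\<close>

lemma A1_bound_ball_average:
  fixes A :: "real^'n \<Rightarrow> real"
  assumes [measurable]: "A \<in> borel_measurable lebesgue" and pos: "AE x in lebesgue. 0 < A x"
    and A1: "A1_bound A (ennreal c)" and r: "0 < r"
  obtains a where "0 < a" "wmeas A (ball x r) = ennreal a * emeasure lebesgue (ball x r)"
    "AE y in lebesgue. y \<in> ball x r \<longrightarrow> a \<le> c * A y"
proof -
  let ?L = "emeasure lebesgue (ball x r)"
  have L: "0 < ?L" "?L < top" using emeasure_lborel_ball_pos[OF r, of x] emeasure_lborel_ball_less_top[of x r] by auto
  have le: "AE y in lebesgue. y \<in> ball x r \<longrightarrow> wmeas A (ball x r) / ?L \<le> ennreal c * ennreal (A y)"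
    using A1 r by (auto simp: A1_bound_def)
  have "wmeas A (ball x r) / ?L < top"
  proof (rule ccontr)
    assume "\<not> ?thesis"
    then have "wmeas A (ball x r) / ?L = top" by (meson not_less top_unique)
    then have "AE y in lebesgue. y \<notin> ball x r"
      using le by (auto simp: ennreal_mult_eq_top_iff top_unique elim!: eventually_mono)
    then have "?L = 0" by (subst (asm) AE_iff_null_sets[symmetric]) auto
    with L show False by simp
  qed
  then obtain a where a: "0 \<le> a" "wmeas A (ball x r) / ?L = ennreal a"
    by (auto simp: less_top_ennreal)
  have "wmeas A (ball x r) \<noteq> 0"
  proof
    assume "wmeas A (ball x r) = 0"
    then have "AE y in lebesgue. ennreal (A y) * indicator (ball x r) y = 0"
      unfolding wmeas_def by (subst (asm) nn_integral_0_iff_AE, measurable)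
    then have "AE y in lebesgue. y \<notin> ball x r"
      using pos by eventually_elim (auto simp: indicator_def split: if_splits)
    then have "?L = 0" by (subst (asm) AE_iff_null_sets[symmetric]) auto
    with L show False by simp
  qed
  then have a0: "0 < a" using a L by (metis ennreal_0 ennreal_divide_eq_0_iff less_le less_irrefl)
  have "wmeas A (ball x r) = wmeas A (ball x r) / ?L * ?L"
    using L by (auto simp: ennreal_divide_times)
  then have w: "wmeas A (ball x r) = ennreal a * ?L" using a by simp
  have "AE y in lebesgue. y \<in> ball x r \<longrightarrow> a \<le> c * A y"
    using le pos
  proof eventually_elim
    case (elim y)
    show ?case
    proof
      assume "y \<in> ball x r"
      then have "ennreal a \<le> ennreal (c * A y)" using elim a by (simp add: ennreal_mult'')
      then show "a \<le> c * A y" using a0 by (simp add: ennreal_le_iff2)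
    qed
  qed
  then show ?thesis using that a0 w by blast
qed

text \<open>The elementary half of the Jones factorization theorem. If \<open>a\<close> and
  \<open>d\<close> are the averages of \<open>A\<close> and \<open>D\<close> over a ball, the A_1
  bounds give A \<ge> a/c and D \<ge> d/c there. Inserted into the negative powers, they cancel
  \<open>a\<close> and \<open>d\<close> and leave c^(p-1) c.\<close>

lemma Ap_factorization:
  fixes A D :: "real^'n \<Rightarrow> real"
  assumes mA [measurable]: "A \<in> borel_measurable lebesgue" and mD [measurable]: "D \<in> borel_measurable lebesgue"
    and pos: "AE x in lebesgue. 0 < A x" "AE x in lebesgue. 0 < D x"
    and A1: "A1_bound A (ennreal c)" "A1_bound D (ennreal c)" and p: "1 \<le> p"
  shows "(\<lambda>x. A x * D x powr (1 - p)) \<in> Ap p"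
    "Ap_const p (\<lambda>x. A x * D x powr (1 - p)) \<le> ennreal (c powr p)"
proof -
  define u where "u = (\<lambda>x. A x * D x powr (1 - p))"
  have [measurable]: "u \<in> borel_measurable lebesgue" unfolding u_def by measurable
  have upos: "AE x in lebesgue. 0 < u x"
    using pos by eventually_elim (auto simp: u_def)
  \<comment> \<open>Otherwise the bound a \<le> c A would fail almost everywhere on the unit ball,
    which is not null.\<close>
  have c: "0 < c"
  proof -
    obtain a where a: "0 < a" "AE y in lebesgue. y \<in> ball 0 1 \<longrightarrow> a \<le> c * A y"
      using A1_bound_ball_average[OF mA pos(1) A1(1), of 1 0] by auto
    show ?thesis
    proof (rule ccontr)
      assume c0: "\<not> 0 < c"
      have "AE y in lebesgue. y \<notin> (ball 0 1 :: (real^'n) set)"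
        using a(2) pos(1)
      proof eventually_elim
        case (elim y)
        have "c * A y \<le> 0" using elim(2) c0 by (intro mult_nonpos_nonneg) auto
        then show ?case using elim(1) a(1) by auto
      qed
      then have "emeasure lebesgue (ball 0 1 :: (real^'n) set) = 0" by (subst (asm) AE_iff_null_sets[symmetric]) auto
      then show False using emeasure_lborel_ball_pos[of 1 "0::real^'n"] by simp
    qed
  qed
  have est: "\<exists>a d. 0 < a \<and> 0 < d \<and>
      wmeas u (ball x r) \<le> ennreal ((d / c) powr (1 - p) * a) * emeasure lebesgue (ball x r) \<and>
      (1 < p \<longrightarrow> wmeas (\<lambda>y. u y powr (1 - p / (p - 1))) (ball x r) \<le>
        ennreal ((a / c) powr (- 1 / (p - 1)) * d) * emeasure lebesgue (ball x r))"
    if r: "0 < r" for x r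
  proof -
    obtain a where a: "0 < a" "wmeas A (ball x r) = ennreal a * emeasure lebesgue (ball x r)"
      "AE y in lebesgue. y \<in> ball x r \<longrightarrow> a \<le> c * A y"
      using A1_bound_ball_average[OF mA pos(1) A1(1) r] by blast
    obtain d where d: "0 < d" "wmeas D (ball x r) = ennreal d * emeasure lebesgue (ball x r)"
      "AE y in lebesgue. y \<in> ball x r \<longrightarrow> d \<le> c * D y"
      using A1_bound_ball_average[OF mD pos(2) A1(2) r] by blast
    have "wmeas u (ball x r) \<le> (\<integral>\<^sup>+y. ennreal ((d / c) powr (1 - p)) * (ennreal (A y) * indicator (ball x r) y) \<partial>lebesgue)"
      unfolding wmeas_def using d(3) pos
    proof (intro nn_integral_mono_AE, eventually_elim)
      case (elim y)
      show ?case
      proof (cases "y \<in> ball x r")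
        case True
        then have "d / c \<le> D y" using elim c by (simp add: field_simps)
        then have "D y powr (1 - p) \<le> (d / c) powr (1 - p)"
          using p c d by (intro powr_mono2') auto
        then have "u y \<le> (d / c) powr (1 - p) * A y"
          using elim by (simp add: u_def mult.commute)
        then show ?thesis using True elim by (simp add: ennreal_mult[symmetric])
      qed auto
    qed
    also have "\<dots> = ennreal ((d / c) powr (1 - p)) * wmeas A (ball x r)"
      unfolding wmeas_def by (rule nn_integral_cmult) measurable
    also have "\<dots> = ennreal ((d / c) powr (1 - p) * a) * emeasure lebesgue (ball x r)"
      unfolding a(2) using a(1) by (simp add: ennreal_mult mult.assoc)
    finally have 1: "wmeas u (ball x r) \<le> ennreal ((d / c) powr (1 - p) * a) * emeasure lebesgue (ball x r)" .
    have 2: "wmeas (\<lambda>y. u y powr (1 - p / (p - 1))) (ball x r) \<le>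
        ennreal ((a / c) powr (- 1 / (p - 1)) * d) * emeasure lebesgue (ball x r)" if p1: "1 < p"
    proof -
      \<comment> \<open>The exponent 1 - p' takes D^(1-p) back to D.\<close>
      have e: "1 - p / (p - 1) = - 1 / (p - 1)" "(1 - p) * (- 1 / (p - 1)) = 1" using p1 by (auto simp: field_simps)
      have "wmeas (\<lambda>y. u y powr (1 - p / (p - 1))) (ball x r) \<le> (\<integral>\<^sup>+y. ennreal ((a / c) powr (- 1 / (p - 1))) * (ennreal (D y) * indicator (ball x r) y) \<partial>lebesgue)"
        unfolding wmeas_def using a(3) pos
      proof (intro nn_integral_mono_AE, eventually_elim)
        case (elim y)
        show ?case
        proof (cases "y \<in> ball x r")
          case True
          then have "a / c \<le> A y" using elim c by (simp add: field_simps)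
          then have *: "A y powr (- 1 / (p - 1)) \<le> (a / c) powr (- 1 / (p - 1))"
            using p1 c a by (intro powr_mono2') auto
          have "u y powr (1 - p / (p - 1)) = A y powr (- 1 / (p - 1)) * D y powr ((1 - p) * (- 1 / (p - 1)))"
            unfolding e(1) u_def using elim by (simp only: powr_mult powr_powr)
          also have "\<dots> = A y powr (- 1 / (p - 1)) * D y"
            unfolding e(2) using elim by simp
          also have "\<dots> \<le> (a / c) powr (- 1 / (p - 1)) * D y"
            using * elim by (intro mult_right_mono) auto
          finally show ?thesis using True elim by (simp add: ennreal_mult[symmetric])
        qed auto
      qed
      also have "\<dots> = ennreal ((a / c) powr (- 1 / (p - 1))) * wmeas D (ball x r)"
        unfolding wmeas_def by (rule nn_integral_cmult) measurable
      also have "\<dots> = ennreal ((a / c) powr (- 1 / (p - 1)) * d) * emeasure lebesgue (ball x r)"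
        unfolding d(2) using d(1) by (simp add: ennreal_mult mult.assoc)
      finally show ?thesis .
    qed
    from 1 2 a(1) d(1) show ?thesis by blast
  qed
  have weight: "weight u"
  proof (rule weightI)
    fix R :: real assume "0 < R"
    from est[OF this, of 0] obtain t where "wmeas u (ball 0 R) \<le> ennreal t * emeasure lebesgue (ball (0::real^'n) R)"
      by blast
    also have "\<dots> < top" using emeasure_lborel_ball_less_top[of "0::real^'n" R] by (simp add: ennreal_mult_less_top)
    finally show "wmeas u (ball 0 R) < top" .
  qed (use upos in auto)
  have "u \<in> Ap p \<and> Ap_const p u \<le> ennreal (c powr p)"
  proof (cases "p = 1")
    case True
    \<comment> \<open>\<open>0 powr 0\<close> is 0, so the two functions are compared only where
      \<open>D\<close> is positive.\<close>
    have "AE x in lebesgue. A x = u x"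
      using pos(2) by eventually_elim (simp add: u_def True)
    then have "A1_bound u (ennreal c)" by (rule A1_bound_cong_AE[OF _ A1(1)])
    moreover from this have "Inf {c. A1_bound u c} \<le> ennreal c" by (intro Inf_lower) auto
    ultimately show ?thesis using True weight c by (auto simp: Ap_def Ap_const_def intro!: exI[of _ "ennreal c"])
  next
    case False
    then have p1: "1 < p" using p by simp
    have "Ap_const p u \<le> ennreal (c powr p)"
    proof -
      have main: "wmeas u (ball x r) / emeasure lebesgue (ball x r) *
          epowr (wmeas (\<lambda>y. u y powr (1 - p / (p - 1))) (ball x r) / emeasure lebesgue (ball x r)) (p - 1) \<le> ennreal (c powr p)"
        if r: "r \<in> {0<..}" for x r
      proof -
      let ?L = "emeasure lebesgue (ball x r)"
      have L: "0 < ?L" "?L < top" using r emeasure_lborel_ball_pos[of r x] emeasure_lborel_ball_less_top[of x r] by auto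
      have div: "s / ?L \<le> t" if "s \<le> t * ?L" for s t
        using that L by (metis divide_right_mono_ennreal ennreal_divide_self ennreal_times_divide less_irrefl mult.right_neutral)
      obtain a d where ad: "0 < a" "0 < d"
        "wmeas u (ball x r) \<le> ennreal ((d / c) powr (1 - p) * a) * ?L"
        "wmeas (\<lambda>y. u y powr (1 - p / (p - 1))) (ball x r) \<le> ennreal ((a / c) powr (- 1 / (p - 1)) * d) * ?L"
        using est[of r x] r p1 by auto
      have "wmeas u (ball x r) / ?L * epowr (wmeas (\<lambda>y. u y powr (1 - p / (p - 1))) (ball x r) / ?L) (p - 1) \<le>
          ennreal ((d / c) powr (1 - p) * a) * epowr (ennreal ((a / c) powr (- 1 / (p - 1)) * d)) (p - 1)"
        using p1 by (intro mult_mono div ad epowr_mono) auto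
      also have "\<dots> = ennreal ((d / c) powr (1 - p) * a * ((a / c) powr (- 1 / (p - 1)) * d) powr (p - 1))"
      proof -
        have "epowr (ennreal ((a / c) powr (- 1 / (p - 1)) * d)) (p - 1) = ennreal (((a / c) powr (- 1 / (p - 1)) * d) powr (p - 1))"
          using ad by (intro epowr_ennreal) auto
        then show ?thesis using ad by (simp only:) (intro ennreal_mult[symmetric]; simp)
      qed
      also have "((a / c) powr (- 1 / (p - 1)) * d) powr (p - 1) = (a / c) powr (- 1) * d powr (p - 1)"
        using p1 by (simp add: powr_mult powr_powr)
      also have "(d / c) powr (1 - p) * a * ((a / c) powr (- 1) * d powr (p - 1)) = c powr p"
      proof -
        have "(d / c) powr (1 - p) = d powr (- (p - 1)) * c powr (p - 1)"
          using ad c by (simp add: powr_divide powr_minus field_simps powr_diff)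
        moreover have "d powr (- (p - 1)) * d powr (p - 1) = 1"
          using ad by (simp only: powr_minus) simp
        ultimately have "(d / c) powr (1 - p) * d powr (p - 1) = c powr (p - 1)"
          by (metis mult.commute mult.left_commute mult.right_neutral)
        moreover have "a * (a / c) powr (- 1) = c"
          using ad c by (simp add: powr_minus field_simps)
        ultimately have "(d / c) powr (1 - p) * a * ((a / c) powr (- 1) * d powr (p - 1)) = c powr (p - 1) * c"
          by (metis mult.assoc mult.commute)
        then show ?thesis using c by (simp add: powr_diff)
      qed
      finally show ?thesis .
      qed
      show ?thesis
        unfolding Ap_const_def if_not_P[OF False]
        by (intro SUP_least, erule SigmaE, simp only: prod.case, rule main)
    qed
    moreover from this have "Ap_const p u < top" by (rule le_less_trans) simp
    ultimately show ?thesis using False weight by (simp add: Ap_def)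
  qed
  then show "(\<lambda>x. A x * D x powr (1 - p)) \<in> Ap p"
    "Ap_const p (\<lambda>x. A x * D x powr (1 - p)) \<le> ennreal (c powr p)"
    unfolding u_def by auto
qed

text \<open>Multiplying the averages by |B| and |B|^(p-1) turns the bounded supremum into the
  product form of \<open>ap_pair\<close>.\<close>

lemma ap_pairI:
  fixes u :: "real^'n \<Rightarrow> real"
  assumes [measurable]: "u \<in> borel_measurable lebesgue" and pos: "\<And>x. 0 < u x" and p: "1 < p" and K: "0 < K"
    and le: "Ap_const p u \<le> ennreal K"
  shows "ap_pair p K u (\<lambda>x. u x powr (1 - p / (p - 1)))"
  unfolding ap_pair_def
proof (intro conjI allI impI)
  fix x
  have "(1 - p / (p - 1)) * (p - 1) = - 1" using p by (simp add: field_simps)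
  then show "u x * (u x powr (1 - p / (p - 1))) powr (p - 1) = 1"
    using pos[of x] by (simp only: powr_powr) (simp add: powr_minus)
next
  fix x :: "real^'n" and r :: real assume r: "0 < r"
  let ?L = "emeasure lebesgue (ball x r)"
  have L: "0 < ?L" "?L < top" using r emeasure_lborel_ball_pos[of r x] emeasure_lborel_ball_less_top[of x r] by auto
  let ?W = "\<integral>\<^sup>+y\<in>ball x r. ennreal (u y) \<partial>lebesgue"
  let ?S = "\<integral>\<^sup>+y\<in>ball x r. ennreal (u y powr (1 - p / (p - 1))) \<partial>lebesgue"
  have *: "?W / ?L * epowr (?S / ?L) (p - 1) \<le> ennreal K"
  proof -
    have "?W / ?L * epowr (?S / ?L) (p - 1) \<le> Ap_const p u"
      unfolding Ap_const_def wmeas_def using r p by (auto intro!: SUP_upper2[of "(x, r)"])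
    then show ?thesis using le by (rule order_trans)
  qed
  have W: "?W = ?W / ?L * ?L" "?S = ?S / ?L * ?L"
    using L by (auto simp: ennreal_divide_times)
  have "?W * epowr ?S (p - 1) = ?W / ?L * ?L * epowr (?S / ?L * ?L) (p - 1)"
    using W by simp
  also have "\<dots> = ?W / ?L * epowr (?S / ?L) (p - 1) * (epowr ?L 1 * epowr ?L (p - 1))"
    by (simp add: epowr_mult mult_ac)
  also have "epowr ?L 1 * epowr ?L (p - 1) = epowr ?L p"
    by (simp only: epowr_add) simp
  also have "?W / ?L * epowr (?S / ?L) (p - 1) * epowr ?L p \<le> ennreal K * epowr ?L p"
    by (intro mult_right_mono *) auto
  finally show "?W * epowr ?S (p - 1) \<le> ennreal K * epowr ?L p" .
qed (use pos K in \<open>auto simp: less_imp_neq[symmetric]\<close>)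

section \<open>Extrapolation\<close>

text \<open>Both factors are bounded by powers of the maximum \<open>m\<close>, and m^(1/p) m^(1/p')
  = m.\<close>

lemma epowr_young:
  assumes "1 < p"
  shows "a * b \<le> epowr a p + epowr b (p / (p - 1))"
proof -
  define m where "m = max (epowr a p) (epowr b (p / (p - 1)))"
  have "epowr a p \<le> m" "epowr b (p / (p - 1)) \<le> m" by (auto simp: m_def)
  then have "a \<le> epowr m (1 / p)" "b \<le> epowr m (1 / (p / (p - 1)))"
    using assms by (auto simp: epowr_le_iff)
  then have "a * b \<le> epowr m (1 / p) * epowr m (1 / (p / (p - 1)))"
    by (intro mult_mono) auto
  also have "\<dots> = m"
    using assms by (simp add: epowr_add diff_divide_distrib add_divide_distrib[symmetric])
  also have "\<dots> \<le> epowr a p + epowr b (p / (p - 1))"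
    unfolding m_def by (simp add: add_increasing add_increasing2)
  finally show ?thesis .
qed

text \<open>The working form of the hypothesis: integrals instead of norms, and a single constant
  for all weights whose constant is at most \<open>K\<close>.\<close>

definition uniform_Ap_bound :: "real \<Rightarrow> ((real^'n \<Rightarrow> ennreal) \<times> (real^'n \<Rightarrow> ennreal)) set \<Rightarrow> bool" where
  "uniform_Ap_bound p F \<longleftrightarrow> (\<forall>K. \<exists>C>0. \<forall>u\<in>Ap p. Ap_const p u \<le> ennreal K \<longrightarrow>
     (\<forall>(f, g)\<in>F. (\<integral>\<^sup>+x. epowr (g x) p * ennreal (u x) \<partial>lebesgue)
       \<le> ennreal C * (\<integral>\<^sup>+x. epowr (f x) p * ennreal (u x) \<partial>lebesgue)))"

lemma A1_bound_1: "A1_bound (\<lambda>_ :: real^'n. 1) (ennreal 1)"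
  unfolding A1_bound_def
proof (intro allI impI AE_I2)
  fix x y :: "real^'n" and r :: real assume r: "0 < r"
  show "wmeas (\<lambda>_. 1) (ball x r) / emeasure lebesgue (ball x r) \<le> ennreal 1 * ennreal 1"
    using emeasure_lborel_ball_pos[OF r, of x] emeasure_lborel_ball_less_top[of x r]
    by (auto simp: wmeas_def less_imp_neq[symmetric])
qed

text \<open>Splitting at \<open>g \<le> F\<close> replaces the application of Hoelder's inequality in the usual proof of
  extrapolation.\<close>

lemma dual_majorant_inequality:
  assumes "1 \<le> p0" and f: "f \<le> F" and F: "0 < F" "F < top" and H: "0 < H" "H < top"
  shows "g * H \<le> F * H + epowr g p0 * ennreal (enn2real H * enn2real F powr (1 - p0))"
    and "epowr f p0 * ennreal (enn2real H * enn2real F powr (1 - p0)) \<le> F * H"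
proof -
  obtain F' where F': "F = ennreal F'" "0 < F'" using F by (cases F) auto
  obtain H' where H': "H = ennreal H'" "0 < H'" using H by (cases H) auto
  show "g * H \<le> F * H + epowr g p0 * ennreal (enn2real H * enn2real F powr (1 - p0))"
  proof (cases g)
    case top
    then show ?thesis using F' H' by (simp add: ennreal_top_mult)
  next
    case (real g')
    show ?thesis
    proof (cases "g' \<le> F'")
      case True
      then have "g * H \<le> F * H" using real F' H' by (intro mult_right_mono) auto
      then show ?thesis by (simp add: add_increasing2)
    next
      case False
      \<comment> \<open>Where g > F, the factor (g/F)^(p0-1) is at least 1.\<close>
      have "F' powr (p0 - 1) \<le> g' powr (p0 - 1)"
        using F' False assms(1) by (intro powr_mono2) auto
      then have "g' * F' powr (p0 - 1) \<le> g' * g' powr (p0 - 1)"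
        using real by (intro mult_left_mono) auto
      also have "\<dots> = g' powr p0"
        using powr_mult_base[of g' "p0 - 1"] real by simp
      finally have "g' \<le> g' powr p0 / F' powr (p0 - 1)"
        using F' by (simp add: field_simps)
      also have "\<dots> = g' powr p0 * F' powr (1 - p0)"
        using powr_minus_divide[of F' "p0 - 1"] by simp
      finally have "g' * H' \<le> g' powr p0 * F' powr (1 - p0) * H'"
        using H' by (intro mult_right_mono) auto
      then have "g * H \<le> epowr g p0 * ennreal (H' * F' powr (1 - p0))"
        using real H' F' by (simp add: epowr_ennreal ennreal_mult[symmetric] mult_ac)
      then show ?thesis using F' H' by (simp add: add_increasing)
    qed
  qed
  have "epowr f p0 * ennreal (H' * F' powr (1 - p0)) \<le> epowr F p0 * ennreal (H' * F' powr (1 - p0))"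
    using f assms(1) by (intro mult_right_mono epowr_mono) auto
  also have "\<dots> = F * H"
  proof -
    have "F' powr p0 * F' powr (1 - p0) = F'" using F' by (simp add: powr_add[symmetric])
    then have "F' powr p0 * (H' * F' powr (1 - p0)) = F' * H'" by (metis mult.assoc mult.commute)
    then show ?thesis using F' H' by (simp add: epowr_ennreal ennreal_mult[symmetric])
  qed
  finally show "epowr f p0 * ennreal (enn2real H * enn2real F powr (1 - p0)) \<le> F * H"
    using F' H' by simp
qed

text \<open>Let X and Y be the integrals of g^p w and f^p w. The majorants \<open>F\<close> of
  \<open>f\<close> and \<open>H\<close> of g^(p-1) w give X \<le> (1 + C2) Z with Z the integral of
  F H, and Young's inequality bounds Z by a multiple of Y plus a small multiple of X, which is
  absorbed. One argument covers p < p0 and p > p0 alike.\<close>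

theorem extrapolation:
  fixes \<F> :: "((real^'n \<Rightarrow> ennreal) \<times> (real^'n \<Rightarrow> ennreal)) set"
  assumes U: "uniform_Ap_bound p0 \<F>" and p0: "1 \<le> p0" and p: "1 < p"
    and meas: "\<And>f g. (f, g) \<in> \<F> \<Longrightarrow> f \<in> borel_measurable lebesgue \<and> g \<in> borel_measurable lebesgue"
  shows "\<exists>C>0. \<forall>w \<sigma>. ap_pair p K w \<sigma> \<longrightarrow> (\<forall>(f, g)\<in>\<F>. \<forall>c r.
    (\<integral>\<^sup>+x\<in>ball c r. epowr (g x) p * ennreal (w x) \<partial>lebesgue) \<le>
      ennreal C * (\<integral>\<^sup>+x. epowr (f x) p * ennreal (w x) \<partial>lebesgue))"
proof -
  define p' where "p' = p / (p - 1)"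
  have p': "1 < p'" "p' * (p - 1) = p" "(p - 1) * p' = p" "p' / (p' - 1) = p" using p by (auto simp: p'_def field_simps)
  obtain Ca where Ca: "0 < Ca" and rdf1: "\<forall>w \<sigma> f. ap_pair p K w \<sigma> \<longrightarrow> f \<in> borel_measurable lebesgue \<longrightarrow>
    (\<exists>F \<in> borel_measurable (lebesgue :: (real^'n) measure).
      (\<forall>x. f x \<le> F x) \<and> (\<forall>x. maxop lebesgue F x \<le> ennreal Ca * F x) \<and>
      (\<integral>\<^sup>+x. epowr (F x) p * ennreal (w x) \<partial>lebesgue) \<le>
        ennreal Ca * (\<integral>\<^sup>+x. epowr (f x) p * ennreal (w x) \<partial>lebesgue))"
    using rubio_de_francia[OF p, of K] by (elim exE conjE) (rule that)
  obtain Cb where Cb: "0 < Cb" and rdf2: "\<forall>w \<sigma> f. ap_pair p' (K powr (1 / (p - 1))) w \<sigma> \<longrightarrow> f \<in> borel_measurable lebesgue \<longrightarrow>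
    (\<exists>F \<in> borel_measurable (lebesgue :: (real^'n) measure).
      (\<forall>x. f x \<le> F x) \<and> (\<forall>x. maxop lebesgue F x \<le> ennreal Cb * F x) \<and>
      (\<integral>\<^sup>+x. epowr (F x) p' * ennreal (w x) \<partial>lebesgue) \<le>
        ennreal Cb * (\<integral>\<^sup>+x. epowr (f x) p' * ennreal (w x) \<partial>lebesgue))"
    using rubio_de_francia[OF p'(1), of "K powr (1 / (p - 1))"] by (elim exE conjE) (rule that)
  define Cm where "Cm = max Ca Cb"
  have uni: "\<exists>C>0. \<forall>u f g. u \<in> Ap p0 \<longrightarrow> Ap_const p0 u \<le> ennreal K \<longrightarrow> (f, g) \<in> \<F> \<longrightarrow>
      (\<integral>\<^sup>+x. epowr (g x) p0 * ennreal (u x) \<partial>lebesgue) \<le> ennreal C * (\<integral>\<^sup>+x. epowr (f x) p0 * ennreal (u x) \<partial>lebesgue)" for K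
  proof -
    obtain C where C: "0 < C" and le: "\<forall>u\<in>Ap p0. Ap_const p0 u \<le> ennreal K \<longrightarrow>
     (\<forall>(f, g)\<in>\<F>. (\<integral>\<^sup>+x. epowr (g x) p0 * ennreal (u x) \<partial>lebesgue)
       \<le> ennreal C * (\<integral>\<^sup>+x. epowr (f x) p0 * ennreal (u x) \<partial>lebesgue))"
      using U[unfolded uniform_Ap_bound_def, rule_format, of K] by (elim exE conjE) (rule that)
    show ?thesis
      by (intro exI[of _ C] conjI C allI impI) (use le in fast)
  qed
  \<comment> \<open>The bound for the constant weight 1. It is used only when \<open>f\<close>
    vanishes almost everywhere, since its majorant then vanishes too and yields no weight.\<close>
  obtain C1 where C1: "0 < C1" "\<And>u f g. u \<in> Ap p0 \<Longrightarrow> Ap_const p0 u \<le> ennreal (1 powr p0) \<Longrightarrow> (f, g) \<in> \<F> \<Longrightarrow>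
      (\<integral>\<^sup>+x. epowr (g x) p0 * ennreal (u x) \<partial>lebesgue) \<le> ennreal C1 * (\<integral>\<^sup>+x. epowr (f x) p0 * ennreal (u x) \<partial>lebesgue)"
    using uni[of "1 powr p0"] by (elim exE conjE) (rule that; blast)
  obtain C2 where C2: "0 < C2" "\<And>u f g. u \<in> Ap p0 \<Longrightarrow> Ap_const p0 u \<le> ennreal (Cm powr p0) \<Longrightarrow> (f, g) \<in> \<F> \<Longrightarrow>
      (\<integral>\<^sup>+x. epowr (g x) p0 * ennreal (u x) \<partial>lebesgue) \<le> ennreal C2 * (\<integral>\<^sup>+x. epowr (f x) p0 * ennreal (u x) \<partial>lebesgue)"
    using uni[of "Cm powr p0"] by (elim exE conjE) (rule that; blast)
  \<comment> \<open>Chosen so that the coefficient of X after Young's inequality is 1/2; the factor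
    2 in \<open>C\<close> then comes from absorbing it.\<close>
  define s where "s = (2 * (1 + C2) * Cb) powr (1 / p')"
  have s: "0 < s" using C2 Cb by (auto simp: s_def)
  have s_p': "(1 + C2) * (s powr (- p') * Cb) = 1 / 2"
  proof -
    have "0 < 2 * (1 + C2) * Cb" using C2 Cb by auto
    moreover from this have "s powr (- p') = 1 / (2 * (1 + C2) * Cb)"
      using p' by (simp add: s_def powr_powr powr_minus_divide)
    ultimately show ?thesis using C2 Cb by (auto simp: field_simps)
  qed
  define C where "C = 2 * ((1 + C2) * (s powr p * Ca))"
  have C0: "0 < C" using C2 s Ca by (simp add: C_def)
  show ?thesis
  proof (intro exI[of _ C] conjI allI impI C0 ballI, clarify)
    fix w \<sigma> :: "real^'n \<Rightarrow> real" and f g and c :: "real^'n" and r :: real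
    assume w: "ap_pair p K w \<sigma>" and fg: "(f, g) \<in> \<F>"
    have [measurable]: "f \<in> borel_measurable lebesgue" "g \<in> borel_measurable lebesgue"
      using meas[OF fg] by auto
    have [measurable]: "w \<in> borel_measurable lebesgue" "\<sigma> \<in> borel_measurable lebesgue"
      and pos: "\<And>x. 0 < w x" "\<And>x. 0 < \<sigma> x" "\<And>x. w x * \<sigma> x powr (p - 1) = 1"
      using w by (auto simp: ap_pair_def)
    have nz: "ennreal (w x) \<noteq> 0" "ennreal (\<sigma> x) \<noteq> 0" for x
      using pos(1,2)[of x] by auto
    have w': "ap_pair p' (K powr (1 / (p - 1))) \<sigma> w"
      unfolding p'_def by (rule ap_pair_swap[OF w p])
    let ?B = "ball c r"
    let ?Y = "\<integral>\<^sup>+x. epowr (f x) p * ennreal (w x) \<partial>lebesgue"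
    show "(\<integral>\<^sup>+x\<in>?B. epowr (g x) p * ennreal (w x) \<partial>lebesgue) \<le> ennreal C * ?Y"
    proof (cases "?Y = top \<or> (AE x in lebesgue. f x = 0) \<or> r \<le> 0")
      case True
      then consider "?Y = top" | "AE x in lebesgue. f x = 0" | "r \<le> 0" by blast
      then show ?thesis
      proof cases
        case 1
        then show ?thesis using C0 by (simp add: ennreal_mult_top)
      next
        case 2
        have 1: "(\<lambda>x. 1 * 1 powr (1 - p0)) \<in> (Ap p0 :: (real^'n \<Rightarrow> real) set)"
          "Ap_const p0 (\<lambda>x::real^'n. 1 * 1 powr (1 - p0)) \<le> ennreal (1 powr p0)"
          by (rule Ap_factorization[OF _ _ _ _ A1_bound_1 A1_bound_1 p0]; simp)+
        have "(\<integral>\<^sup>+x. epowr (f x) p0 * ennreal (1 * 1 powr (1 - p0)) \<partial>lebesgue) = 0"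
          using 2 by (subst nn_integral_0_iff_AE, measurable) (auto elim!: eventually_mono)
        then have "(\<integral>\<^sup>+x. epowr (g x) p0 * ennreal (1 * 1 powr (1 - p0)) \<partial>lebesgue) = 0"
          using C1(2)[OF 1 fg] by simp
        then have "AE x in lebesgue. g x = 0"
          by (subst (asm) nn_integral_0_iff_AE, measurable) (auto elim!: eventually_mono)
        then have "(\<integral>\<^sup>+x\<in>?B. epowr (g x) p * ennreal (w x) \<partial>lebesgue) = 0"
          by (subst nn_integral_0_iff_AE, measurable) (auto elim!: eventually_mono)
        then show ?thesis by simp
      qed (auto simp: ball_empty)
    next
      case False
      then have Y: "?Y < top" and fnz: "\<not> (AE x in lebesgue. f x = 0)" and r: "0 < r" by (auto simp: less_top)
      have trunc: "(\<integral>\<^sup>+x\<in>?B. epowr (min (g x) (of_nat n)) p * ennreal (w x) \<partial>lebesgue) \<le> ennreal C * ?Y" for n :: nat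
      proof -
        define h where "h x = min (g x) (of_nat n) * indicator ?B x" for x
        \<comment> \<open>The extremal dual function: the integral of its power p' against
          \<open>\<sigma>\<close> is again X.\<close>
        define k where "k x = epowr (h x) (p - 1) * ennreal (w x)" for x
        have [measurable]: "h \<in> borel_measurable lebesgue" "k \<in> borel_measurable lebesgue"
          unfolding h_def k_def by measurable
        let ?X = "\<integral>\<^sup>+x. epowr (h x) p * ennreal (w x) \<partial>lebesgue"
        have X_eq: "(\<integral>\<^sup>+x\<in>?B. epowr (min (g x) (of_nat n)) p * ennreal (w x) \<partial>lebesgue) = ?X"
          by (intro nn_integral_cong) (auto simp: h_def indicator_def)
        have Xfin: "?X < top"
        proof -
          have "?X \<le> (\<integral>\<^sup>+x. ennreal (real n powr p) * (ennreal (w x) * indicator ?B x) \<partial>lebesgue)"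
          proof (intro nn_integral_mono)
            fix x
            have "epowr (h x) p \<le> epowr (of_nat n) p" if "x \<in> ?B"
              using p that by (intro epowr_mono) (auto simp: h_def)
            also have "epowr (of_nat n) p = ennreal (real n powr p)"
              by (simp add: ennreal_of_nat_eq_real_of_nat epowr_ennreal)
            finally show "epowr (h x) p * ennreal (w x) \<le> ennreal (real n powr p) * (ennreal (w x) * indicator ?B x)"
              by (cases "x \<in> ?B") (auto intro!: mult_right_mono simp: h_def)
          qed
          also have "\<dots> = ennreal (real n powr p) * (\<integral>\<^sup>+x\<in>?B. ennreal (w x) \<partial>lebesgue)"
            by (rule nn_integral_cmult) measurable
          also have "\<dots> < top" using ap_pair_finite[OF w p r, of c] by (simp add: ennreal_mult_less_top)
          finally show ?thesis .
        qed
        have kX: "(\<integral>\<^sup>+x. epowr (k x) p' * ennreal (\<sigma> x) \<partial>lebesgue) = ?X"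
        proof (intro nn_integral_cong)
          fix x
          have "w x powr p' * \<sigma> x = \<sigma> x powr (- (p - 1) * p') * \<sigma> x powr 1"
            using eq_powr_minusI[OF pos(3)[of x]] pos(2)[of x] by (simp only: powr_powr) simp
          also have "\<dots> = \<sigma> x powr (- (p - 1))"
          proof -
            have "- (p - 1) * p' + 1 = - (p - 1)" using p'(3) by (simp add: algebra_simps)
            then show ?thesis by (simp only: powr_add[symmetric])
          qed
          also have "\<dots> = w x" by (rule eq_powr_minusI[OF pos(3), symmetric])
          finally have "ennreal (w x powr p') * ennreal (\<sigma> x) = ennreal (w x)"
            using pos(2)[of x] by (simp add: ennreal_mult[symmetric])
          moreover have "epowr (k x) p' = epowr (h x) p * ennreal (w x powr p')"
            using pos(1)[of x] p' by (simp add: k_def epowr_mult epowr_epowr epowr_ennreal less_imp_le)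
          ultimately show "epowr (k x) p' * ennreal (\<sigma> x) = epowr (h x) p * ennreal (w x)"
            by (simp only: mult.assoc)
        qed
        show ?thesis
        proof (cases "?X = 0")
          case True
          then show ?thesis unfolding X_eq by simp
        next
          case False
          obtain F where [measurable]: "F \<in> borel_measurable lebesgue" and F: "\<And>x. f x \<le> F x"
            "\<And>x. maxop lebesgue F x \<le> ennreal Ca * F x" "(\<integral>\<^sup>+x. epowr (F x) p * ennreal (w x) \<partial>lebesgue) \<le> ennreal Ca * ?Y"
            using rdf1[rule_format, OF w, of f] by auto
          obtain H where [measurable]: "H \<in> borel_measurable lebesgue" and H: "\<And>x. k x \<le> H x"
            "\<And>x. maxop lebesgue H x \<le> ennreal Cb * H x" "(\<integral>\<^sup>+x. epowr (H x) p' * ennreal (\<sigma> x) \<partial>lebesgue) \<le> ennreal Cb * ?X"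
            using rdf2[rule_format, OF w', of k] kX by auto
          have knz: "\<not> (AE x in lebesgue. k x = 0)"
          proof
            assume "AE x in lebesgue. k x = 0"
            then have "AE x in lebesgue. epowr (h x) p * ennreal (w x) = 0"
              by eventually_elim (auto simp: k_def nz)
            then have "?X = 0" by (subst nn_integral_0_iff_AE, measurable)
            with False show False by simp
          qed
          have posF: "0 < F x" for x
          proof -
            have "\<not> (AE x in lebesgue. F x = 0)"
              using fnz F(1) by (metis (mono_tags, lifting) eventually_mono le_zero_eq)
            then have "0 < maxop lebesgue F x" by (intro maxop_pos) auto
            with F(2)[of x] show ?thesis by (auto simp: zero_less_iff_neq_zero)
          qed
          have posH: "0 < H x" for x
          proof -
            have "\<not> (AE x in lebesgue. H x = 0)"
              using knz H(1) by (metis (mono_tags, lifting) eventually_mono le_zero_eq)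
            then have "0 < maxop lebesgue H x" by (intro maxop_pos) auto
            with H(2)[of x] show ?thesis by (auto simp: zero_less_iff_neq_zero)
          qed
          have finF: "AE x in lebesgue. F x < top"
          proof -
            have "(\<integral>\<^sup>+x. epowr (F x) p * ennreal (w x) \<partial>lebesgue) < top"
              using F(3) Y by (auto intro: le_less_trans simp: ennreal_mult_less_top)
            then have "AE x in lebesgue. epowr (F x) p * ennreal (w x) \<noteq> \<infinity>"
              by (intro nn_integral_PInf_AE) auto
            then show ?thesis
              by eventually_elim (auto simp: ennreal_mult_eq_top_iff less_top nz)
          qed
          have finH: "AE x in lebesgue. H x < top"
          proof -
            have "(\<integral>\<^sup>+x. epowr (H x) p' * ennreal (\<sigma> x) \<partial>lebesgue) < top"
              using H(3) Xfin by (auto intro: le_less_trans simp: ennreal_mult_less_top)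
            then have "AE x in lebesgue. epowr (H x) p' * ennreal (\<sigma> x) \<noteq> \<infinity>"
              by (intro nn_integral_PInf_AE) auto
            then show ?thesis
              by eventually_elim (auto simp: ennreal_mult_eq_top_iff less_top nz)
          qed
          \<comment> \<open>Both factors are A_1 with constant \<open>Cm\<close>, so the constant of
            this weight is at most Cm^p0, whatever \<open>f\<close>, \<open>g\<close> and
            \<open>w\<close> are.\<close>
          define u where "u = (\<lambda>x. enn2real (H x) * enn2real (F x) powr (1 - p0))"
          have "maxop lebesgue H x \<le> ennreal Cm * H x" "maxop lebesgue F x \<le> ennreal Cm * F x" for x
            by (rule order_trans[OF H(2)] order_trans[OF F(2)], intro mult_right_mono ennreal_leI; simp add: Cm_def)+
          then have "A1_bound (\<lambda>x. enn2real (H x)) (ennreal Cm)" "A1_bound (\<lambda>x. enn2real (F x)) (ennreal Cm)"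
            by (auto intro!: A1_bound_maxop finF finH)
          moreover have "AE x in lebesgue. 0 < enn2real (H x)" "AE x in lebesgue. 0 < enn2real (F x)"
            using finF finH posF posH by (auto simp: enn2real_positive_iff)
          ultimately have u: "u \<in> Ap p0" "Ap_const p0 u \<le> ennreal (Cm powr p0)"
            unfolding u_def by (auto intro!: Ap_factorization p0)
          have [measurable]: "u \<in> borel_measurable lebesgue" unfolding u_def by measurable
          let ?Z = "\<integral>\<^sup>+x. F x * H x \<partial>lebesgue"
          have "?X \<le> (\<integral>\<^sup>+x. g x * H x \<partial>lebesgue)"
          proof (intro nn_integral_mono)
            fix x
            have "epowr (h x) p = h x * epowr (h x) (p - 1)"
              using epowr_add[of "h x" 1 "p - 1"] by simp
            then have "epowr (h x) p * ennreal (w x) = h x * k x"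
              by (simp add: k_def mult.assoc)
            also have "\<dots> \<le> g x * H x"
              by (intro mult_mono H) (auto simp: h_def indicator_def)
            finally show "epowr (h x) p * ennreal (w x) \<le> g x * H x" .
          qed
          also have "\<dots> \<le> (\<integral>\<^sup>+x. F x * H x + epowr (g x) p0 * ennreal (u x) \<partial>lebesgue)"
            using finF finH
          proof (intro nn_integral_mono_AE, eventually_elim)
            case (elim x)
            then show ?case unfolding u_def
              by (intro dual_majorant_inequality(1)[OF p0 F(1)] posF posH)
          qed
          also have "\<dots> = ?Z + (\<integral>\<^sup>+x. epowr (g x) p0 * ennreal (u x) \<partial>lebesgue)"
            by (rule nn_integral_add) measurable
          also have "\<dots> \<le> ?Z + ennreal C2 * (\<integral>\<^sup>+x. epowr (f x) p0 * ennreal (u x) \<partial>lebesgue)"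
            by (intro add_left_mono C2(2) u fg)
          also have "\<dots> \<le> ?Z + ennreal C2 * ?Z"
          proof (intro add_left_mono mult_left_mono nn_integral_mono_AE, use finF finH in eventually_elim)
            case (elim x)
            then show ?case unfolding u_def
              by (intro dual_majorant_inequality(2)[OF p0 F(1)] posF posH)
          qed auto
          also have "\<dots> = ennreal (1 + C2) * ?Z"
            using C2 by (simp add: distrib_right)
          finally have XZ: "?X \<le> ennreal (1 + C2) * ?Z" .
          have "?Z \<le> (\<integral>\<^sup>+x. ennreal (s powr p) * (epowr (F x) p * ennreal (w x)) + ennreal (s powr (- p')) * (epowr (H x) p' * ennreal (\<sigma> x)) \<partial>lebesgue)"
          proof (intro nn_integral_mono)
            fix x
            \<comment> \<open>The identity w^(1/p) \<sigma>^(1/p') = 1 inserts both weights, and the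
              free factor \<open>s\<close> shifts the cost from \<open>H\<close> to
              \<open>F\<close>.\<close>
            have 1: "(s * w x powr (1 / p)) * (s powr (- 1) * \<sigma> x powr (1 / p')) = 1"
            proof -
              have "w x powr (1 / p) * \<sigma> x powr (1 / p') = \<sigma> x powr (- (p - 1) * (1 / p) + 1 / p')"
                using eq_powr_minusI[OF pos(3)[of x]] by (simp only: powr_powr powr_add)
              also have "- (p - 1) * (1 / p) + 1 / p' = 0" using p by (simp add: p'_def field_simps)
              finally have "w x powr (1 / p) * \<sigma> x powr (1 / p') = 1" using pos(2)[of x] by simp
              moreover have "s * s powr (- 1) = 1" using s by (simp add: powr_minus)
              moreover have "(s * w x powr (1 / p)) * (s powr (- 1) * \<sigma> x powr (1 / p')) =
                  (s * s powr (- 1)) * (w x powr (1 / p) * \<sigma> x powr (1 / p'))"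
                by (simp only: mult_ac)
              ultimately show ?thesis by simp
            qed
            have "F x * H x = F x * H x * ennreal ((s * w x powr (1 / p)) * (s powr (- 1) * \<sigma> x powr (1 / p')))"
              unfolding 1 by simp
            also have "\<dots> = (ennreal (s * w x powr (1 / p)) * F x) * (ennreal (s powr (- 1) * \<sigma> x powr (1 / p')) * H x)"
              using s by (subst ennreal_mult) (auto simp: mult_ac)
            also have "\<dots> \<le> epowr (ennreal (s * w x powr (1 / p)) * F x) p + epowr (ennreal (s powr (- 1) * \<sigma> x powr (1 / p')) * H x) p'"
              unfolding p'_def by (rule epowr_young[OF p])
            also have "epowr (ennreal (s * w x powr (1 / p)) * F x) p = ennreal (s powr p) * (epowr (F x) p * ennreal (w x))"
            proof -
              have "(s * w x powr (1 / p)) powr p = s powr p * w x"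
                using s pos(1)[of x] p by (simp add: powr_mult powr_powr)
              then show ?thesis using s pos(1)[of x] by (subst epowr_mult_ennreal) (auto simp: ennreal_mult mult_ac)
            qed
            also have "epowr (ennreal (s powr (- 1) * \<sigma> x powr (1 / p')) * H x) p' = ennreal (s powr (- p')) * (epowr (H x) p' * ennreal (\<sigma> x))"
            proof -
              have "(s powr (- 1) * \<sigma> x powr (1 / p')) powr p' = s powr (- p') * \<sigma> x"
                using s pos(2)[of x] p' by (simp only: powr_mult powr_powr) simp
              then show ?thesis using s pos(2)[of x] by (subst epowr_mult_ennreal) (auto simp: ennreal_mult mult_ac)
            qed
            finally show "F x * H x \<le> ennreal (s powr p) * (epowr (F x) p * ennreal (w x)) + ennreal (s powr (- p')) * (epowr (H x) p' * ennreal (\<sigma> x))" .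
          qed
          also have "\<dots> = ennreal (s powr p) * (\<integral>\<^sup>+x. epowr (F x) p * ennreal (w x) \<partial>lebesgue) + ennreal (s powr (- p')) * (\<integral>\<^sup>+x. epowr (H x) p' * ennreal (\<sigma> x) \<partial>lebesgue)"
            by (subst nn_integral_add, measurable, subst (1 2) nn_integral_cmult, measurable)
          also have "\<dots> \<le> ennreal (s powr p) * (ennreal Ca * ?Y) + ennreal (s powr (- p')) * (ennreal Cb * ?X)"
            by (intro add_mono mult_left_mono F(3) H(3)) auto
          finally have ZXY: "?Z \<le> ennreal (s powr p) * (ennreal Ca * ?Y) + ennreal (s powr (- p')) * (ennreal Cb * ?X)" .
          obtain X where X: "0 \<le> X" "?X = ennreal X" using Xfin by (cases ?X) auto
          obtain Y' where Y': "0 \<le> Y'" "?Y = ennreal Y'" using Y by (cases ?Y) auto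
          have "ennreal X \<le> ennreal (1 + C2) * (ennreal (s powr p) * (ennreal Ca * ?Y) + ennreal (s powr (- p')) * (ennreal Cb * ?X))"
            unfolding X(2)[symmetric] by (rule order_trans[OF XZ]) (intro mult_left_mono ZXY, simp)
          also have "\<dots> = ennreal ((1 + C2) * (s powr p * (Ca * Y') + s powr (- p') * (Cb * X)))"
            using X Y' C2 Ca Cb by (simp add: ennreal_mult ennreal_plus less_imp_le)
          finally have "X \<le> (1 + C2) * (s powr p * (Ca * Y') + s powr (- p') * (Cb * X))"
            using X Y' C2 Ca Cb by (subst (asm) ennreal_le_iff) (auto intro!: mult_nonneg_nonneg add_nonneg_nonneg)
          also have "\<dots> = C / 2 * Y' + ((1 + C2) * (s powr (- p') * Cb)) * X"
            by (simp add: C_def algebra_simps)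
          finally have "X \<le> C * Y'" unfolding s_p' by simp
          then show ?thesis unfolding X_eq X Y' using C0 Y' by (simp add: ennreal_mult[symmetric])
        qed
      qed
      \<comment> \<open>Monotone convergence removes the truncation in height.\<close>
      have "(\<integral>\<^sup>+x\<in>?B. epowr (g x) p * ennreal (w x) \<partial>lebesgue) =
          (\<integral>\<^sup>+x. (SUP n::nat. epowr (min (g x) (of_nat n)) p * ennreal (w x) * indicator ?B x) \<partial>lebesgue)"
      proof (intro nn_integral_cong)
        fix x
        have "(SUP n::nat. min (g x) (of_nat n)) = g x"
        proof (rule antisym)
          show "g x \<le> (SUP n::nat. min (g x) (of_nat n))"
          proof (cases "g x")
            case (real y)
            obtain n :: nat where "y \<le> real n" using real_arch_simple by blast
            then have "min (g x) (of_nat n) = g x"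
              using real by (auto simp: min_def ennreal_of_nat_eq_real_of_nat)
            then show ?thesis by (metis SUP_upper UNIV_I)
          next
            case top
            then show ?thesis by (simp add: min_absorb2 ennreal_SUP_of_nat_eq_top)
          qed
        qed (auto intro!: SUP_least)
        then have "epowr (g x) p = (SUP n::nat. epowr (min (g x) (of_nat n)) p)"
          using p by (subst epowr_SUP[symmetric]) auto
        then show "epowr (g x) p * ennreal (w x) * indicator ?B x =
            (SUP n::nat. epowr (min (g x) (of_nat n)) p * ennreal (w x) * indicator ?B x)"
          by (simp add: SUP_mult_right_ennreal)
      qed
      also have "\<dots> = (SUP n::nat. \<integral>\<^sup>+x. epowr (min (g x) (of_nat n)) p * ennreal (w x) * indicator ?B x \<partial>lebesgue)"
        using p by (intro nn_integral_monotone_convergence_SUP)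
          (auto simp: incseq_def le_fun_def intro!: mult_right_mono epowr_mono min.mono of_nat_mono)
      also have "\<dots> \<le> ennreal C * ?Y"
        by (intro SUP_least trunc)
      finally show ?thesis .
    qed
  qed
qed

section \<open>Uniformity in the weight constant\<close>

text \<open>The notion of weight supplies integrability on compact sets; \<open>u\<close> is the
  pointwise limit of its restrictions to growing balls.\<close>

lemma weight_measurable:
  fixes u :: "real^'n \<Rightarrow> real"
  assumes "weight u" shows "u \<in> borel_measurable lebesgue"
proof (rule borel_measurable_LIMSEQ_real)
  show "(\<lambda>x. indicator (cball 0 (real n)) x *\<^sub>R u x) \<in> borel_measurable lebesgue" for n
    using assms by (auto simp: weight_def set_integrable_def dest!: spec[of _ "cball 0 (real n)"])
  fix x :: "real^'n"
  show "(\<lambda>n. indicator (cball 0 (real n)) x *\<^sub>R u x) \<longlonglongrightarrow> u x"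
  proof (rule tendsto_eventually)
    obtain N :: nat where "norm x \<le> real N" using real_arch_simple by blast
    then show "\<forall>\<^sub>F n in sequentially. indicator (cball 0 (real n)) x *\<^sub>R u x = u x"
      by (intro eventually_sequentiallyI[of N]) (auto simp: indicator_def)
  qed
qed

lemma weight_wmeas_less_top:
  fixes u :: "real^'n \<Rightarrow> real"
  assumes "weight u" "bounded E" shows "wmeas u E < top"
proof -
  obtain r where r: "E \<subseteq> cball 0 r"
    using assms(2) unfolding bounded_iff by (force simp: subset_iff)
  have "integrable lebesgue (\<lambda>x. indicator (cball 0 r) x *\<^sub>R u x)"
    using assms(1) by (auto simp: weight_def set_integrable_def)
  then have "(\<integral>\<^sup>+x. ennreal (norm (indicator (cball 0 r) x *\<^sub>R u x)) \<partial>lebesgue) < \<infinity>"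
    by (simp add: integrable_iff_bounded)
  moreover have "wmeas u E \<le> (\<integral>\<^sup>+x. ennreal (norm (indicator (cball 0 r) x *\<^sub>R u x)) \<partial>lebesgue)"
    unfolding wmeas_def using r by (intro nn_integral_mono) (auto simp: indicator_def intro!: ennreal_leI)
  ultimately show ?thesis by (auto intro: le_less_trans)
qed

lemma wmeas_pos:
  assumes u: "weight u" and E: "E \<in> sets lebesgue" "emeasure lebesgue E \<noteq> 0"
  shows "0 < wmeas u E"
proof (rule ccontr)
  have [measurable]: "u \<in> borel_measurable lebesgue" by (rule weight_measurable[OF u])
  assume "\<not> 0 < wmeas u E"
  then have "AE y in lebesgue. ennreal (u y) * indicator E y = 0"
    unfolding wmeas_def using E(1) by (subst nn_integral_0_iff_AE[symmetric]) (auto simp: zero_less_iff_neq_zero)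
  moreover have "AE x in lebesgue. 0 < u x" using u by (simp add: weight_def)
  ultimately have "AE y in lebesgue. y \<notin> E"
    by eventually_elim (auto simp: indicator_def split: if_splits)
  then have "emeasure lebesgue E = 0" using E(1) by (subst (asm) AE_iff_null_sets[symmetric]) auto
  with E(2) show False by simp
qed

lemma wmeas_le_scale:
  fixes u w :: "real^'n \<Rightarrow> real"
  assumes [measurable]: "u \<in> borel_measurable lebesgue" "E \<in> sets lebesgue"
    and a: "0 \<le> a" and le: "AE x in lebesgue. x \<in> E \<longrightarrow> w x \<le> a * u x"
  shows "wmeas w E \<le> ennreal a * wmeas u E"
proof -
  have "wmeas w E \<le> (\<integral>\<^sup>+x. ennreal a * (ennreal (u x) * indicator E x) \<partial>lebesgue)"
    unfolding wmeas_def using le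
  proof (intro nn_integral_mono_AE, eventually_elim)
    case (elim x)
    then show ?case using a by (cases "x \<in> E") (auto simp: ennreal_mult'[symmetric] intro!: ennreal_leI)
  qed
  also have "\<dots> = ennreal a * wmeas u E"
    unfolding wmeas_def by (rule nn_integral_cmult) measurable
  finally show ?thesis .
qed

lemma A1_bound_comparable:
  fixes u w :: "real^'n \<Rightarrow> real"
  assumes meas: "u \<in> borel_measurable lebesgue" and a: "0 < a" "0 < b"
    and le: "AE x in lebesgue. w x \<le> a * u x \<and> u x \<le> b * w x" and A1: "A1_bound u c"
  shows "A1_bound w (ennreal (a * b) * c)"
  unfolding A1_bound_def
proof (intro allI impI)
  fix x :: "real^'n" and r :: real assume r: "0 < r"
  have "AE y in lebesgue. y \<in> ball x r \<longrightarrow> wmeas u (ball x r) / emeasure lebesgue (ball x r) \<le> c * ennreal (u y)"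
    using A1 r by (auto simp: A1_bound_def)
  then show "AE y in lebesgue. y \<in> ball x r \<longrightarrow> wmeas w (ball x r) / emeasure lebesgue (ball x r) \<le> ennreal (a * b) * c * ennreal (w y)"
    using le
  proof eventually_elim
    case (elim y)
    show ?case
    proof
      assume y: "y \<in> ball x r"
      have "wmeas w (ball x r) / emeasure lebesgue (ball x r) \<le> ennreal a * wmeas u (ball x r) / emeasure lebesgue (ball x r)"
        using le a by (intro divide_right_mono_ennreal wmeas_le_scale meas) (auto elim!: eventually_mono)
      also have "\<dots> = ennreal a * (wmeas u (ball x r) / emeasure lebesgue (ball x r))"
        by (simp add: ennreal_times_divide)
      also have "\<dots> \<le> ennreal a * (c * ennreal (u y))"
        using elim y by (intro mult_left_mono) auto
      also have "\<dots> \<le> ennreal a * (c * (ennreal b * ennreal (w y)))"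
        using elim a by (intro mult_left_mono) (auto simp: ennreal_mult'[symmetric] intro!: ennreal_leI)
      also have "\<dots> = ennreal (a * b) * c * ennreal (w y)"
        using a by (simp add: ennreal_mult mult_ac)
      finally show "wmeas w (ball x r) / emeasure lebesgue (ball x r) \<le> ennreal (a * b) * c * ennreal (w y)" .
    qed
  qed
qed

text \<open>The weight is bounded above through \<open>a\<close> and its negative power through
  \<open>b\<close>, whence the product. Separate constants pay off when one of them is 1: this keeps
  the logarithm of the constant 1-Lipschitz along the family of weights used later.\<close>

lemma Ap_const_comparable:
  fixes u w :: "real^'n \<Rightarrow> real"
  assumes meas: "u \<in> borel_measurable lebesgue" and a: "0 < a" "0 < b"
    and le: "AE x in lebesgue. w x \<le> a * u x \<and> u x \<le> b * w x"
    and pos: "AE x in lebesgue. 0 < u x" and p: "1 \<le> p"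
  shows "Ap_const p w \<le> ennreal (a * b) * Ap_const p u"
proof (cases "p = 1")
  case True
  have "Inf {c. A1_bound w c} / ennreal (a * b) \<le> c" if "A1_bound u c" for c
  proof -
    have "Inf {c. A1_bound w c} \<le> ennreal (a * b) * c"
      using A1_bound_comparable[OF meas a le that] by (intro Inf_lower) auto
    then have "Inf {c. A1_bound w c} / ennreal (a * b) \<le> c * ennreal (a * b) / ennreal (a * b)"
      by (intro divide_right_mono_ennreal) (simp add: mult.commute)
    also have "\<dots> = c" using a by (intro mult_divide_eq_ennreal) auto
    finally show ?thesis .
  qed
  then have "Inf {c. A1_bound w c} / ennreal (a * b) \<le> Inf {c. A1_bound u c}"
    by (intro Inf_greatest) auto
  then have "ennreal (a * b) * (Inf {c. A1_bound w c} / ennreal (a * b)) \<le> ennreal (a * b) * Inf {c. A1_bound u c}"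
    by (intro mult_left_mono) auto
  also have "ennreal (a * b) * (Inf {c. A1_bound w c} / ennreal (a * b)) = Inf {c. A1_bound w c}"
    using a by (simp add: ennreal_times_divide mult.commute[of "ennreal (a * b)"] mult_divide_eq_ennreal)
  finally show ?thesis using True by (simp add: Ap_const_def)
next
  case False
  then have p1: "1 < p" using p by simp
  define e where "e = 1 - p / (p - 1)"
  have e: "e = - (1 / (p - 1))" using p1 by (simp add: e_def field_simps)
  have main: "wmeas w (ball x r) / emeasure lebesgue (ball x r) *
      epowr (wmeas (\<lambda>y. w y powr e) (ball x r) / emeasure lebesgue (ball x r)) (p - 1) \<le> ennreal (a * b) * Ap_const p u"
    if r: "r \<in> {0<..}" for x r
  proof -
    let ?L = "emeasure lebesgue (ball x r)"
    have 1: "wmeas w (ball x r) \<le> ennreal a * wmeas u (ball x r)"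
      using le a by (intro wmeas_le_scale meas) (auto elim!: eventually_mono)
    have 2: "wmeas (\<lambda>y. w y powr e) (ball x r) \<le> ennreal (b powr (1 / (p - 1))) * wmeas (\<lambda>y. u y powr e) (ball x r)"
    proof (rule wmeas_le_scale)
      show "AE y in lebesgue. y \<in> ball x r \<longrightarrow> w y powr e \<le> b powr (1 / (p - 1)) * u y powr e"
        using le pos
      proof eventually_elim
        case (elim y)
        have "w y powr e \<le> (u y / b) powr e"
          using elim a p1 unfolding e by (intro powr_mono2') (auto simp: field_simps)
        also have "\<dots> = b powr (1 / (p - 1)) * u y powr e"
          using elim a unfolding e by (simp add: powr_divide powr_minus_divide)
        finally show ?case by simp
      qed
    qed (use meas in auto)
    have "wmeas w (ball x r) / ?L * epowr (wmeas (\<lambda>y. w y powr e) (ball x r) / ?L) (p - 1) \<le>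
        ennreal a * wmeas u (ball x r) / ?L * epowr (ennreal (b powr (1 / (p - 1))) * wmeas (\<lambda>y. u y powr e) (ball x r) / ?L) (p - 1)"
      using p1 by (intro mult_mono epowr_mono divide_right_mono_ennreal 1 2) auto
    also have "\<dots> = ennreal a * (wmeas u (ball x r) / ?L) * epowr (ennreal (b powr (1 / (p - 1))) * (wmeas (\<lambda>y. u y powr e) (ball x r) / ?L)) (p - 1)"
      by (simp only: ennreal_times_divide)
    also have "\<dots> = ennreal (a * b) * (wmeas u (ball x r) / ?L * epowr (wmeas (\<lambda>y. u y powr e) (ball x r) / ?L) (p - 1))"
      using a p1 by (subst epowr_mult_ennreal) (auto simp: powr_powr ennreal_mult mult_ac)
    also have "\<dots> \<le> ennreal (a * b) * Ap_const p u"
    proof (intro mult_left_mono)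
      show "wmeas u (ball x r) / ?L * epowr (wmeas (\<lambda>y. u y powr e) (ball x r) / ?L) (p - 1) \<le> Ap_const p u"
        unfolding Ap_const_def if_not_P[OF False] e_def using r by (intro SUP_upper2[of "(x, r)"]) auto
    qed auto
    finally show ?thesis .
  qed
  show ?thesis
    unfolding Ap_const_def[of p w] if_not_P[OF False]
    by (intro SUP_least, erule SigmaE, simp only: prod.case, rule main[unfolded e_def])
qed

lemma Ap_const_less_top: "u \<in> Ap p \<Longrightarrow> Ap_const p u < top"
  unfolding Ap_def Ap_const_def by (auto split: if_splits intro: le_less_trans[OF Inf_lower])

lemma Ap_comparable:
  fixes u w :: "real^'n \<Rightarrow> real"
  assumes u: "u \<in> Ap p" and meas: "w \<in> borel_measurable lebesgue" and a: "0 < a" "0 < b"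
    and le: "AE x in lebesgue. w x \<le> a * u x \<and> u x \<le> b * w x" and p: "1 \<le> p"
  shows "w \<in> Ap p"
proof -
  have wu: "weight u" using u by (simp add: Ap_def)
  note mu = weight_measurable[OF wu]
  have pos: "AE x in lebesgue. 0 < u x" using wu by (simp add: weight_def)
  have posw: "AE x in lebesgue. 0 < w x"
    using pos le by eventually_elim (use a in \<open>auto dest: order.strict_trans2 simp: zero_less_mult_iff\<close>)
  have "weight w"
  proof (rule weightI[OF meas posw])
    fix R :: real
    have "wmeas w (ball 0 R) \<le> ennreal a * wmeas u (ball 0 R)"
      using le a by (intro wmeas_le_scale mu) (auto elim!: eventually_mono)
    also have "\<dots> < top" using weight_wmeas_less_top[OF wu, of "ball 0 R"] by (simp add: ennreal_mult_less_top)
    finally show "wmeas w (ball 0 R) < top" .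
  qed
  moreover have "\<exists>c<top. A1_bound w c" if p1: "p = 1"
  proof -
    obtain c where c: "c < top" "A1_bound u c" using u p1 by (simp add: Ap_def) blast
    from A1_bound_comparable[OF mu a le c(2)] c(1) show ?thesis
      by (intro exI[of _ "ennreal (a * b) * c"]) (auto simp: ennreal_mult_less_top)
  qed
  moreover have "Ap_const p w < top"
    using Ap_const_comparable[OF mu a le pos p] Ap_const_less_top[OF u]
    by (auto intro: le_less_trans simp: ennreal_mult_less_top)
  ultimately show ?thesis by (simp add: Ap_def)
qed

text \<open>On \<open>E\<close> the two weights have the same dual weight, whose mass is bounded
  below by the dual inequality, while the mass of \<open>w\<close> on the ball is at least
  \<open>t\<close> times that of \<open>u\<close> on \<open>E\<close>. For \<open>p = 1\<close> the
  A_1 bound is integrated over \<open>E\<close> instead.\<close>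

lemma Ap_const_ge:
  fixes u w :: "real^'n \<Rightarrow> real"
  assumes u: "weight u" and w: "w \<in> borel_measurable lebesgue" and r: "0 < r"
    and E: "E \<in> sets lebesgue" "E \<subseteq> ball c r" "emeasure lebesgue E \<noteq> 0"
    and wE: "\<And>x. x \<in> E \<Longrightarrow> w x = u x" and W: "ennreal t * wmeas u E \<le> wmeas w (ball c r)" and p: "1 \<le> p"
  shows "ennreal t * ennreal (2 powr (- p)) * epowr (emeasure lebesgue E / emeasure lebesgue (ball c r)) p \<le> Ap_const p w"
proof -
  let ?L = "emeasure lebesgue (ball c r)"
  have mu [measurable]: "u \<in> borel_measurable lebesgue" by (rule weight_measurable[OF u])
  have pos: "AE x in lebesgue. 0 < u x" using u by (simp add: weight_def)
  have L: "0 < ?L" "?L < top" using r emeasure_lborel_ball_pos[of r c] emeasure_lborel_ball_less_top[of c r] by auto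
  note E(1) [measurable]
  have bE: "bounded E" using E(2) bounded_ball bounded_subset by blast
  have Efin: "emeasure lebesgue E < top" using E L emeasure_mono[of E "ball c r" lebesgue] by (auto intro: le_less_trans)
  have UE: "0 < wmeas u E" "wmeas u E < top"
    using wmeas_pos[OF u E(1,3)] weight_wmeas_less_top[OF u bE] by auto
  show ?thesis
  proof (cases "p = 1")
    case True
    have "ennreal t * ennreal (2 powr (- p)) * (emeasure lebesgue E / ?L) \<le> c'" if "A1_bound w c'" for c'
    proof -
      have "AE y in lebesgue. y \<in> ball c r \<longrightarrow> wmeas w (ball c r) / ?L \<le> c' * ennreal (w y)"
        using that r by (auto simp: A1_bound_def)
      then have ae: "AE y in lebesgue. ennreal t * wmeas u E / ?L * indicator E y \<le> c' * (ennreal (u y) * indicator E y)"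
      proof eventually_elim
        case (elim y)
        show ?case
        proof (cases "y \<in> E")
          case True
          have "ennreal t * wmeas u E / ?L \<le> wmeas w (ball c r) / ?L"
            by (intro divide_right_mono_ennreal W)
          also have "\<dots> \<le> c' * ennreal (u y)" using True elim E(2) wE[OF True] by auto
          finally show ?thesis using True by simp
        qed auto
      qed
      have "ennreal t * wmeas u E / ?L * emeasure lebesgue E = (\<integral>\<^sup>+y. ennreal t * wmeas u E / ?L * indicator E y \<partial>lebesgue)"
        using E by (simp add: nn_integral_cmult_indicator)
      also have "\<dots> \<le> (\<integral>\<^sup>+y. c' * (ennreal (u y) * indicator E y) \<partial>lebesgue)"
        by (rule nn_integral_mono_AE[OF ae])
      also have "\<dots> = c' * wmeas u E"
        unfolding wmeas_def by (intro nn_integral_cmult) measurable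
      finally have "wmeas u E * (ennreal t * (emeasure lebesgue E / ?L)) \<le> wmeas u E * c'"
        by (simp add: divide_ennreal_def mult_ac)
      then have "ennreal t * (emeasure lebesgue E / ?L) \<le> c'"
        using UE by (subst (asm) ennreal_mult_le_mult_iff) auto
      moreover have "ennreal t * ennreal (2 powr (- p)) * (emeasure lebesgue E / ?L) \<le> ennreal t * 1 * (emeasure lebesgue E / ?L)"
      proof (intro mult_right_mono mult_left_mono)
        show "ennreal (2 powr (- p)) \<le> 1"
          using p powr_mono[of "- p" 0 2] by (simp add: ennreal_le_1[symmetric] del: ennreal_le_1)
      qed auto
      ultimately show ?thesis by simp
    qed
    then show ?thesis using True by (auto simp: Ap_const_def intro!: Inf_greatest)
  next
    case False
    then have p1: "1 < p" using p by simp
    define e where "e = 1 - p / (p - 1)"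
    have e: "e * (p - 1) = - 1" using p1 by (simp add: e_def field_simps)
    have "epowr (emeasure lebesgue E) p \<le> ennreal (2 powr p) * (wmeas u E * epowr (wmeas (\<lambda>y. u y powr e) E) (p - 1))"
      unfolding wmeas_def
    proof (rule epowr_emeasure_le_dual)
      show "AE x in lebesgue. x \<in> E \<longrightarrow> 0 < u x \<and> 0 < u x powr e \<and> 1 \<le> u x * (u x powr e) powr (p - 1)"
        using pos
      proof eventually_elim
        case (elim x)
        then show ?case unfolding powr_powr e by (simp add: powr_minus)
      qed
    qed (use E p1 Efin in auto)
    then have "ennreal (2 powr (- p)) * epowr (emeasure lebesgue E) p \<le>
        ennreal (2 powr (- p)) * (ennreal (2 powr p) * (wmeas u E * epowr (wmeas (\<lambda>y. u y powr e) E) (p - 1)))"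
      by (intro mult_left_mono) auto
    also have "\<dots> = wmeas u E * epowr (wmeas (\<lambda>y. u y powr e) E) (p - 1)"
    proof -
      have "ennreal (2 powr (- p)) * ennreal (2 powr p) = 1"
        by (simp add: ennreal_mult'[symmetric] powr_minus)
      then show ?thesis by (simp only: mult.assoc[symmetric]) simp
    qed
    finally have low: "ennreal (2 powr (- p)) * epowr (emeasure lebesgue E) p \<le> wmeas u E * epowr (wmeas (\<lambda>y. u y powr e) E) (p - 1)" .
    have S: "wmeas (\<lambda>y. u y powr e) E \<le> wmeas (\<lambda>y. w y powr e) (ball c r)"
      unfolding wmeas_def using E(2) wE by (intro nn_integral_mono) (auto simp: indicator_def)
    have EL: "epowr (emeasure lebesgue E / ?L) p = epowr (emeasure lebesgue E) p * (inverse ?L * epowr (inverse ?L) (p - 1))"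
      using epowr_add[of "inverse ?L" 1 "p - 1"] by (simp add: divide_ennreal_def epowr_mult)
    have "ennreal t * ennreal (2 powr (- p)) * epowr (emeasure lebesgue E / ?L) p =
        ennreal t * (ennreal (2 powr (- p)) * epowr (emeasure lebesgue E) p) * (inverse ?L * epowr (inverse ?L) (p - 1))"
      unfolding EL by (simp only: mult.assoc)
    also have "\<dots> \<le> ennreal t * (wmeas u E * epowr (wmeas (\<lambda>y. u y powr e) E) (p - 1)) * (inverse ?L * epowr (inverse ?L) (p - 1))"
      by (intro mult_left_mono mult_right_mono low) auto
    also have "\<dots> = (ennreal t * wmeas u E * inverse ?L) * epowr (wmeas (\<lambda>y. u y powr e) E * inverse ?L) (p - 1)"
      by (simp only: epowr_mult mult_ac)
    also have "\<dots> \<le> (wmeas w (ball c r) * inverse ?L) * epowr (wmeas (\<lambda>y. w y powr e) (ball c r) * inverse ?L) (p - 1)"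
      using p1 by (intro mult_mono epowr_mono W S) auto
    also have "\<dots> \<le> Ap_const p w"
      unfolding Ap_const_def if_not_P[OF False] e_def divide_ennreal_def[symmetric]
      using r by (intro SUP_upper2[of "(c, r)"]) auto
    finally show ?thesis .
  qed
qed

text \<open>The weight is multiplied by \<open>e\<^sup>t\<close> on the heavier of two disjoint balls of equal radius. This makes
  the constant at least proportional to \<open>e\<^sup>t\<close>, and the logarithm of the constant is a Lipschitz function
  of \<open>t\<close>, so that the intermediate value theorem applies.\<close>

theorem exists_comparable_Ap_const_eq:
  assumes p: "1 \<le> p"
  shows "\<exists>T\<ge>0. \<forall>u::real^'n \<Rightarrow> real. u \<in> Ap p \<longrightarrow> Ap_const p u \<le> ennreal K \<longrightarrow>
    (\<exists>w\<in>Ap p. Ap_const p w = ennreal (max K 1) \<and> (\<forall>x. 0 < u x \<longrightarrow> u x \<le> w x \<and> w x \<le> exp T * u x))"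
proof -
  obtain z :: "real^'n" where z: "norm z = 1 / 2"
    using vector_choose_size[of "1/2"] by auto
  define E where "E i = (if i then ball z (1/2) else ball (- z) (1/2))" for i
  have Esub: "E i \<subseteq> ball 0 1" for i
  proof
    fix x assume "x \<in> E i"
    then have "norm (x - z) < 1/2 \<or> norm (x + z) < 1/2"
      by (cases i) (simp_all add: E_def dist_norm norm_minus_commute[of z x] norm_minus_commute[of "- z" x])
    then have "norm x < 1"
      using norm_triangle_ineq[of "x - z" z] norm_triangle_ineq4[of "x + z" z] z by auto
    then show "x \<in> ball 0 1" by simp
  qed
  have disj: "x \<notin> E (\<not> i)" if "x \<in> E i" for x i
  proof
    assume "x \<in> E (\<not> i)"
    then have "x \<in> ball z (1/2)" "x \<in> ball (- z) (1/2)" using that by (auto simp: E_def split: if_splits)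
    then have "dist z (- z) < 1" using dist_triangle_less_add[of z x "1/2" "- z" "1/2"] by (simp add: dist_commute)
    moreover have "dist z (- z) = norm (2 *\<^sub>R z)" by (simp add: dist_norm scaleR_2)
    ultimately show False using z by simp
  qed
  have Emeas [measurable]: "E i \<in> sets lebesgue" for i by (auto simp: E_def)
  have Eem: "emeasure lebesgue (E i) = emeasure lebesgue (ball (0::real^'n) (1/2))" for i
    by (simp add: E_def emeasure_lborel_ball)
  have E0: "emeasure lebesgue (E i) \<noteq> 0" for i
    unfolding Eem using emeasure_lborel_ball_pos[of "1/2" "0::real^'n"] by auto
  have Ebdd: "bounded (E i)" for i by (simp add: E_def)
  obtain \<kappa> where \<kappa>: "0 < \<kappa>" "ennreal \<kappa> = ennreal (2 powr (- p)) * epowr (emeasure lebesgue (ball (0::real^'n) (1/2)) / emeasure lebesgue (ball (0::real^'n) 1)) p"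
  proof -
    let ?q = "emeasure lebesgue (ball (0::real^'n) (1/2)) / emeasure lebesgue (ball (0::real^'n) 1)"
    have "0 < ?q" "?q < top"
      using emeasure_lborel_ball_pos[of "1/2" "0::real^'n"] emeasure_lborel_ball_less_top[of "0::real^'n"]
        emeasure_lborel_ball_pos[of 1 "0::real^'n"]
      by (auto simp: ennreal_zero_less_divide less_top[symmetric] ennreal_divide_eq_top_iff less_imp_neq[symmetric])
    then obtain q where "0 < q" "?q = ennreal q" by (cases ?q) auto
    then have "0 < 2 powr (- p) * q powr p" "ennreal (2 powr (- p) * q powr p) = ennreal (2 powr (- p)) * epowr ?q p"
      by (auto simp: epowr_ennreal ennreal_mult)
    then show ?thesis by (rule that)
  qed
  \<comment> \<open>The target value has to be positive for its logarithm, hence the maximum with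
    1.\<close>
  define K1 where "K1 = max K 1"
  \<comment> \<open>Large enough for the lower bound \<open>exp T * \<kappa>\<close> of the constant
    to reach \<open>K1\<close>.\<close>
  define T where "T = max 0 (ln (K1 / \<kappa>))"
  have K1: "1 \<le> K1" "K \<le> K1" by (auto simp: K1_def)
  have T: "0 \<le> T" "K1 \<le> exp T * \<kappa>"
  proof -
    have "K1 / \<kappa> = exp (ln (K1 / \<kappa>))" using K1 \<kappa> by simp
    also have "\<dots> \<le> exp T" by (simp add: T_def)
    finally show "K1 \<le> exp T * \<kappa>" using \<kappa> by (simp add: field_simps)
  qed (simp add: T_def)
  show ?thesis
  proof (intro exI[of _ T] conjI T(1) allI impI)
    fix u :: "real^'n \<Rightarrow> real" assume u: "u \<in> Ap p" and uK: "Ap_const p u \<le> ennreal K"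
    have wu: "weight u" using u by (simp add: Ap_def)
    note mu [measurable] = weight_measurable[OF wu]
    have pos: "AE x in lebesgue. 0 < u x" using wu by (simp add: weight_def)
    \<comment> \<open>Enlarging the heavier ball guarantees that the unit ball gets at least
      \<open>exp T\<close> times the mass of the lighter ball, on which the weight is
      unchanged.\<close>
    obtain i where i: "wmeas u (E (\<not> i)) \<le> wmeas u (E i)"
      using linear[of "wmeas u (E True)" "wmeas u (E False)"] that[of True] that[of False] by auto
    define w where "w t x = (if x \<in> E i then exp t * u x else u x)" for t x
    have mw [measurable]: "w t \<in> borel_measurable lebesgue" for t
      unfolding w_def by measurable
    have comp: "w s x \<le> exp \<bar>s - t\<bar> * w t x" if "0 < u x" for s t x
    proof -
      have "exp s \<le> exp \<bar>s - t\<bar> * exp t" by (simp add: exp_add[symmetric])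
      then have "exp s * u x \<le> exp \<bar>s - t\<bar> * exp t * u x" using that by (intro mult_right_mono) auto
      then show ?thesis using that by (auto simp: w_def mult.assoc)
    qed
    have comp_mono: "w s x \<le> w t x" if "0 < u x" "s \<le> t" for s t x
      using that by (auto simp: w_def)
    have w0: "w 0 = u" by (auto simp: w_def)
    have wAp: "w t \<in> Ap p" for t
    proof (rule Ap_comparable[OF u mw _ _ _ p])
      show "AE x in lebesgue. w t x \<le> exp \<bar>t\<bar> * u x \<and> u x \<le> exp \<bar>t\<bar> * w t x"
        using pos by eventually_elim (use comp[of _ t 0] comp[of _ 0 t] w0 in auto)
    qed auto
    \<comment> \<open>The family increases with \<open>t\<close> where \<open>u\<close> is positive,
      so one of the two comparison constants is 1.\<close>
    have cle: "Ap_const p (w s) \<le> ennreal (exp \<bar>s - t\<bar>) * Ap_const p (w t)" for s t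
    proof -
      have post: "AE x in lebesgue. 0 < w t x" for t using wAp[of t] by (simp add: Ap_def weight_def)
      show ?thesis
      proof (cases "s \<le> t")
        case True
        have "AE x in lebesgue. w s x \<le> 1 * w t x \<and> w t x \<le> exp \<bar>s - t\<bar> * w s x"
          using pos
        proof eventually_elim
          case (elim x)
          show ?case using comp_mono[OF elim True] comp[OF elim, of t s] by (simp add: abs_minus_commute)
        qed
        from Ap_const_comparable[OF mw _ _ this post p] show ?thesis by simp
      next
        case False
        have "AE x in lebesgue. w s x \<le> exp \<bar>s - t\<bar> * w t x \<and> w t x \<le> 1 * w s x"
          using pos
        proof eventually_elim
          case (elim x)
          show ?case using comp_mono[OF elim, of t s] False comp[OF elim, of s t] by simp
        qed
        from Ap_const_comparable[OF mw _ _ this post p] show ?thesis by simp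
      qed
    qed
    define \<phi> where "\<phi> t = enn2real (Ap_const p (w t))" for t
    have \<phi>: "Ap_const p (w t) = ennreal (\<phi> t)" for t
      using Ap_const_less_top[OF wAp, of t] by (simp add: \<phi>_def)
    have \<phi>le: "\<phi> s \<le> exp \<bar>s - t\<bar> * \<phi> t" for s t
      using cle[of s t] unfolding \<phi> by (simp add: ennreal_mult'[symmetric] \<phi>_def)
    have \<phi>T: "K1 \<le> \<phi> T"
    proof -
      have "ennreal (exp T) * ennreal (2 powr (- p)) * epowr (emeasure lebesgue (E (\<not> i)) / emeasure lebesgue (ball (0::real^'n) 1)) p \<le> Ap_const p (w T)"
      proof (rule Ap_const_ge[OF wu mw])
        show "w T x = u x" if "x \<in> E (\<not> i)" for x
          using disj[OF that] by (simp add: w_def)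
        have "ennreal (exp T) * wmeas u (E (\<not> i)) \<le> ennreal (exp T) * wmeas u (E i)"
          by (intro mult_left_mono i) auto
        also have "\<dots> = (\<integral>\<^sup>+x. ennreal (exp T) * (ennreal (u x) * indicator (E i) x) \<partial>lebesgue)"
          unfolding wmeas_def by (rule nn_integral_cmult[symmetric]) measurable
        also have "\<dots> \<le> wmeas (w T) (ball 0 1)"
          unfolding wmeas_def using Esub[of i]
          by (intro nn_integral_mono) (auto simp: w_def indicator_def ennreal_mult')
        finally show "ennreal (exp T) * wmeas u (E (\<not> i)) \<le> wmeas (w T) (ball 0 1)" .
      qed (use Esub E0 p in auto)
      also have "ennreal (exp T) * ennreal (2 powr (- p)) * epowr (emeasure lebesgue (E (\<not> i)) / emeasure lebesgue (ball (0::real^'n) 1)) p = ennreal (exp T * \<kappa>)"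
        unfolding Eem mult.assoc \<kappa>(2)[symmetric] using \<kappa>(1) by (simp add: ennreal_mult)
      finally have "exp T * \<kappa> \<le> \<phi> T" unfolding \<phi> by (simp add: \<phi>_def)
      then show ?thesis using T by simp
    qed
    have \<phi>pos: "0 < \<phi> t" for t
    proof -
      have "0 < exp \<bar>T - t\<bar> * \<phi> t" using \<phi>le[of T t] \<phi>T K1 by linarith
      then show ?thesis by (simp add: zero_less_mult_iff)
    qed
    have lip: "ln (\<phi> s) \<le> \<bar>s - t\<bar> + ln (\<phi> t)" for s t
    proof -
      have "ln (\<phi> s) \<le> ln (exp \<bar>s - t\<bar> * \<phi> t)" using \<phi>pos \<phi>le by (subst ln_le_cancel_iff) auto
      also have "\<dots> = \<bar>s - t\<bar> + ln (\<phi> t)" using \<phi>pos[of t] by (simp add: ln_mult)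
      finally show ?thesis .
    qed
    have "1-lipschitz_on {0..T} (\<lambda>t. ln (\<phi> t))"
    proof (rule lipschitz_onI)
      fix s t show "dist (ln (\<phi> s)) (ln (\<phi> t)) \<le> 1 * dist s t"
        using lip[of s t] lip[of t s] by (simp add: dist_real_def abs_minus_commute)
    qed simp
    then have cont: "continuous_on {0..T} (\<lambda>t. ln (\<phi> t))" by (rule lipschitz_on_continuous_on)
    have "\<phi> 0 \<le> K1"
    proof -
      have "ennreal (\<phi> 0) \<le> ennreal K1" using uK K1 unfolding \<phi>[symmetric] w0 by (auto intro: order_trans ennreal_leI)
      then show ?thesis using K1 by simp
    qed
    then have "ln (\<phi> 0) \<le> ln K1" "ln K1 \<le> ln (\<phi> T)"
      using \<phi>pos[of 0] \<phi>pos[of T] K1 \<phi>T by auto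
    then obtain t where t: "0 \<le> t" "t \<le> T" "ln (\<phi> t) = ln K1"
      using IVT'[OF _ _ T(1) cont] by auto
    then have "\<phi> t = K1" using \<phi>pos[of t] K1 by simp
    show "\<exists>w\<in>Ap p. Ap_const p w = ennreal (max K 1) \<and> (\<forall>x. 0 < u x \<longrightarrow> u x \<le> w x \<and> w x \<le> exp T * u x)"
    proof (intro bexI[of _ "w t"] conjI allI impI wAp)
      show "Ap_const p (w t) = ennreal (max K 1)" unfolding \<phi> \<open>\<phi> t = K1\<close> K1_def ..
      fix x assume x: "0 < u x"
      show "u x \<le> w t x" using comp_mono[OF x t(1)] by (simp add: w0)
      have "w t x \<le> exp t * u x" using comp[OF x, of t 0] t w0 by simp
      also have "\<dots> \<le> exp T * u x" using t x by (intro mult_right_mono) auto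
      finally show "w t x \<le> exp T * u x" .
    qed
  qed
qed

text \<open>The arbitrary function \<open>\<Phi>\<close> may be unbounded on bounded sets. Therefore a weight with constant at
  most \<open>K\<close> is compared with one whose constant is exactly \<open>max K 1\<close>.\<close>

theorem uniform_Ap_boundI:
  fixes \<F> :: "((real^'n \<Rightarrow> ennreal) \<times> (real^'n \<Rightarrow> ennreal)) set"
  assumes p: "1 \<le> p" and meas: "\<forall>(f, g) \<in> \<F>. f \<in> borel_measurable lebesgue \<and> g \<in> borel_measurable lebesgue"
    and hyp: "\<forall>u \<in> Ap p. \<forall>(f, g) \<in> \<F>. wLp_norm p u g \<le> ennreal (\<Phi> (Ap_const p u)) * wLp_norm p u f"
  shows "uniform_Ap_bound p \<F>"
  unfolding uniform_Ap_bound_def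
proof
  fix K :: real
  obtain T where T: "0 \<le> T" and ex: "\<forall>u::real^'n \<Rightarrow> real. u \<in> Ap p \<longrightarrow> Ap_const p u \<le> ennreal K \<longrightarrow>
    (\<exists>w\<in>Ap p. Ap_const p w = ennreal (max K 1) \<and> (\<forall>x. 0 < u x \<longrightarrow> u x \<le> w x \<and> w x \<le> exp T * u x))"
    using exists_comparable_Ap_const_eq[OF p, of K] by (elim exE conjE) (rule that)
  \<comment> \<open>At least 1, hence positive even if \<open>\<Phi>\<close> takes a negative value
    there.\<close>
  define B where "B = max 1 (\<Phi> (ennreal (max K 1)))"
  show "\<exists>C>0. \<forall>u\<in>Ap p. Ap_const p u \<le> ennreal K \<longrightarrow>
     (\<forall>(f, g)\<in>\<F>. (\<integral>\<^sup>+x. epowr (g x) p * ennreal (u x) \<partial>lebesgue)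
       \<le> ennreal C * (\<integral>\<^sup>+x. epowr (f x) p * ennreal (u x) \<partial>lebesgue))"
  proof (intro exI[of _ "B powr p * exp T"] conjI ballI impI, goal_cases)
    case 1
    have "0 < B" by (simp add: B_def)
    then show ?case by simp
  next
    case (2 u fg)
    obtain f g where fg: "fg = (f, g)" "(f, g) \<in> \<F>" using 2(3) by (cases fg) auto
    have [measurable]: "f \<in> borel_measurable lebesgue" using meas fg by auto
    have wu: "weight u" using 2 by (simp add: Ap_def)
    note [measurable] = weight_measurable[OF wu]
    have pos: "AE x in lebesgue. 0 < u x" using wu by (simp add: weight_def)
    obtain w where w: "w \<in> Ap p" "Ap_const p w = ennreal (max K 1)"
      "\<And>x. 0 < u x \<Longrightarrow> u x \<le> w x \<and> w x \<le> exp T * u x"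
      using ex[rule_format, OF 2(1,2)] by blast
    let ?I = "\<lambda>h v. \<integral>\<^sup>+x. epowr (h x) p * ennreal (v x) \<partial>lebesgue"
    have "epowr (?I g w) (1 / p) \<le> ennreal B * epowr (?I f w) (1 / p)"
    proof -
      have "wLp_norm p w g \<le> ennreal (\<Phi> (ennreal (max K 1))) * wLp_norm p w f"
        using hyp[rule_format, OF w(1) fg(2)] w(2) by simp
      also have "\<dots> \<le> ennreal B * wLp_norm p w f"
        by (intro mult_right_mono ennreal_leI) (auto simp: B_def)
      finally show ?thesis by (simp add: wLp_norm_def)
    qed
    then have "epowr (epowr (?I g w) (1 / p)) p \<le> epowr (ennreal B * epowr (?I f w) (1 / p)) p"
      using p by (intro epowr_mono) auto
    then have gw: "?I g w \<le> ennreal (B powr p) * ?I f w"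
      using p by (simp add: epowr_epowr epowr_mult_ennreal B_def)
    have "?I g u \<le> ?I g w"
      using pos by (intro nn_integral_mono_AE, elim eventually_mono) (auto intro!: mult_left_mono ennreal_leI w(3)[THEN conjunct1])
    also note gw
    also have "?I f w \<le> (\<integral>\<^sup>+x. ennreal (exp T) * (epowr (f x) p * ennreal (u x)) \<partial>lebesgue)"
    proof (intro nn_integral_mono_AE, use pos in eventually_elim)
      case (elim x)
      have "epowr (f x) p * ennreal (w x) \<le> epowr (f x) p * ennreal (exp T * u x)"
        using w(3)[OF elim] by (intro mult_left_mono ennreal_leI) auto
      then show ?case by (simp add: ennreal_mult' mult_ac)
    qed
    also have "\<dots> = ennreal (exp T) * ?I f u"
      by (rule nn_integral_cmult) measurable
    finally have "?I g u \<le> ennreal (B powr p * exp T) * ?I f u"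
      by (simp add: ennreal_mult mult_left_mono mult.assoc)
    then show ?case by (simp add: fg)
  qed
qed

section \<open>Integrals of powers\<close>

text \<open>For \<eta> < 0 the power |x-a|^\<eta> is the integral of -\<eta> t^(\<eta>-1) over t >
  |x-a|. By Tonelli's theorem an integral against the power is then controlled by the growth of ball
  integrals.\<close>

lemma nn_integral_norm_powr_le:
  fixes G :: "'a::euclidean_space \<Rightarrow> ennreal"
  assumes [measurable]: "G \<in> borel_measurable lebesgue" and \<eta>: "\<eta> < 0"
  shows "(\<integral>\<^sup>+x. ennreal (norm (x - a) powr \<eta>) * G x \<partial>lebesgue) \<le>
    (\<integral>\<^sup>+t. ennreal (- \<eta> * t powr (\<eta> - 1)) * indicator {0<..} t * (\<integral>\<^sup>+x\<in>ball a t. G x \<partial>lebesgue) \<partial>lborel)"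
proof -
  define h where "h x = norm (x - a)" for x
  have [measurable]: "h \<in> borel_measurable lebesgue"
    unfolding h_def by (intro measurable_completion) measurable
  interpret L: sigma_finite_measure "lebesgue :: 'a measure" by (rule sigma_finite_lebesgue)
  interpret pair_sigma_finite lborel "lebesgue :: 'a measure" ..
  have [measurable]: "Measurable.pred (lborel \<Otimes>\<^sub>M (lebesgue :: 'a measure)) (\<lambda>x. h (snd x) < fst x)"
    by measurable
  let ?k = "\<lambda>t x. ennreal (- \<eta> * t powr (\<eta> - 1)) * indicator {0<..} t * (G x * (if h x < t then 1 else 0))"
  have "(\<integral>\<^sup>+x. ennreal (h x powr \<eta>) * G x \<partial>lebesgue) \<le> (\<integral>\<^sup>+x. (\<integral>\<^sup>+t. ?k t x \<partial>lborel) \<partial>lebesgue)"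
  proof (intro nn_integral_mono)
    fix x
    show "ennreal (h x powr \<eta>) * G x \<le> (\<integral>\<^sup>+t. ?k t x \<partial>lborel)"
    \<comment> \<open>At \<open>x = a\<close> the convention \<open>0 powr \<eta> = 0\<close> makes
      the left side 0 while the right side may be infinite, hence an inequality.\<close>
    proof (cases "x = a")
      case False
      then have n: "0 < h x" by (simp add: h_def)
      have "ennreal (h x powr \<eta>) * G x = ennreal (- \<eta>) * G x * ennreal (h x powr \<eta> / - \<eta>)"
        using \<eta> by (simp add: ennreal_mult'[symmetric] mult_ac)
      also have "\<dots> = ennreal (- \<eta>) * G x * (\<integral>\<^sup>+t. ennreal (t powr (\<eta> - 1)) * indicator {h x<..} t \<partial>lborel)"
        using nn_integral_powr_c_inf[of "\<eta> - 1", OF _ n] \<eta> by simp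
      also have "\<dots> = (\<integral>\<^sup>+t. ennreal (- \<eta>) * G x * (ennreal (t powr (\<eta> - 1)) * indicator {h x<..} t) \<partial>lborel)"
        by (rule nn_integral_cmult[symmetric]) measurable
      also have "\<dots> \<le> (\<integral>\<^sup>+t. ?k t x \<partial>lborel)"
      proof (intro nn_integral_mono)
        fix t :: real
        show "ennreal (- \<eta>) * G x * (ennreal (t powr (\<eta> - 1)) * indicator {h x<..} t) \<le> ?k t x"
        proof (cases "h x < t")
          case True
          then have "0 < t" using n by linarith
          moreover have "ennreal (- \<eta> * t powr (\<eta> - 1)) = ennreal (- \<eta>) * ennreal (t powr (\<eta> - 1))"
            using \<eta> by (intro ennreal_mult) auto
          ultimately show ?thesis using True by (simp only:) (simp add: mult_ac)
        qed simp
      qed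
      finally show ?thesis .
    qed (simp add: h_def)
  qed
  also have "\<dots> = (\<integral>\<^sup>+t. (\<integral>\<^sup>+x. ?k t x \<partial>lebesgue) \<partial>lborel)"
    by (rule Fubini') measurable
  also have "\<dots> = (\<integral>\<^sup>+t. ennreal (- \<eta> * t powr (\<eta> - 1)) * indicator {0<..} t * (\<integral>\<^sup>+x\<in>ball a t. G x \<partial>lebesgue) \<partial>lborel)"
  proof (intro nn_integral_cong)
    fix t :: real
    have "(\<integral>\<^sup>+x. ?k t x \<partial>lebesgue) = ennreal (- \<eta> * t powr (\<eta> - 1)) * indicator {0<..} t * (\<integral>\<^sup>+x. G x * (if h x < t then 1 else 0) \<partial>lebesgue)"
      by (rule nn_integral_cmult) measurable
    also have "\<dots> = ennreal (- \<eta> * t powr (\<eta> - 1)) * indicator {0<..} t * (\<integral>\<^sup>+x\<in>ball a t. G x \<partial>lebesgue)"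
      by (intro arg_cong2[where f = "(*)"] nn_integral_cong refl)
        (auto simp: h_def indicator_def dist_norm norm_minus_commute)
    finally show "(\<integral>\<^sup>+x. ?k t x \<partial>lebesgue) = ennreal (- \<eta> * t powr (\<eta> - 1)) * indicator {0<..} t * (\<integral>\<^sup>+x\<in>ball a t. G x \<partial>lebesgue)" .
  qed
  finally show ?thesis unfolding h_def .
qed

text \<open>For \<eta> \<ge> 0 the power is at most T^\<eta>. For \<eta> < 0 the layer cake integral
  splits at t = T: below it the growth bound applies, with convergence at 0 because \<eta> +
  \<kappa> > 0, and above it the ball integral stays at its value for T.\<close>

lemma nn_integral_norm_powr_ball:
  assumes "0 < \<eta> + \<kappa>"
  shows "\<exists>C\<ge>0. \<forall>(G :: 'a::euclidean_space \<Rightarrow> ennreal) a T M. G \<in> borel_measurable lebesgue \<longrightarrow> 0 < T \<longrightarrow>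
    (\<forall>t>0. t \<le> T \<longrightarrow> (\<integral>\<^sup>+x\<in>ball a t. G x \<partial>lebesgue) \<le> M * ennreal (t powr \<kappa>)) \<longrightarrow>
    (\<integral>\<^sup>+x\<in>ball a T. ennreal (norm (x - a) powr \<eta>) * G x \<partial>lebesgue) \<le> ennreal C * M * ennreal (T powr (\<eta> + \<kappa>))"
proof (intro exI[of _ "max 1 (- \<eta> / (\<eta> + \<kappa>) + 1)"] conjI allI impI)
  fix G :: "'a \<Rightarrow> ennreal" and a T M
  assume meas: "G \<in> borel_measurable lebesgue" and T: "0 < T"
    and G: "\<forall>t>0. t \<le> T \<longrightarrow> (\<integral>\<^sup>+x\<in>ball a t. G x \<partial>lebesgue) \<le> M * ennreal (t powr \<kappa>)"
  note [measurable] = meas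
  \<comment> \<open>The quotient comes from t < T and the summand 1 from t > T; the maximum with 1
    covers \<eta> \<ge> 0.\<close>
  let ?C = "max 1 (- \<eta> / (\<eta> + \<kappa>) + 1)"
  show "(\<integral>\<^sup>+x\<in>ball a T. ennreal (norm (x - a) powr \<eta>) * G x \<partial>lebesgue) \<le> ennreal ?C * M * ennreal (T powr (\<eta> + \<kappa>))"
  proof (cases "0 \<le> \<eta>")
    case True
    have "(\<integral>\<^sup>+x\<in>ball a T. ennreal (norm (x - a) powr \<eta>) * G x \<partial>lebesgue) \<le> (\<integral>\<^sup>+x. ennreal (T powr \<eta>) * (G x * indicator (ball a T) x) \<partial>lebesgue)"
    proof (intro nn_integral_mono)
      fix x
      show "ennreal (norm (x - a) powr \<eta>) * G x * indicator (ball a T) x \<le> ennreal (T powr \<eta>) * (G x * indicator (ball a T) x)"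
        using True by (cases "x \<in> ball a T")
          (auto simp: dist_norm norm_minus_commute intro!: mult_right_mono ennreal_leI powr_mono2)
    qed
    also have "\<dots> = ennreal (T powr \<eta>) * (\<integral>\<^sup>+x\<in>ball a T. G x \<partial>lebesgue)"
      by (rule nn_integral_cmult) measurable
    also have "\<dots> \<le> ennreal (T powr \<eta>) * (M * ennreal (T powr \<kappa>))"
      using G T by (intro mult_left_mono) auto
    also have "\<dots> = 1 * M * ennreal (T powr (\<eta> + \<kappa>))"
      by (simp add: powr_add ennreal_mult mult_ac)
    also have "\<dots> \<le> ennreal ?C * M * ennreal (T powr (\<eta> + \<kappa>))"
      by (intro mult_right_mono) auto
    finally show ?thesis .
  next
    case False
    then have \<eta>: "\<eta> < 0" by simp
    have e: "ennreal (- \<eta> * t powr (\<eta> - 1)) = ennreal (- \<eta>) * ennreal (t powr (\<eta> - 1))" for t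
      using \<eta> by (intro ennreal_mult) auto
    let ?G = "\<lambda>x. G x * indicator (ball a T) x"
    have "(\<integral>\<^sup>+x\<in>ball a T. ennreal (norm (x - a) powr \<eta>) * G x \<partial>lebesgue) = (\<integral>\<^sup>+x. ennreal (norm (x - a) powr \<eta>) * ?G x \<partial>lebesgue)"
      by (simp add: mult.assoc)
    also have "\<dots> \<le> (\<integral>\<^sup>+t. ennreal (- \<eta> * t powr (\<eta> - 1)) * indicator {0<..} t * (\<integral>\<^sup>+x\<in>ball a t. ?G x \<partial>lebesgue) \<partial>lborel)"
      by (rule nn_integral_norm_powr_le[OF _ \<eta>]) measurable
    also have "\<dots> \<le> (\<integral>\<^sup>+t. ennreal (- \<eta>) * M * (ennreal (t powr (\<eta> + \<kappa> - 1)) * indicator {0<..<T} t) +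
        ennreal (- \<eta>) * M * ennreal (T powr \<kappa>) * (ennreal (t powr (\<eta> - 1)) * indicator {T<..} t) \<partial>lborel)"
    proof (intro nn_integral_mono_AE, use AE_lborel_singleton[of T] in eventually_elim)
      case (elim t)
      have le1: "(\<integral>\<^sup>+x\<in>ball a t. ?G x \<partial>lebesgue) \<le> (\<integral>\<^sup>+x\<in>ball a t. G x \<partial>lebesgue)"
        by (intro nn_integral_mono) (auto simp: indicator_def)
      have le2: "(\<integral>\<^sup>+x\<in>ball a t. ?G x \<partial>lebesgue) \<le> (\<integral>\<^sup>+x\<in>ball a T. G x \<partial>lebesgue)"
        by (intro nn_integral_mono) (auto simp: indicator_def)
      consider "t \<le> 0" | "0 < t" "t < T" | "T < t" using elim by linarith
      then show ?case
      proof cases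
        case 1
        then show ?thesis by simp
      next
        case 2
        have "ennreal (- \<eta> * t powr (\<eta> - 1)) * (\<integral>\<^sup>+x\<in>ball a t. ?G x \<partial>lebesgue) \<le> ennreal (- \<eta> * t powr (\<eta> - 1)) * (M * ennreal (t powr \<kappa>))"
          using order_trans[OF le1] G 2 by (intro mult_left_mono) auto
        also have "\<dots> = ennreal (- \<eta>) * M * ennreal (t powr (\<eta> - 1) * t powr \<kappa>)"
          using e[of t] by (simp only: ennreal_mult[OF powr_ge_zero powr_ge_zero] mult_ac)
        also have "t powr (\<eta> - 1) * t powr \<kappa> = t powr (\<eta> + \<kappa> - 1)"
          by (simp add: powr_add[symmetric] algebra_simps)
        finally show ?thesis using 2 by simp
      next
        case 3
        have "ennreal (- \<eta> * t powr (\<eta> - 1)) * (\<integral>\<^sup>+x\<in>ball a t. ?G x \<partial>lebesgue) \<le> ennreal (- \<eta> * t powr (\<eta> - 1)) * (M * ennreal (T powr \<kappa>))"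
          using order_trans[OF le2] G T by (intro mult_left_mono) auto
        also have "\<dots> = ennreal (- \<eta>) * M * ennreal (T powr \<kappa>) * ennreal (t powr (\<eta> - 1))"
          using e[of t] by (simp only: ennreal_mult[OF powr_ge_zero powr_ge_zero] mult_ac)
        finally show ?thesis using 3 T by simp
      qed
    qed
    also have "\<dots> = ennreal (- \<eta>) * M * ennreal (T powr (\<eta> + \<kappa>) / (\<eta> + \<kappa>)) + ennreal (- \<eta>) * M * ennreal (T powr \<kappa>) * ennreal (T powr \<eta> / - \<eta>)"
      using nn_integral_powr_0_c[of "\<eta> + \<kappa> - 1" T] nn_integral_powr_c_inf[of "\<eta> - 1" T] assms \<eta> T
      by (subst nn_integral_add) (auto simp: nn_integral_cmult)
    also have "\<dots> = ennreal (- \<eta> / (\<eta> + \<kappa>) + 1) * M * ennreal (T powr (\<eta> + \<kappa>))"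
    proof -
      have "ennreal (- \<eta>) * M * ennreal (T powr (\<eta> + \<kappa>) / (\<eta> + \<kappa>)) = M * (ennreal (- \<eta>) * ennreal (T powr (\<eta> + \<kappa>) / (\<eta> + \<kappa>)))"
        by (simp only: mult_ac)
      also have "ennreal (- \<eta>) * ennreal (T powr (\<eta> + \<kappa>) / (\<eta> + \<kappa>)) = ennreal (- \<eta> / (\<eta> + \<kappa>) * T powr (\<eta> + \<kappa>))"
        using \<eta> assms by (subst ennreal_mult[symmetric]) auto
      finally have 1: "ennreal (- \<eta>) * M * ennreal (T powr (\<eta> + \<kappa>) / (\<eta> + \<kappa>)) = M * ennreal (- \<eta> / (\<eta> + \<kappa>) * T powr (\<eta> + \<kappa>))" .
      have "ennreal (- \<eta>) * M * ennreal (T powr \<kappa>) * ennreal (T powr \<eta> / - \<eta>) = M * (ennreal (- \<eta>) * ennreal (T powr \<kappa>) * ennreal (T powr \<eta> / - \<eta>))"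
        by (simp only: mult_ac)
      also have "ennreal (- \<eta>) * ennreal (T powr \<kappa>) * ennreal (T powr \<eta> / - \<eta>) = ennreal ((- \<eta>) * T powr \<kappa> * (T powr \<eta> / - \<eta>))"
      proof -
        have "0 \<le> T powr \<eta> / - \<eta>" using \<eta> by (intro divide_nonneg_pos) auto
        moreover have "0 \<le> - \<eta> * T powr \<kappa>" using \<eta> by (intro mult_nonneg_nonneg) auto
        ultimately show ?thesis using \<eta> by (simp only: ennreal_mult powr_ge_zero neg_0_le_iff_le less_imp_le)
      qed
      also have "(- \<eta>) * T powr \<kappa> * (T powr \<eta> / - \<eta>) = T powr (\<eta> + \<kappa>)"
        using \<eta> by (simp add: powr_add)
      finally have 2: "ennreal (- \<eta>) * M * ennreal (T powr \<kappa>) * ennreal (T powr \<eta> / - \<eta>) = M * ennreal (T powr (\<eta> + \<kappa>))" .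
      have 3: "0 \<le> - \<eta> / (\<eta> + \<kappa>)" using \<eta> assms by (intro divide_nonneg_pos) auto
      have "M * ennreal (- \<eta> / (\<eta> + \<kappa>) * T powr (\<eta> + \<kappa>)) + M * ennreal (T powr (\<eta> + \<kappa>)) = M * (ennreal (- \<eta> / (\<eta> + \<kappa>) * T powr (\<eta> + \<kappa>)) + ennreal (T powr (\<eta> + \<kappa>)))"
        by (simp only: distrib_left)
      also have "ennreal (- \<eta> / (\<eta> + \<kappa>) * T powr (\<eta> + \<kappa>)) + ennreal (T powr (\<eta> + \<kappa>)) = ennreal ((- \<eta> / (\<eta> + \<kappa>) + 1) * T powr (\<eta> + \<kappa>))"
        unfolding distrib_right mult_1_left
        by (intro ennreal_plus[symmetric] mult_nonneg_nonneg 3 powr_ge_zero)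
      also have "\<dots> = ennreal (- \<eta> / (\<eta> + \<kappa>) + 1) * ennreal (T powr (\<eta> + \<kappa>))"
        using 3 by (intro ennreal_mult) auto
      finally show ?thesis unfolding 1 2 by (simp only: mult_ac)
    qed
    also have "\<dots> \<le> ennreal ?C * M * ennreal (T powr (\<eta> + \<kappa>))"
      by (intro mult_right_mono ennreal_leI) auto
    finally show ?thesis .
  qed
qed auto

text \<open>Removing the ball leaves only t > T in the layer cake integral, which converges at
  infinity because \<eta> + \<kappa> < 0.\<close>

lemma nn_integral_norm_powr_outside_ball:
  assumes "\<eta> + \<kappa> < 0" "\<eta> < 0"
  shows "\<exists>C\<ge>0. \<forall>(G :: 'a::euclidean_space \<Rightarrow> ennreal) a T M. G \<in> borel_measurable lebesgue \<longrightarrow> 0 < T \<longrightarrow>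
    (\<forall>t\<ge>T. (\<integral>\<^sup>+x\<in>ball a t. G x \<partial>lebesgue) \<le> M * ennreal (t powr \<kappa>)) \<longrightarrow>
    (\<integral>\<^sup>+x\<in>- ball a T. ennreal (norm (x - a) powr \<eta>) * G x \<partial>lebesgue) \<le> ennreal C * M * ennreal (T powr (\<eta> + \<kappa>))"
proof (intro exI[of _ "- \<eta> / - (\<eta> + \<kappa>)"] conjI allI impI)
  show C0: "0 \<le> - \<eta> / - (\<eta> + \<kappa>)" using assms by (intro divide_nonneg_pos) auto
  fix G :: "'a \<Rightarrow> ennreal" and a T M
  assume meas: "G \<in> borel_measurable lebesgue" and T: "0 < T"
    and G: "\<forall>t\<ge>T. (\<integral>\<^sup>+x\<in>ball a t. G x \<partial>lebesgue) \<le> M * ennreal (t powr \<kappa>)"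
  note [measurable] = meas
  have [measurable]: "- ball a T \<in> sets lebesgue" by auto
  have e: "ennreal (- \<eta> * t powr (\<eta> - 1)) = ennreal (- \<eta>) * ennreal (t powr (\<eta> - 1))" for t
    using assms by (intro ennreal_mult) auto
  let ?G = "\<lambda>x. G x * indicator (- ball a T) x"
  have "(\<integral>\<^sup>+x\<in>- ball a T. ennreal (norm (x - a) powr \<eta>) * G x \<partial>lebesgue) = (\<integral>\<^sup>+x. ennreal (norm (x - a) powr \<eta>) * ?G x \<partial>lebesgue)"
    by (simp add: mult.assoc)
  also have "\<dots> \<le> (\<integral>\<^sup>+t. ennreal (- \<eta> * t powr (\<eta> - 1)) * indicator {0<..} t * (\<integral>\<^sup>+x\<in>ball a t. ?G x \<partial>lebesgue) \<partial>lborel)"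
    by (rule nn_integral_norm_powr_le[OF _ assms(2)]) measurable
  also have "\<dots> \<le> (\<integral>\<^sup>+t. ennreal (- \<eta>) * M * (ennreal (t powr (\<eta> + \<kappa> - 1)) * indicator {T<..} t) \<partial>lborel)"
  proof (intro nn_integral_mono)
    fix t :: real
    show "ennreal (- \<eta> * t powr (\<eta> - 1)) * indicator {0<..} t * (\<integral>\<^sup>+x\<in>ball a t. ?G x \<partial>lebesgue) \<le>
        ennreal (- \<eta>) * M * (ennreal (t powr (\<eta> + \<kappa> - 1)) * indicator {T<..} t)"
    proof (cases "T < t")
      case True
      have "(\<integral>\<^sup>+x\<in>ball a t. ?G x \<partial>lebesgue) \<le> (\<integral>\<^sup>+x\<in>ball a t. G x \<partial>lebesgue)"
        by (intro nn_integral_mono) (auto simp: indicator_def)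
      also have "\<dots> \<le> M * ennreal (t powr \<kappa>)" using G True by auto
      finally have "ennreal (- \<eta> * t powr (\<eta> - 1)) * (\<integral>\<^sup>+x\<in>ball a t. ?G x \<partial>lebesgue) \<le> ennreal (- \<eta> * t powr (\<eta> - 1)) * (M * ennreal (t powr \<kappa>))"
        by (intro mult_left_mono) auto
      also have "\<dots> = ennreal (- \<eta>) * M * ennreal (t powr (\<eta> - 1) * t powr \<kappa>)"
        using e[of t] by (simp only: ennreal_mult[OF powr_ge_zero powr_ge_zero] mult_ac)
      also have "t powr (\<eta> - 1) * t powr \<kappa> = t powr (\<eta> + \<kappa> - 1)"
        by (simp add: powr_add[symmetric] algebra_simps)
      finally show ?thesis using True T by simp
    next
      case False
      have "?G x * indicator (ball a t) x = 0" for x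
        using False by (cases "x \<in> ball a T"; cases "x \<in> ball a t") auto
      then have "(\<integral>\<^sup>+x\<in>ball a t. ?G x \<partial>lebesgue) = 0"
        by (simp only: nn_integral_const mult_zero_left)
      then show ?thesis by (simp only: mult_zero_right zero_le)
    qed
  qed
  also have "\<dots> = ennreal (- \<eta>) * M * ennreal (T powr (\<eta> + \<kappa>) / - (\<eta> + \<kappa>))"
    using nn_integral_powr_c_inf[of "\<eta> + \<kappa> - 1" T] assms T by (subst nn_integral_cmult) auto
  also have "\<dots> = M * (ennreal (- \<eta>) * ennreal (T powr (\<eta> + \<kappa>) / - (\<eta> + \<kappa>)))"
    by (simp only: mult_ac)
  also have "ennreal (- \<eta>) * ennreal (T powr (\<eta> + \<kappa>) / - (\<eta> + \<kappa>)) = ennreal (- \<eta> / - (\<eta> + \<kappa>) * T powr (\<eta> + \<kappa>))"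
    using assms by (subst ennreal_mult'[symmetric]) auto
  also have "\<dots> = ennreal (- \<eta> / - (\<eta> + \<kappa>)) * ennreal (T powr (\<eta> + \<kappa>))"
    using C0 by (intro ennreal_mult) auto
  finally show "(\<integral>\<^sup>+x\<in>- ball a T. ennreal (norm (x - a) powr \<eta>) * G x \<partial>lebesgue) \<le> ennreal (- \<eta> / - (\<eta> + \<kappa>)) * M * ennreal (T powr (\<eta> + \<kappa>))"
    by (simp only: mult_ac)
qed

section \<open>Power weights\<close>

text \<open>The case G = 1 of \<open>nn_integral_norm_powr_ball\<close>, with the dimension as
  growth exponent.\<close>

lemma nn_integral_norm_powr_ball_lebesgue:
  assumes "- real DIM('a::euclidean_space) < \<eta>"
  shows "\<exists>C\<ge>0. \<forall>(a::'a) T. 0 < T \<longrightarrow>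
    (\<integral>\<^sup>+x\<in>ball a T. ennreal (norm (x - a) powr \<eta>) \<partial>lebesgue) \<le> ennreal (C * T powr (\<eta> + real DIM('a)))"
proof -
  obtain C where C: "0 \<le> C" and le: "\<forall>(G :: 'a \<Rightarrow> ennreal) a T M. G \<in> borel_measurable lebesgue \<longrightarrow> 0 < T \<longrightarrow>
    (\<forall>t>0. t \<le> T \<longrightarrow> (\<integral>\<^sup>+x\<in>ball a t. G x \<partial>lebesgue) \<le> M * ennreal (t powr real DIM('a))) \<longrightarrow>
    (\<integral>\<^sup>+x\<in>ball a T. ennreal (norm (x - a) powr \<eta>) * G x \<partial>lebesgue) \<le> ennreal C * M * ennreal (T powr (\<eta> + real DIM('a)))"
    using nn_integral_norm_powr_ball[of \<eta> "real DIM('a)"] assms by (auto simp: field_simps)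
  define b where "b = measure lborel (ball (0::'a) 1)"
  have b: "0 \<le> b" by (simp add: b_def)
  show ?thesis
  proof (intro exI[of _ "C * b"] conjI allI impI)
    show "0 \<le> C * b" using C b by simp
    fix a :: 'a and T :: real assume T: "0 < T"
    have "(\<integral>\<^sup>+x\<in>ball a T. ennreal (norm (x - a) powr \<eta>) * 1 \<partial>lebesgue) \<le> ennreal C * ennreal b * ennreal (T powr (\<eta> + real DIM('a)))"
    proof (rule le[rule_format, OF _ T])
      fix t :: real assume t: "0 < t"
      show "(\<integral>\<^sup>+x\<in>ball a t. 1 \<partial>lebesgue) \<le> ennreal b * ennreal (t powr real DIM('a))"
        using t b emeasure_lborel_ball[of t a] by (simp add: b_def ennreal_mult[symmetric] powr_realpow)
    qed simp
    then show "(\<integral>\<^sup>+x\<in>ball a T. ennreal (norm (x - a) powr \<eta>) \<partial>lebesgue) \<le> ennreal (C * b * T powr (\<eta> + real DIM('a)))"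
      using C b by (simp add: ennreal_mult)
  qed
qed

lemma measurable_norm_diff_lebesgue [measurable]:
  "(\<lambda>x. norm (x - a)) \<in> borel_measurable (lebesgue :: 'a::euclidean_space measure)"
  by (intro measurable_completion) measurable

text \<open>On a ball with 2r \<le> |z-a| the values of the power differ by at most the factor
  3^\<tau>. Any other ball lies in the ball of radius 3r about \<open>a\<close>, where the power is
  at least (3r)^(-\<tau>) off \<open>a\<close> and the average is at most a multiple of
  that.\<close>

lemma A1_power_weight:
  fixes \<tau> :: real
  assumes \<tau>: "0 \<le> \<tau>" "\<tau> < real CARD('n)"
  shows "\<exists>c>0. \<forall>a::real^'n. A1_bound (\<lambda>x. norm (x - a) powr (- \<tau>)) (ennreal c)"
proof -
  let ?n = "real CARD('n)"
  obtain C where C: "0 \<le> C" and le: "\<forall>(a::real^'n) T. 0 < T \<longrightarrow>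
    (\<integral>\<^sup>+x\<in>ball a T. ennreal (norm (x - a) powr (- \<tau>)) \<partial>lebesgue) \<le> ennreal (C * T powr (- \<tau> + ?n))"
    using nn_integral_norm_powr_ball_lebesgue[where 'a = "real^'n", of "- \<tau>"] \<tau> by auto
  define b where "b = measure lborel (ball (0::real^'n) 1)"
  have b: "0 < b" by (simp add: b_def)
  define c where "c = max (3 powr \<tau>) (C * 3 powr ?n / b)"
  show ?thesis
  proof (intro exI[of _ c] conjI allI)
    show "0 < c" by (simp add: c_def less_max_iff_disj)
    fix a :: "real^'n"
    show "A1_bound (\<lambda>x. norm (x - a) powr (- \<tau>)) (ennreal c)"
      unfolding A1_bound_def
    proof (intro allI impI)
      fix z :: "real^'n" and r :: real assume r: "0 < r"
      let ?L = "emeasure lebesgue (ball z r)"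
      have L: "?L = ennreal (b * r powr ?n)"
        using emeasure_lborel_ball[of r z] r by (simp add: b_def powr_realpow)
      have L0: "0 < b * r powr ?n" using b r by simp
      show "AE y in lebesgue. y \<in> ball z r \<longrightarrow>
          wmeas (\<lambda>x. norm (x - a) powr (- \<tau>)) (ball z r) / ?L \<le> ennreal c * ennreal (norm (y - a) powr (- \<tau>))"
      proof (cases "2 * r \<le> norm (z - a)")
        case True
        let ?m = "norm (z - a)"
        have m: "0 < ?m" using True r by linarith
        have "wmeas (\<lambda>x. norm (x - a) powr (- \<tau>)) (ball z r) \<le> (\<integral>\<^sup>+x. ennreal ((?m / 2) powr (- \<tau>)) * indicator (ball z r) x \<partial>lebesgue)"
          unfolding wmeas_def
        proof (intro nn_integral_mono)
          fix x
          show "ennreal (norm (x - a) powr (- \<tau>)) * indicator (ball z r) x \<le> ennreal ((?m / 2) powr (- \<tau>)) * indicator (ball z r) x"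
          proof (cases "x \<in> ball z r")
            case x: True
            then have "?m / 2 \<le> norm (x - a)"
              using True norm_triangle_ineq[of "z - x" "x - a"] by (simp add: dist_norm)
            then show ?thesis using \<tau> m by (intro mult_right_mono ennreal_leI powr_mono2') auto
          qed simp
        qed
        also have "\<dots> = ennreal ((?m / 2) powr (- \<tau>)) * ?L"
          by (rule nn_integral_cmult_indicator) simp
        finally have "wmeas (\<lambda>x. norm (x - a) powr (- \<tau>)) (ball z r) / ?L \<le> ennreal ((?m / 2) powr (- \<tau>)) * ?L / ?L"
          by (rule divide_right_mono_ennreal)
        also have "\<dots> = ennreal ((?m / 2) powr (- \<tau>))"
          using L0 unfolding L by (intro mult_divide_eq_ennreal) auto
        finally have avg: "wmeas (\<lambda>x. norm (x - a) powr (- \<tau>)) (ball z r) / ?L \<le> ennreal ((?m / 2) powr (- \<tau>))" .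
        show ?thesis
        proof (intro AE_I2 impI)
          fix y assume y: "y \<in> ball z r"
          have y1: "?m / 2 \<le> norm (y - a)" "norm (y - a) \<le> 3 * (?m / 2)"
            using y True norm_triangle_ineq[of "z - y" "y - a"] norm_triangle_ineq[of "y - z" "z - a"]
            by (auto simp: dist_norm norm_minus_commute)
          have "(?m / 2) powr (- \<tau>) = 3 powr \<tau> * (3 * (?m / 2)) powr (- \<tau>)"
            using m by (simp add: powr_mult powr_minus powr_divide)
          also have "\<dots> \<le> c * norm (y - a) powr (- \<tau>)"
            using y1 m \<tau> by (intro mult_mono powr_mono2') (auto simp: c_def le_max_iff_disj)
          finally have "ennreal ((?m / 2) powr (- \<tau>)) \<le> ennreal c * ennreal (norm (y - a) powr (- \<tau>))"
            by (simp add: ennreal_mult''[symmetric] ennreal_leI)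
          with avg show "wmeas (\<lambda>x. norm (x - a) powr (- \<tau>)) (ball z r) / ?L \<le> ennreal c * ennreal (norm (y - a) powr (- \<tau>))"
            by (rule order_trans)
        qed
      next
        case False
        have sub: "ball z r \<subseteq> ball a (3 * r)"
        proof
          fix x assume "x \<in> ball z r"
          then show "x \<in> ball a (3 * r)"
            using False norm_triangle_ineq[of "x - z" "z - a"] by (simp add: dist_norm norm_minus_commute)
        qed
        have "wmeas (\<lambda>x. norm (x - a) powr (- \<tau>)) (ball z r) \<le> (\<integral>\<^sup>+x\<in>ball a (3 * r). ennreal (norm (x - a) powr (- \<tau>)) \<partial>lebesgue)"
          unfolding wmeas_def using sub by (intro nn_integral_mono) (auto simp: indicator_def)
        also have "\<dots> \<le> ennreal (C * (3 * r) powr (- \<tau> + ?n))"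
          using le r by auto
        finally have "wmeas (\<lambda>x. norm (x - a) powr (- \<tau>)) (ball z r) / ?L \<le> ennreal (C * (3 * r) powr (- \<tau> + ?n)) / ennreal (b * r powr ?n)"
          unfolding L by (rule divide_right_mono_ennreal)
        also have "\<dots> = ennreal (C * (3 * r) powr (- \<tau> + ?n) / (b * r powr ?n))"
          using C L0 by (intro divide_ennreal) auto
        also have "C * (3 * r) powr (- \<tau> + ?n) / (b * r powr ?n) = C * 3 powr ?n / b * (3 * r) powr (- \<tau>)"
        proof -
          have "(3 * r) powr (- \<tau> + ?n) = (3 * r) powr (- \<tau>) * (3 powr ?n * r powr ?n)"
            unfolding powr_add using r by (simp add: powr_mult)
          then show ?thesis using r b by simp
        qed
        finally have avg: "wmeas (\<lambda>x. norm (x - a) powr (- \<tau>)) (ball z r) / ?L \<le> ennreal (C * 3 powr ?n / b * (3 * r) powr (- \<tau>))" .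
        \<comment> \<open>At \<open>a\<close> itself the power is 0 by convention, so that point is
          left out.\<close>
        have "AE y in lebesgue. y \<noteq> a"
          using AE_lborel_singleton[of a] by (rule AE_completion)
        then show ?thesis
        proof eventually_elim
          case (elim y)
          show ?case
          proof
            assume "y \<in> ball z r"
            then have "y \<in> ball a (3 * r)" using sub by blast
            then have "norm (y - a) < 3 * r" by (simp add: dist_norm norm_minus_commute)
            then have "C * 3 powr ?n / b * (3 * r) powr (- \<tau>) \<le> c * norm (y - a) powr (- \<tau>)"
              using elim \<tau> C b by (intro mult_mono powr_mono2') (auto simp: c_def le_max_iff_disj)
            then have "ennreal (C * 3 powr ?n / b * (3 * r) powr (- \<tau>)) \<le> ennreal c * ennreal (norm (y - a) powr (- \<tau>))"
              by (simp add: ennreal_mult''[symmetric] ennreal_leI)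
            with avg show "wmeas (\<lambda>x. norm (x - a) powr (- \<tau>)) (ball z r) / ?L \<le> ennreal c * ennreal (norm (y - a) powr (- \<tau>))"
              by (rule order_trans)
          qed
        qed
      qed
    qed
  qed
qed

section \<open>Minimum, maximum and scaling in A_1\<close>

lemma A1_bound_mono:
  fixes u :: "real^'n \<Rightarrow> real"
  assumes "A1_bound u c" "c \<le> d" shows "A1_bound u d"
  unfolding A1_bound_def
proof (intro allI impI)
  fix x :: "real^'n" and r :: real assume r: "0 < r"
  have "AE y in lebesgue. y \<in> ball x r \<longrightarrow> wmeas u (ball x r) / emeasure lebesgue (ball x r) \<le> c * ennreal (u y)"
    using assms(1) r by (auto simp: A1_bound_def)
  then show "AE y in lebesgue. y \<in> ball x r \<longrightarrow> wmeas u (ball x r) / emeasure lebesgue (ball x r) \<le> d * ennreal (u y)"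
    by eventually_elim (use mult_right_mono[OF assms(2)] in \<open>auto intro: order_trans\<close>)
qed

text \<open>The average of the minimum is at most either average, in particular that of the function
  which is smaller at the given point.\<close>

lemma A1_bound_min:
  fixes u v :: "real^'n \<Rightarrow> real"
  assumes "A1_bound u c" "A1_bound v c"
  shows "A1_bound (\<lambda>x. min (u x) (v x)) c"
  unfolding A1_bound_def
proof (intro allI impI)
  fix x :: "real^'n" and r :: real assume r: "0 < r"
  have 1: "wmeas (\<lambda>x. min (u x) (v x)) (ball x r) / emeasure lebesgue (ball x r) \<le> wmeas u (ball x r) / emeasure lebesgue (ball x r)"
    "wmeas (\<lambda>x. min (u x) (v x)) (ball x r) / emeasure lebesgue (ball x r) \<le> wmeas v (ball x r) / emeasure lebesgue (ball x r)"
    unfolding wmeas_def by (auto intro!: divide_right_mono_ennreal nn_integral_mono mult_right_mono ennreal_leI)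
  have "AE y in lebesgue. y \<in> ball x r \<longrightarrow> wmeas u (ball x r) / emeasure lebesgue (ball x r) \<le> c * ennreal (u y)"
    "AE y in lebesgue. y \<in> ball x r \<longrightarrow> wmeas v (ball x r) / emeasure lebesgue (ball x r) \<le> c * ennreal (v y)"
    using assms r by (auto simp: A1_bound_def)
  then show "AE y in lebesgue. y \<in> ball x r \<longrightarrow> wmeas (\<lambda>x. min (u x) (v x)) (ball x r) / emeasure lebesgue (ball x r) \<le> c * ennreal (min (u y) (v y))"
  proof eventually_elim
    case (elim y)
    then show ?case using order_trans[OF 1(1)] order_trans[OF 1(2)] by (simp add: min_def)
  qed
qed

text \<open>The maximum is at most the sum, which costs the factor 2.\<close>

lemma A1_bound_max:
  fixes u v :: "real^'n \<Rightarrow> real"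
  assumes [measurable]: "u \<in> borel_measurable lebesgue" "v \<in> borel_measurable lebesgue"
    and A1: "A1_bound u c" "A1_bound v c"
  shows "A1_bound (\<lambda>x. max (u x) (v x)) (2 * c)"
  unfolding A1_bound_def
proof (intro allI impI)
  fix x :: "real^'n" and r :: real assume r: "0 < r"
  let ?L = "emeasure lebesgue (ball x r)"
  have "wmeas (\<lambda>x. max (u x) (v x)) (ball x r) \<le> (\<integral>\<^sup>+y. ennreal (u y) * indicator (ball x r) y + ennreal (v y) * indicator (ball x r) y \<partial>lebesgue)"
    unfolding wmeas_def by (intro nn_integral_mono) (auto simp: indicator_def max_def add_increasing add_increasing2)
  also have "\<dots> = wmeas u (ball x r) + wmeas v (ball x r)"
    unfolding wmeas_def by (rule nn_integral_add) measurable
  finally have 1: "wmeas (\<lambda>x. max (u x) (v x)) (ball x r) / ?L \<le> wmeas u (ball x r) / ?L + wmeas v (ball x r) / ?L"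
    by (metis add_divide_distrib_ennreal divide_right_mono_ennreal)
  have "AE y in lebesgue. y \<in> ball x r \<longrightarrow> wmeas u (ball x r) / ?L \<le> c * ennreal (u y)"
    "AE y in lebesgue. y \<in> ball x r \<longrightarrow> wmeas v (ball x r) / ?L \<le> c * ennreal (v y)"
    using A1 r by (auto simp: A1_bound_def)
  then show "AE y in lebesgue. y \<in> ball x r \<longrightarrow> wmeas (\<lambda>x. max (u x) (v x)) (ball x r) / ?L \<le> 2 * c * ennreal (max (u y) (v y))"
  proof eventually_elim
    case (elim y)
    show ?case
    proof
      assume y: "y \<in> ball x r"
      have "wmeas (\<lambda>x. max (u x) (v x)) (ball x r) / ?L \<le> c * ennreal (u y) + c * ennreal (v y)"
        using elim y by (intro order_trans[OF 1] add_mono) auto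
      also have "\<dots> \<le> c * ennreal (max (u y) (v y)) + c * ennreal (max (u y) (v y))"
        by (intro add_mono mult_left_mono ennreal_leI) auto
      finally show "wmeas (\<lambda>x. max (u x) (v x)) (ball x r) / ?L \<le> 2 * c * ennreal (max (u y) (v y))"
        by (simp add: mult_2 distrib_right)
    qed
  qed
qed

text \<open>Positive factors do not affect the A_1 constant: the comparison constants
  \<open>r powr \<tau>\<close> and its reciprocal multiply to 1.\<close>

lemma A1_bound_scaled_power:
  fixes a :: "real^'n"
  assumes "A1_bound (\<lambda>x. norm (x - a) powr (- \<tau>)) c" "0 < r"
  shows "A1_bound (\<lambda>x. (norm (x - a) / r) powr (- \<tau>)) c"
proof -
  have eq: "(norm (x - a) / r) powr (- \<tau>) = r powr \<tau> * norm (x - a) powr (- \<tau>)" for x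
    using assms(2) by (simp add: powr_divide powr_minus field_simps)
  have "A1_bound (\<lambda>x. r powr \<tau> * norm (x - a) powr (- \<tau>)) (ennreal (r powr \<tau> * (1 / r powr \<tau>)) * c)"
    by (rule A1_bound_comparable[OF _ _ _ _ assms(1)]) (use assms(2) in \<open>auto intro!: AE_I2\<close>)
  then show ?thesis using assms(2) by (simp add: eq)
qed

text \<open>With \<open>a (p - 1) = \<gamma>\<close> the second factor is \<open>min ((|x| / \<rho>)\<^sup>\<gamma>) 1\<close>; the form \<open>A D\<^sup>1\<^sup>-\<^sup>p\<close> with \<open>A\<close> and \<open>D\<close> in
  \<open>A\<^sub>1\<close> is the one of the factorization theorem.\<close>

definition test_weight :: "real \<Rightarrow> real \<Rightarrow> real \<Rightarrow> real \<Rightarrow> real^'n \<Rightarrow> real \<Rightarrow> real \<Rightarrow> real^'n \<Rightarrow> real" where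
  "test_weight p \<tau> s a z r \<rho> x =
     min ((norm (x - z) / r) powr (- \<tau>)) ((norm (x - z) / r) powr (- s)) *
     max ((norm (x - 0) / \<rho>) powr (- a)) 1 powr (1 - p)"

text \<open>One constant serves all centres and radii because translation and scaling preserve the
  A_1 constant of a power weight.\<close>

lemma test_weight_factors:
  assumes "0 \<le> \<tau>" "\<tau> < real CARD('n)" "0 \<le> s" "s < real CARD('n)" "0 \<le> a" "a < real CARD('n)"
  shows "\<exists>c>0. \<forall>(z::real^'n) r. 0 < r \<longrightarrow>
    A1_bound (\<lambda>x. min ((norm (x - z) / r) powr (- \<tau>)) ((norm (x - z) / r) powr (- s))) (ennreal c) \<and>
    A1_bound (\<lambda>x::real^'n. max ((norm (x - 0) / r) powr (- a)) 1) (ennreal c)"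
proof -
  obtain c1 where c1: "0 < c1" "\<And>z::real^'n. A1_bound (\<lambda>x. norm (x - z) powr (- \<tau>)) (ennreal c1)"
    using A1_power_weight[OF assms(1,2)] by blast
  obtain c2 where c2: "0 < c2" "\<And>z::real^'n. A1_bound (\<lambda>x. norm (x - z) powr (- s)) (ennreal c2)"
    using A1_power_weight[OF assms(3,4)] by blast
  obtain c3 where c3: "0 < c3" "\<And>z::real^'n. A1_bound (\<lambda>x. norm (x - z) powr (- a)) (ennreal c3)"
    using A1_power_weight[OF assms(5,6)] by blast
  define c where "c = max (max c1 c2) (max c3 1)"
  show ?thesis
  proof (intro exI[of _ "2 * c"] conjI allI impI)
    show "0 < 2 * c" using c1 by (simp add: c_def less_max_iff_disj)
    fix z :: "real^'n" and r :: real assume r: "0 < r"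
    have "A1_bound (\<lambda>x. min ((norm (x - z) / r) powr (- \<tau>)) ((norm (x - z) / r) powr (- s))) (ennreal c)"
      by (intro A1_bound_min A1_bound_scaled_power r A1_bound_mono[OF c1(2)] A1_bound_mono[OF c2(2)] ennreal_leI)
        (auto simp: c_def)
    then show "A1_bound (\<lambda>x. min ((norm (x - z) / r) powr (- \<tau>)) ((norm (x - z) / r) powr (- s))) (ennreal (2 * c))"
      by (rule A1_bound_mono) (use c1 in \<open>auto simp: c_def intro!: ennreal_leI\<close>)
    have "A1_bound (\<lambda>x::real^'n. max ((norm (x - 0) / r) powr (- a)) 1) (2 * ennreal c)"
    proof (rule A1_bound_max)
      show "(\<lambda>x::real^'n. (norm (x - 0) / r) powr (- a)) \<in> borel_measurable lebesgue" by measurable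
      show "A1_bound (\<lambda>x::real^'n. (norm (x - 0) / r) powr (- a)) (ennreal c)"
        by (intro A1_bound_scaled_power r A1_bound_mono[OF c3(2)] ennreal_leI) (simp add: c_def)
      show "A1_bound (\<lambda>x::real^'n. 1) (ennreal c)"
        by (rule A1_bound_mono[OF A1_bound_1]) (intro ennreal_leI, simp add: c_def)
    qed simp
    then show "A1_bound (\<lambda>x::real^'n. max ((norm (x - 0) / r) powr (- a)) 1) (ennreal (2 * c))"
      by (simp add: ennreal_mult')
  qed
qed

text \<open>Factorization bounds the constants of all test weights at once. For \<open>p = 1\<close>
  the hypothesis applies directly, for \<open>p > 1\<close> extrapolation supplies the
  inequality.\<close>

theorem test_weight_bound:
  fixes \<F> :: "((real^'n \<Rightarrow> ennreal) \<times> (real^'n \<Rightarrow> ennreal)) set"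
  assumes U: "uniform_Ap_bound p0 \<F>" and p0: "1 \<le> p0" and p: "1 < p \<or> p = 1 \<and> p0 = 1"
    and meas: "\<And>f g. (f, g) \<in> \<F> \<Longrightarrow> f \<in> borel_measurable lebesgue \<and> g \<in> borel_measurable lebesgue"
    and params: "0 \<le> \<tau>" "\<tau> < real CARD('n)" "0 \<le> s" "s < real CARD('n)" "0 \<le> a" "a < real CARD('n)"
  shows "\<exists>C>0. \<forall>f g. (f, g) \<in> \<F> \<longrightarrow> (\<forall>z r \<rho> c t. 0 < r \<longrightarrow> 0 < \<rho> \<longrightarrow>
    (\<integral>\<^sup>+x\<in>ball c t. epowr (g x) p * ennreal (test_weight p \<tau> s a z r \<rho> x) \<partial>lebesgue) \<le>
      ennreal C * (\<integral>\<^sup>+x. epowr (f x) p * ennreal (test_weight p \<tau> s a z r \<rho> x) \<partial>lebesgue))"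
proof -
  have p1: "1 \<le> p" using p by auto
  obtain c0 where c0: "0 < c0" and A1: "\<forall>(z::real^'n) r. 0 < r \<longrightarrow>
    A1_bound (\<lambda>x. min ((norm (x - z) / r) powr (- \<tau>)) ((norm (x - z) / r) powr (- s))) (ennreal c0) \<and>
    A1_bound (\<lambda>x::real^'n. max ((norm (x - 0) / r) powr (- a)) 1) (ennreal c0)"
    using test_weight_factors[OF params] by (elim exE conjE) (rule that)
  have [measurable]: "test_weight p \<tau> s a z r \<rho> \<in> borel_measurable lebesgue" for z :: "real^'n" and r \<rho>
    unfolding test_weight_def by measurable
  have ne: "AE x in lebesgue. x \<noteq> (z::real^'n)" for z
    using AE_lborel_singleton[of z] by (rule AE_completion)
  have tw: "test_weight p \<tau> s a z r \<rho> \<in> Ap p" "Ap_const p (test_weight p \<tau> s a z r \<rho>) \<le> ennreal (c0 powr p)"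
    if "0 < r" "0 < \<rho>" for z :: "real^'n" and r \<rho>
  proof -
    define A where "A x = min ((norm (x - z) / r) powr (- \<tau>)) ((norm (x - z) / r) powr (- s))" for x
    define D where "D x = max ((norm (x - 0) / \<rho>) powr (- a)) 1" for x :: "real^'n"
    have eq: "test_weight p \<tau> s a z r \<rho> = (\<lambda>x. A x * D x powr (1 - p))"
      by (auto simp: test_weight_def A_def D_def fun_eq_iff)
    have m: "A \<in> borel_measurable lebesgue" "D \<in> borel_measurable lebesgue"
      unfolding A_def D_def by measurable
    have pA: "AE x in lebesgue. 0 < A x"
      using ne[of z] by eventually_elim (use that in \<open>auto simp: A_def\<close>)
    have pD: "AE x in lebesgue. 0 < D x"
      by (auto simp: D_def less_max_iff_disj)
    have "A1_bound A (ennreal c0)" "A1_bound D (ennreal c0)"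
      using A1[rule_format, OF that(1), of z] A1[rule_format, OF that(2)] unfolding A_def D_def by simp_all
    note f = Ap_factorization[OF m pA pD this p1]
    show "test_weight p \<tau> s a z r \<rho> \<in> Ap p" "Ap_const p (test_weight p \<tau> s a z r \<rho>) \<le> ennreal (c0 powr p)"
      unfolding eq by (rule f)+
  qed
  show ?thesis
  proof (cases "p = 1")
    case True
    then have pp: "p0 = p" using p by auto
    obtain C where C: "0 < C" and le: "\<forall>u\<in>Ap p. Ap_const p u \<le> ennreal (c0 powr p) \<longrightarrow>
     (\<forall>(f, g)\<in>\<F>. (\<integral>\<^sup>+x. epowr (g x) p * ennreal (u x) \<partial>lebesgue)
       \<le> ennreal C * (\<integral>\<^sup>+x. epowr (f x) p * ennreal (u x) \<partial>lebesgue))"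
      using U[unfolded uniform_Ap_bound_def pp, rule_format, of "c0 powr p"] by (elim exE conjE) (rule that)
    show ?thesis
    proof (intro exI[of _ C] conjI C allI impI)
      fix f g :: "real^'n \<Rightarrow> ennreal" and z c :: "real^'n" and r \<rho> t :: real
      assume fg: "(f, g) \<in> \<F>" and r: "0 < r" "0 < \<rho>"
      let ?u = "test_weight p \<tau> s a z r \<rho>"
      have "(\<integral>\<^sup>+x\<in>ball c t. epowr (g x) p * ennreal (?u x) \<partial>lebesgue) \<le> (\<integral>\<^sup>+x. epowr (g x) p * ennreal (?u x) \<partial>lebesgue)"
        by (intro nn_integral_mono) (auto simp: indicator_def)
      also have "\<dots> \<le> ennreal C * (\<integral>\<^sup>+x. epowr (f x) p * ennreal (?u x) \<partial>lebesgue)"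
        using le[rule_format, OF tw[OF r, of z], of "(f, g)"] fg by auto
      finally show "(\<integral>\<^sup>+x\<in>ball c t. epowr (g x) p * ennreal (?u x) \<partial>lebesgue) \<le> ennreal C * (\<integral>\<^sup>+x. epowr (f x) p * ennreal (?u x) \<partial>lebesgue)" .
    qed
  next
    case False
    then have p1': "1 < p" using p1 by simp
    obtain C where C: "0 < C" and le: "\<forall>w \<sigma>. ap_pair p (c0 powr p) w \<sigma> \<longrightarrow> (\<forall>(f, g)\<in>\<F>. \<forall>c r.
    (\<integral>\<^sup>+x\<in>ball c r. epowr (g x) p * ennreal (w x) \<partial>lebesgue) \<le>
      ennreal C * (\<integral>\<^sup>+x. epowr (f x) p * ennreal (w x) \<partial>lebesgue))"
      by (rule exE[OF extrapolation[OF U p0 p1' meas, of "c0 powr p"]]) (assumption, elim conjE, rule that)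
    show ?thesis
    proof (intro exI[of _ C] conjI C allI impI)
      fix f g :: "real^'n \<Rightarrow> ennreal" and z c :: "real^'n" and r \<rho> t :: real
      assume fg: "(f, g) \<in> \<F>" and r: "0 < r" "0 < \<rho>"
      let ?u = "test_weight p \<tau> s a z r \<rho>"
      \<comment> \<open>\<open>0 powr (- s)\<close> is 0, so the formula vanishes at
        \<open>z\<close>, whereas \<open>ap_pair\<close> wants positivity everywhere; the value at
        this one point is changed to 1.\<close>
      define w where "w x = (if x = z then 1 else ?u x)" for x
      have [measurable]: "{z} \<in> sets lebesgue" by auto
      have [measurable]: "w \<in> borel_measurable lebesgue"
      proof -
        have "w = (\<lambda>x. if x \<in> {z} then 1 else ?u x)" by (auto simp: w_def)
        also have "\<dots> \<in> borel_measurable lebesgue" by measurable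
        finally show ?thesis .
      qed
      have wu: "AE x in lebesgue. w x = ?u x"
        using ne[of z] by eventually_elim (simp add: w_def)
      have wpos: "0 < w x" for x
        using r by (auto simp: w_def test_weight_def less_max_iff_disj)
      have "Ap_const p w \<le> ennreal (1 * 1) * Ap_const p ?u"
      proof (rule Ap_const_comparable)
        show "AE x in lebesgue. w x \<le> 1 * ?u x \<and> ?u x \<le> 1 * w x"
          using wu by eventually_elim simp
        show "AE x in lebesgue. 0 < ?u x"
          using wu by eventually_elim (metis wpos)
      qed (use p1 in simp_all)
      then have "Ap_const p w \<le> ennreal (c0 powr p)"
        using tw(2)[OF r, of z] by simp
      then have "ap_pair p (c0 powr p) w (\<lambda>x. w x powr (1 - p / (p - 1)))"
        using c0 by (intro ap_pairI wpos p1') auto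
      then have *: "(\<integral>\<^sup>+x\<in>ball c t. epowr (g x) p * ennreal (w x) \<partial>lebesgue) \<le>
          ennreal C * (\<integral>\<^sup>+x. epowr (f x) p * ennreal (w x) \<partial>lebesgue)"
        using le fg by fast
      have "(\<integral>\<^sup>+x\<in>ball c t. epowr (g x) p * ennreal (w x) \<partial>lebesgue) = (\<integral>\<^sup>+x\<in>ball c t. epowr (g x) p * ennreal (?u x) \<partial>lebesgue)"
        "(\<integral>\<^sup>+x. epowr (f x) p * ennreal (w x) \<partial>lebesgue) = (\<integral>\<^sup>+x. epowr (f x) p * ennreal (?u x) \<partial>lebesgue)"
        using wu by (auto intro!: nn_integral_cong_AE elim!: eventually_mono)
      with * show "(\<integral>\<^sup>+x\<in>ball c t. epowr (g x) p * ennreal (?u x) \<partial>lebesgue) \<le> ennreal C * (\<integral>\<^sup>+x. epowr (f x) p * ennreal (?u x) \<partial>lebesgue)"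
        by simp
    qed
  qed
qed

section \<open>Integrals against the test weights\<close>

text \<open>The minimum and the maximum of the two constants cover both signs of \<open>e\<close>,
  that is, increasing and decreasing powers.\<close>

lemma powr_between:
  fixes e :: real
  assumes "0 < k1" "0 < u" "k1 * u \<le> y" "y \<le> k2 * u"
  shows "min (k1 powr e) (k2 powr e) * u powr e \<le> y powr e"
    and "y powr e \<le> max (k1 powr e) (k2 powr e) * u powr e"
proof -
  have y: "0 < y" using assms by (meson less_le_trans mult_pos_pos)
  have k2: "0 < k2" using assms(2,4) y by (meson less_le_trans zero_less_mult_pos2)
  have eq: "(k1 * u) powr e = k1 powr e * u powr e" "(k2 * u) powr e = k2 powr e * u powr e"
    using assms k2 by (auto simp: powr_mult)
  have le: "min (k1 powr e) (k2 powr e) * u powr e \<le> k1 powr e * u powr e"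
    "min (k1 powr e) (k2 powr e) * u powr e \<le> k2 powr e * u powr e"
    "k1 powr e * u powr e \<le> max (k1 powr e) (k2 powr e) * u powr e"
    "k2 powr e * u powr e \<le> max (k1 powr e) (k2 powr e) * u powr e"
    by (auto intro!: mult_right_mono)
  show "min (k1 powr e) (k2 powr e) * u powr e \<le> y powr e"
  proof (cases "0 \<le> e")
    case True
    have "(k1 * u) powr e \<le> y powr e" using assms True by (intro powr_mono2) auto
    with le(1) eq show ?thesis by linarith
  next
    case False
    have "(k2 * u) powr e \<le> y powr e" using assms False y by (intro powr_mono2') auto
    with le(2) eq show ?thesis by linarith
  qed
  show "y powr e \<le> max (k1 powr e) (k2 powr e) * u powr e"
  proof (cases "0 \<le> e")
    case True
    have "y powr e \<le> (k2 * u) powr e" using assms True y by (intro powr_mono2) auto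
    with le(4) eq show ?thesis by linarith
  next
    case False
    have "y powr e \<le> (k1 * u) powr e" using assms False y by (intro powr_mono2') auto
    with le(3) eq show ?thesis by linarith
  qed
qed

lemma norm_in_ball_away:
  fixes x y :: "'a::real_normed_vector"
  assumes "y \<in> ball x r" "2 * r \<le> norm x"
  shows "1 / 2 * norm x \<le> norm y" "norm y \<le> 2 * norm x"
  using assms norm_triangle_ineq2[of x y] norm_triangle_ineq2[of y x]
  by (auto simp: dist_norm norm_minus_commute)

lemma wmeas_ball_between:
  fixes v :: "real^'n \<Rightarrow> real"
  assumes "0 < t"
  defines "b \<equiv> measure lborel (ball (0::real^'n) 1)"
  shows "(\<And>y. y \<in> ball z t \<Longrightarrow> lo \<le> v y) \<Longrightarrow> 0 \<le> lo \<Longrightarrow> ennreal (lo * (b * t powr real CARD('n))) \<le> wmeas v (ball z t)"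
    and "(\<And>y. y \<in> ball z t \<Longrightarrow> v y \<le> hi) \<Longrightarrow> 0 \<le> hi \<Longrightarrow> wmeas v (ball z t) \<le> ennreal (hi * (b * t powr real CARD('n)))"
proof -
  have L: "emeasure lebesgue (ball z t) = ennreal (b * t powr real CARD('n))"
    using emeasure_lborel_ball[of t z] assms by (simp add: powr_realpow)
  have int: "(\<integral>\<^sup>+y. ennreal c * indicator (ball z t) y \<partial>lebesgue) = ennreal (c * (b * t powr real CARD('n)))" if "0 \<le> c" for c
  proof -
    have "(\<integral>\<^sup>+y. ennreal c * indicator (ball z t) y \<partial>lebesgue) = ennreal c * emeasure lebesgue (ball z t)"
      by (rule nn_integral_cmult_indicator) simp
    then show ?thesis unfolding L using that by (simp add: ennreal_mult b_def)
  qed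
  show "ennreal (lo * (b * t powr real CARD('n))) \<le> wmeas v (ball z t)"
    if "\<And>y. y \<in> ball z t \<Longrightarrow> lo \<le> v y" "0 \<le> lo"
    unfolding int[OF that(2), symmetric] wmeas_def using that(1)
    by (intro nn_integral_mono) (simp add: indicator_def ennreal_leI)
  show "wmeas v (ball z t) \<le> ennreal (hi * (b * t powr real CARD('n)))"
    if "\<And>y. y \<in> ball z t \<Longrightarrow> v y \<le> hi" "0 \<le> hi"
    unfolding int[OF that(2), symmetric] wmeas_def using that(1)
    by (intro nn_integral_mono) (simp add: indicator_def ennreal_leI)
qed

section \<open>Mass of balls for power weights and size of the Morrey normaliser\<close>

text \<open>Away from the origin |y| is comparable to |x| on the whole ball. For |x| \<le> 8r the
  upper bound comes from the ball of radius 9r about 0 and the lower one from a smaller ball that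
  avoids the origin. The two ranges overlap, which leaves freedom in placing a threshold.\<close>

lemma power_weight_ball_bounds:
  fixes \<beta> :: real
  assumes \<beta>: "- real CARD('n) < \<beta>"
  defines "V \<equiv> \<lambda>(x::real^'n) r. enn2real (wmeas (\<lambda>x. norm x powr \<beta>) (ball x r))"
  shows "\<exists>c1>0. \<exists>c2>0. \<forall>(x::real^'n) r. 0 < r \<longrightarrow>
    (norm x \<le> 8 * r \<longrightarrow> c1 * r powr (real CARD('n) + \<beta>) \<le> V x r \<and> V x r \<le> c2 * r powr (real CARD('n) + \<beta>)) \<and>
    (2 * r \<le> norm x \<longrightarrow> c1 * (norm x powr \<beta> * r powr real CARD('n)) \<le> V x r \<and> V x r \<le> c2 * (norm x powr \<beta> * r powr real CARD('n)))"
proof -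
  let ?n = "real CARD('n)"
  let ?v = "\<lambda>x::real^'n. norm x powr \<beta>"
  define b where "b = measure lborel (ball (0::real^'n) 1)"
  have b: "0 < b" by (simp add: b_def)
  obtain C where C: "0 \<le> C" and le: "\<forall>(a::real^'n) T. 0 < T \<longrightarrow>
    (\<integral>\<^sup>+x\<in>ball a T. ennreal (norm (x - a) powr \<beta>) \<partial>lebesgue) \<le> ennreal (C * T powr (\<beta> + ?n))"
    using nn_integral_norm_powr_ball_lebesgue[where 'a = "real^'n", of \<beta>] \<beta> by auto
  define m1 where "m1 = min ((1/4) powr \<beta>) (9 powr \<beta>) * (b * (1/4) powr ?n)"
  define m2 where "m2 = min ((1/2) powr \<beta>) (2 powr \<beta>) * b"
  define M2 where "M2 = max ((1/2) powr \<beta>) (2 powr \<beta>) * b"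
  define c1 where "c1 = min m1 m2"
  define c2 where "c2 = max (C * 9 powr (\<beta> + ?n)) M2"
  have conv: "l \<le> enn2real X \<and> enn2real X \<le> u" if "ennreal l \<le> X" "X \<le> ennreal u" "0 \<le> l" "0 \<le> u" for l u X
    using that by (cases X) (auto simp: top_unique)
  have c0: "0 < c1" "0 < c2" using b by (auto simp: c1_def m1_def m2_def c2_def M2_def less_max_iff_disj)
  have far: "c1 * (norm x powr \<beta> * r powr ?n) \<le> V x r \<and> V x r \<le> c2 * (norm x powr \<beta> * r powr ?n)"
    if r: "0 < r" and x: "2 * r \<le> norm x" for x r
  proof -
    have x0: "0 < norm x" using r x by linarith
    have bd: "min ((1/2) powr \<beta>) (2 powr \<beta>) * norm x powr \<beta> \<le> ?v y"
      "?v y \<le> max ((1/2) powr \<beta>) (2 powr \<beta>) * norm x powr \<beta>" if "y \<in> ball x r" for y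
      using powr_between[OF _ x0 norm_in_ball_away[OF that x]] by auto
    have "ennreal (c1 * (norm x powr \<beta> * r powr ?n)) \<le> ennreal (min ((1/2) powr \<beta>) (2 powr \<beta>) * norm x powr \<beta> * (b * r powr ?n))"
    proof (rule ennreal_leI)
      have "c1 * (norm x powr \<beta> * r powr ?n) \<le> m2 * (norm x powr \<beta> * r powr ?n)" by (intro mult_right_mono) (auto simp: c1_def)
      then show "c1 * (norm x powr \<beta> * r powr ?n) \<le> min ((1/2) powr \<beta>) (2 powr \<beta>) * norm x powr \<beta> * (b * r powr ?n)"
        by (simp add: m2_def mult_ac)
    qed
    also have "\<dots> \<le> wmeas ?v (ball x r)"
      unfolding b_def using r by (intro wmeas_ball_between(1) bd) auto
    finally have L: "ennreal (c1 * (norm x powr \<beta> * r powr ?n)) \<le> wmeas ?v (ball x r)" .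
    have "wmeas ?v (ball x r) \<le> ennreal (max ((1/2) powr \<beta>) (2 powr \<beta>) * norm x powr \<beta> * (b * r powr ?n))"
      unfolding b_def using r by (intro wmeas_ball_between(2) bd) (auto simp: le_max_iff_disj)
    also have "\<dots> \<le> ennreal (c2 * (norm x powr \<beta> * r powr ?n))"
    proof (rule ennreal_leI)
      have "M2 * (norm x powr \<beta> * r powr ?n) \<le> c2 * (norm x powr \<beta> * r powr ?n)" by (intro mult_right_mono) (auto simp: c2_def)
      then show "max ((1/2) powr \<beta>) (2 powr \<beta>) * norm x powr \<beta> * (b * r powr ?n) \<le> c2 * (norm x powr \<beta> * r powr ?n)"
        by (simp add: M2_def mult_ac)
    qed
    finally have U: "wmeas ?v (ball x r) \<le> ennreal (c2 * (norm x powr \<beta> * r powr ?n))" .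
    from conv[OF L U] c0 show ?thesis by (simp add: V_def)
  qed
  have near: "c1 * r powr (?n + \<beta>) \<le> V x r \<and> V x r \<le> c2 * r powr (?n + \<beta>)"
    if r: "0 < r" and x: "norm x \<le> 8 * r" for x r
  proof -
      \<comment> \<open>Moving the centre outwards by r/2 gives a ball of radius r/4 inside
        \<open>ball x r\<close> on which r/4 \<le> |y| \<le> 9r; for \<open>x = 0\<close> a
        coordinate vector gives the direction.\<close>
      obtain z :: "real^'n" where nz: "norm z = norm x + r / 2" and dz: "dist x z = r / 2"
      proof -
        let ?e = "if x = 0 then axis undefined 1 else (1 / norm x) *\<^sub>R x"
        let ?z = "x + (r / 2) *\<^sub>R ?e"
        have e: "norm ?e = 1" by (simp add: norm_axis_1)
        have "?z = (1 + r / (2 * norm x)) *\<^sub>R x" if "x \<noteq> 0"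
          using that by (simp add: scaleR_add_left)
        then have nz: "norm ?z = norm x + r / 2"
          using e r by (cases "x = 0") (auto simp: field_simps)
        have dz: "dist x ?z = r / 2" using e r by (simp add: dist_norm)
        from nz dz show thesis by (rule that)
      qed
      have sub: "ball z (r / 4) \<subseteq> ball x r"
      proof
        fix y assume "y \<in> ball z (r / 4)"
        then show "y \<in> ball x r" using dist_triangle[of x y z] dz r by simp
      qed
      have low: "min ((1/4) powr \<beta>) (9 powr \<beta>) * r powr \<beta> \<le> ?v y" if "y \<in> ball z (r / 4)" for y
      proof (rule powr_between(1))
        show "1 / 4 * r \<le> norm y"
          using that nz norm_triangle_ineq2[of z y] norm_ge_zero[of x] unfolding mem_ball dist_norm by linarith
        show "norm y \<le> 9 * r"
        proof -
          have "y \<in> ball x r" using sub that by blast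
          then show ?thesis using norm_triangle_ineq2[of y x] x by (simp add: dist_norm norm_minus_commute)
        qed
      qed (use r in auto)
      have "ennreal (c1 * r powr (?n + \<beta>)) \<le> ennreal (min ((1/4) powr \<beta>) (9 powr \<beta>) * r powr \<beta> * (b * (r / 4) powr ?n))"
      proof (rule ennreal_leI)
        have "c1 * r powr (?n + \<beta>) \<le> m1 * r powr (?n + \<beta>)" by (intro mult_right_mono) (auto simp: c1_def)
        also have "\<dots> = min ((1/4) powr \<beta>) (9 powr \<beta>) * r powr \<beta> * (b * (r / 4) powr ?n)"
          using r by (simp add: m1_def powr_add powr_divide)
        finally show "c1 * r powr (?n + \<beta>) \<le> min ((1/4) powr \<beta>) (9 powr \<beta>) * r powr \<beta> * (b * (r / 4) powr ?n)" .
      qed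
      also have "\<dots> \<le> wmeas ?v (ball z (r / 4))"
        unfolding b_def using r by (intro wmeas_ball_between(1) low) auto
      also have "\<dots> \<le> wmeas ?v (ball x r)"
        unfolding wmeas_def using sub by (intro nn_integral_mono) (auto simp: indicator_def)
      finally have L: "ennreal (c1 * r powr (?n + \<beta>)) \<le> wmeas ?v (ball x r)" .
      have sub: "ball x r \<subseteq> ball (0::real^'n) (9 * r)"
      proof
        fix y assume "y \<in> ball x r"
        then show "y \<in> ball 0 (9 * r)" using norm_triangle_ineq2[of y x] r x by (simp add: dist_norm norm_minus_commute)
      qed
      have "wmeas ?v (ball x r) \<le> (\<integral>\<^sup>+x\<in>ball (0::real^'n) (9 * r). ennreal (norm (x - 0) powr \<beta>) \<partial>lebesgue)"
        unfolding wmeas_def using sub by (intro nn_integral_mono) (auto simp: indicator_def)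
      also have "\<dots> \<le> ennreal (C * (9 * r) powr (\<beta> + ?n))"
        using le[rule_format, of "9 * r" 0] r by simp
      also have "\<dots> \<le> ennreal (c2 * r powr (?n + \<beta>))"
      proof (rule ennreal_leI)
        have "C * (9 * r) powr (\<beta> + ?n) = C * 9 powr (\<beta> + ?n) * r powr (?n + \<beta>)"
          using r by (simp add: powr_mult add.commute)
        also have "\<dots> \<le> c2 * r powr (?n + \<beta>)" by (intro mult_right_mono) (auto simp: c2_def)
        finally show "C * (9 * r) powr (\<beta> + ?n) \<le> c2 * r powr (?n + \<beta>)" .
      qed
      finally have U: "wmeas ?v (ball x r) \<le> ennreal (c2 * r powr (?n + \<beta>))" .
      have "0 \<le> c1" "0 \<le> c2" using b by (auto simp: c1_def m1_def m2_def c2_def M2_def le_max_iff_disj)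
      with conv[OF L U] show ?thesis by (simp add: V_def)
  qed
  from c0 near far show ?thesis by blast
qed

text \<open>Raising the ball bounds to the power l2/n, which may be negative, produces the two
  exponents that govern all later estimates: \<open>L\<close> near the origin and
  \<open>\<mu>\<close> on distant balls.\<close>

lemma morrey_normalizer_bounds:
  fixes \<beta> l1 l2 :: real
  assumes \<beta>: "- real CARD('n) < \<beta>"
  defines "N \<equiv> \<lambda>(x::real^'n) r. r powr l1 * enn2real (wmeas (\<lambda>x. norm x powr \<beta>) (ball x r)) powr (l2 / real CARD('n))"
    and "L \<equiv> l1 + l2 * (1 + \<beta> / real CARD('n))" and "\<mu> \<equiv> l1 + l2"
  shows "\<exists>k1>0. \<exists>k2>0. \<forall>(x::real^'n) r. 0 < r \<longrightarrow>
    (norm x \<le> 8 * r \<longrightarrow> k1 * r powr L \<le> N x r \<and> N x r \<le> k2 * r powr L) \<and>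
    (2 * r \<le> norm x \<longrightarrow> k1 * (r powr \<mu> * norm x powr (L - \<mu>)) \<le> N x r \<and> N x r \<le> k2 * (r powr \<mu> * norm x powr (L - \<mu>)))"
proof -
  let ?n = "real CARD('n)"
  define V where "V x r = enn2real (wmeas (\<lambda>x. norm x powr \<beta>) (ball x r))" for x :: "real^'n" and r
  obtain c1 c2 where c: "0 < c1" "0 < c2" and V: "\<forall>(x::real^'n) r. 0 < r \<longrightarrow>
    (norm x \<le> 8 * r \<longrightarrow> c1 * r powr (?n + \<beta>) \<le> V x r \<and> V x r \<le> c2 * r powr (?n + \<beta>)) \<and>
    (2 * r \<le> norm x \<longrightarrow> c1 * (norm x powr \<beta> * r powr ?n) \<le> V x r \<and> V x r \<le> c2 * (norm x powr \<beta> * r powr ?n))"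
    using power_weight_ball_bounds[OF \<beta>] unfolding V_def by blast
  define e where "e = l2 / ?n"
  define k1 where "k1 = min (c1 powr e) (c2 powr e)"
  define k2 where "k2 = max (c1 powr e) (c2 powr e)"
  have k: "0 < k1" "0 < k2" using c by (auto simp: k1_def k2_def less_max_iff_disj)
  have bd: "k1 * (r powr l1 * u powr e) \<le> N x r \<and> N x r \<le> k2 * (r powr l1 * u powr e)"
    if "0 < u" "c1 * u \<le> V x r" "V x r \<le> c2 * u" for u x r
    using mult_left_mono[OF powr_between(1)[OF c(1) that, of e], of "r powr l1"]
      mult_left_mono[OF powr_between(2)[OF c(1) that, of e], of "r powr l1"]
    by (simp add: N_def V_def e_def k1_def k2_def mult_ac)
  have near: "k1 * r powr L \<le> N x r \<and> N x r \<le> k2 * r powr L" if r: "0 < r" and x: "norm x \<le> 8 * r" for x r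
  proof -
    have "r powr l1 * (r powr (?n + \<beta>)) powr e = r powr L"
      by (simp add: powr_powr powr_add[symmetric] L_def e_def field_simps)
    then show ?thesis using bd[of "r powr (?n + \<beta>)" x r] V r x by auto
  qed
  have far: "k1 * (r powr \<mu> * norm x powr (L - \<mu>)) \<le> N x r \<and> N x r \<le> k2 * (r powr \<mu> * norm x powr (L - \<mu>))"
    if r: "0 < r" and x: "2 * r \<le> norm x" for x r
  proof -
    have x0: "x \<noteq> 0" using r x by auto
    have e1: "?n * e = l2" "\<beta> * e = L - \<mu>" by (auto simp: e_def L_def \<mu>_def field_simps)
    have "r powr l1 * (norm x powr \<beta> * r powr ?n) powr e = r powr l1 * r powr (?n * e) * norm x powr (\<beta> * e)"
      by (simp add: powr_mult powr_powr)
    also have "\<dots> = r powr \<mu> * norm x powr (L - \<mu>)"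
      unfolding e1 by (simp add: powr_add \<mu>_def)
    finally show ?thesis using bd[of "norm x powr \<beta> * r powr ?n" x r] V r x x0 by auto
  qed
  from k near far show ?thesis by blast
qed

section \<open>Test weights against functions of Morrey growth\<close>

text \<open>Below the common radius the exponent \<open>\<tau>\<close> wins the minimum and the
  singular power wins the maximum; in \<open>test_weight_outside\<close> both are decided the other
  way.\<close>

lemma test_weight_inside:
  assumes "x \<noteq> 0" "norm x < R" "\<tau> \<le> s" "0 \<le> a"
  shows "test_weight p \<tau> s a 0 R R x = (norm x / R) powr (a * (p - 1) - \<tau>)"
proof -
  define y where "y = norm x / R"
  have "0 < R" using assms(2) norm_ge_zero[of x] by linarith
  then have y: "0 < y" "y < 1" using assms by (auto simp: y_def)
  have "y powr (- \<tau>) \<le> y powr (- s)" using y assms by (intro powr_mono') auto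
  moreover have "1 \<le> y powr (- a)" using y assms powr_mono'[of "- a" 0 y] by auto
  moreover have "(y powr (- a)) powr (1 - p) = y powr (a * (p - 1))"
    by (simp add: powr_powr algebra_simps)
  ultimately have "test_weight p \<tau> s a 0 R R x = y powr (- \<tau>) * y powr (a * (p - 1))"
    by (simp add: test_weight_def y_def max_def)
  also have "\<dots> = y powr (a * (p - 1) - \<tau>)" by (simp add: powr_add[symmetric])
  finally show ?thesis by (simp add: y_def)
qed

lemma test_weight_outside:
  assumes "0 < R" "R \<le> norm x" "\<tau> \<le> s" "0 \<le> a"
  shows "test_weight p \<tau> s a 0 R R x = (norm x / R) powr (- s)"
proof -
  define y where "y = norm x / R"
  have y: "1 \<le> y" using assms by (auto simp: y_def)
  have "y powr (- s) \<le> y powr (- \<tau>)" using y assms by (intro powr_mono) auto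
  moreover have "y powr (- a) \<le> 1" using y assms powr_mono[of "- a" 0 y] by auto
  ultimately show ?thesis by (simp add: test_weight_def y_def)
qed

lemma test_weight_measurable [measurable]:
  "test_weight p \<tau> s a z r \<rho> \<in> borel_measurable lebesgue"
  unfolding test_weight_def by measurable

lemma nn_integral_add3:
  assumes "f \<in> borel_measurable M" "g \<in> borel_measurable M" "h \<in> borel_measurable M"
  shows "(\<integral>\<^sup>+x. a * f x + b * g x + c * h x \<partial>M) = a * (\<integral>\<^sup>+x. f x \<partial>M) + b * (\<integral>\<^sup>+x. g x \<partial>M) + c * (\<integral>\<^sup>+x. h x \<partial>M)"
  using assms by (simp add: nn_integral_add nn_integral_cmult)

text \<open>Relative to |x|^\<beta> the weight is a power with exponent \<open>\<eta>\<close> inside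
  and \<open>\<eta>'\<close> outside the ball of radius \<open>R\<close>. The hypotheses give \<eta>
  + l > 0 and \<eta>' + l < 0, so under the growth t^l both pieces converge, each with a bound of
  the order R^(l-\<beta>).\<close>

lemma nn_integral_centered_test_weight:
  assumes l: "0 < l" "l < s + \<beta>" "\<beta> - l < a * (p - 1) - \<tau>" and \<tau>: "\<tau> \<le> s" "0 \<le> a"
  shows "\<exists>C\<ge>0. \<forall>(\<phi> :: real^'n \<Rightarrow> ennreal) M R. \<phi> \<in> borel_measurable lebesgue \<longrightarrow> 0 < R \<longrightarrow>
    (\<forall>t>0. (\<integral>\<^sup>+x\<in>ball 0 t. \<phi> x * ennreal (norm x powr \<beta>) \<partial>lebesgue) \<le> M * ennreal (t powr l)) \<longrightarrow>
    (\<integral>\<^sup>+x. \<phi> x * ennreal (test_weight p \<tau> s a 0 R R x) \<partial>lebesgue) \<le> ennreal C * M * ennreal (R powr (l - \<beta>))"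
proof -
  define \<eta> where "\<eta> = a * (p - 1) - \<tau> - \<beta>"
  define \<eta>' where "\<eta>' = - s - \<beta>"
  have \<eta>: "0 < \<eta> + l" "\<eta>' + l < 0" "\<eta>' < 0" using l by (auto simp: \<eta>_def \<eta>'_def)
  obtain C1 where C1: "0 \<le> C1" and in_le: "\<forall>(G :: real^'n \<Rightarrow> ennreal) a T M. G \<in> borel_measurable lebesgue \<longrightarrow> 0 < T \<longrightarrow>
    (\<forall>t>0. t \<le> T \<longrightarrow> (\<integral>\<^sup>+x\<in>ball a t. G x \<partial>lebesgue) \<le> M * ennreal (t powr l)) \<longrightarrow>
    (\<integral>\<^sup>+x\<in>ball a T. ennreal (norm (x - a) powr \<eta>) * G x \<partial>lebesgue) \<le> ennreal C1 * M * ennreal (T powr (\<eta> + l))"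
    using nn_integral_norm_powr_ball[OF \<eta>(1)] by (elim exE conjE) (rule that)
  obtain C2 where C2: "0 \<le> C2" and out_le: "\<forall>(G :: real^'n \<Rightarrow> ennreal) a T M. G \<in> borel_measurable lebesgue \<longrightarrow> 0 < T \<longrightarrow>
    (\<forall>t\<ge>T. (\<integral>\<^sup>+x\<in>ball a t. G x \<partial>lebesgue) \<le> M * ennreal (t powr l)) \<longrightarrow>
    (\<integral>\<^sup>+x\<in>- ball a T. ennreal (norm (x - a) powr \<eta>') * G x \<partial>lebesgue) \<le> ennreal C2 * M * ennreal (T powr (\<eta>' + l))"
    using nn_integral_norm_powr_outside_ball[OF \<eta>(2,3)] by (elim exE conjE) (rule that)
  show ?thesis
  proof (intro exI[of _ "C1 + C2"] conjI allI impI)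
    show "0 \<le> C1 + C2" using C1 C2 by simp
    fix \<phi> :: "real^'n \<Rightarrow> ennreal" and M and R :: real
    assume meas: "\<phi> \<in> borel_measurable lebesgue" and R: "0 < R"
      and hyp: "\<forall>t>0. (\<integral>\<^sup>+x\<in>ball 0 t. \<phi> x * ennreal (norm x powr \<beta>) \<partial>lebesgue) \<le> M * ennreal (t powr l)"
    note [measurable] = meas
    define G where "G x = \<phi> x * ennreal (norm (x - 0) powr \<beta>)" for x
    have [measurable]: "G \<in> borel_measurable lebesgue" unfolding G_def by measurable
    have [measurable]: "- ball (0::real^'n) R \<in> sets lebesgue" by auto
    define f1 where "f1 x = ennreal (norm (x - 0) powr \<eta>) * G x * indicator (ball 0 R) x" for x
    define f2 where "f2 x = ennreal (norm (x - 0) powr \<eta>') * G x * indicator (- ball 0 R) x" for x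
    have [measurable]: "f1 \<in> borel_measurable lebesgue" "f2 \<in> borel_measurable lebesgue"
      unfolding f1_def f2_def by measurable
    have hypG: "(\<integral>\<^sup>+x\<in>ball 0 t. G x \<partial>lebesgue) \<le> M * ennreal (t powr l)" if "0 < t" for t
      using hyp that by (simp add: G_def)
    have I1: "(\<integral>\<^sup>+x. f1 x \<partial>lebesgue) \<le> ennreal C1 * M * ennreal (R powr (\<eta> + l))"
      unfolding f1_def by (rule in_le[rule_format]) (use R hypG in auto)
    have I2: "(\<integral>\<^sup>+x. f2 x \<partial>lebesgue) \<le> ennreal C2 * M * ennreal (R powr (\<eta>' + l))"
      unfolding f2_def by (rule out_le[rule_format]) (use R hypG in auto)
    have ne: "AE x in lebesgue. x \<noteq> (0::real^'n)"
      using AE_lborel_singleton[of 0] by (rule AE_completion)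
    \<comment> \<open>The zero summand brings the bound into the shape of
      \<open>nn_integral_add3\<close>.\<close>
    have "(\<integral>\<^sup>+x. \<phi> x * ennreal (test_weight p \<tau> s a 0 R R x) \<partial>lebesgue) \<le>
        (\<integral>\<^sup>+x. ennreal (R powr (- (\<eta> + \<beta>))) * f1 x + ennreal (R powr s) * f2 x + 0 * f2 x \<partial>lebesgue)"
    proof (intro nn_integral_mono_AE, use ne in eventually_elim)
      case (elim x)
      show ?case
      proof (cases "norm x < R")
        case True
        have "test_weight p \<tau> s a 0 R R x = (norm x / R) powr (\<eta> + \<beta>)"
          using test_weight_inside[OF elim True \<tau>] by (simp add: \<eta>_def)
        also have "\<dots> = R powr (- (\<eta> + \<beta>)) * (norm x powr \<eta> * norm x powr \<beta>)"
        proof -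
          have "(norm x / R) powr (\<eta> + \<beta>) = norm x powr (\<eta> + \<beta>) / R powr (\<eta> + \<beta>)"
            using R by (simp add: powr_divide)
          then show ?thesis by (simp only: powr_minus_divide powr_add) simp
        qed
        finally have "\<phi> x * ennreal (test_weight p \<tau> s a 0 R R x) = ennreal (R powr (- (\<eta> + \<beta>))) * f1 x"
          using True by (simp add: f1_def G_def ennreal_mult mult_ac)
        then show ?thesis by (simp add: add_increasing2)
      next
        case False
        have "test_weight p \<tau> s a 0 R R x = (norm x / R) powr (- s)"
          using test_weight_outside[OF R _ \<tau>, of x] False by simp
        also have "\<dots> = R powr s * (norm x powr \<eta>' * norm x powr \<beta>)"
        proof -
          have "(norm x / R) powr (- s) = R powr s * norm x powr (\<eta>' + \<beta>)"
            using R by (simp add: \<eta>'_def powr_divide powr_minus field_simps)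
          then show ?thesis by (simp only: powr_add)
        qed
        finally have "\<phi> x * ennreal (test_weight p \<tau> s a 0 R R x) = ennreal (R powr s) * f2 x"
          using False by (simp add: f2_def G_def ennreal_mult mult_ac)
        then show ?thesis by (simp add: add_increasing)
      qed
    qed
    also have "\<dots> = ennreal (R powr (- (\<eta> + \<beta>))) * (\<integral>\<^sup>+x. f1 x \<partial>lebesgue) + ennreal (R powr s) * (\<integral>\<^sup>+x. f2 x \<partial>lebesgue)"
      by (subst nn_integral_add3) auto
    also have "\<dots> \<le> ennreal (R powr (- (\<eta> + \<beta>))) * (ennreal C1 * M * ennreal (R powr (\<eta> + l))) + ennreal (R powr s) * (ennreal C2 * M * ennreal (R powr (\<eta>' + l)))"
      by (intro add_mono mult_left_mono I1 I2) auto
    also have "\<dots> = ennreal C1 * M * ennreal (R powr (- (\<eta> + \<beta>)) * R powr (\<eta> + l)) + ennreal C2 * M * ennreal (R powr s * R powr (\<eta>' + l))"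
      by (simp only: ennreal_mult[OF powr_ge_zero powr_ge_zero] mult_ac)
    also have "R powr (- (\<eta> + \<beta>)) * R powr (\<eta> + l) = R powr (l - \<beta>)" by (simp add: powr_add[symmetric])
    also have "R powr s * R powr (\<eta>' + l) = R powr (l - \<beta>)" by (simp add: powr_add[symmetric] \<eta>'_def)
    also have "ennreal C1 * M * ennreal (R powr (l - \<beta>)) + ennreal C2 * M * ennreal (R powr (l - \<beta>)) = ennreal (C1 + C2) * M * ennreal (R powr (l - \<beta>))"
      using C1 C2 by (simp add: distrib_right)
    finally show "(\<integral>\<^sup>+x. \<phi> x * ennreal (test_weight p \<tau> s a 0 R R x) \<partial>lebesgue) \<le> ennreal (C1 + C2) * M * ennreal (R powr (l - \<beta>))" .
  qed
qed

text \<open>At distance at least |z|/4 from \<open>z\<close>, the distance |x-z| dominates both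
  |x|/5 and |z|/5. So the tail of the shifted weight is at most a multiple of (r/|z|)^s times a
  weight centred at the origin with scale |z|.\<close>

lemma test_weight_far_le:
  fixes x z :: "real^'n"
  assumes r: "0 < r" and z: "0 < norm z" and x: "x \<noteq> 0" "norm z / 4 \<le> norm (x - z)"
    and \<tau>: "0 \<le> \<tau>" "\<tau> \<le> s"
  shows "test_weight p 0 s a z r (norm z) x \<le> 5 powr s * (r / norm z) powr s * test_weight p \<tau> s a 0 (norm z) (norm z) x"
proof -
  let ?\<rho> = "norm z"
  define y where "y = norm x / ?\<rho>"
  define q where "q = norm (x - z) / ?\<rho>"
  have y: "0 < y" using x z by (simp add: y_def)
  have "norm x \<le> norm (x - z) + norm z" using norm_triangle_ineq[of "x - z" z] by simp
  then have "norm x \<le> 5 * norm (x - z)" using x by simp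
  then have q1: "y / 5 \<le> q" using z by (simp add: y_def q_def field_simps)
  have "norm z \<le> 5 * norm (x - z)" using x norm_ge_zero[of "x - z"] by linarith
  then have q2: "1 / 5 \<le> q" using z unfolding q_def by (subst pos_le_divide_eq) auto
  note q = q1 q2 less_le_trans[OF _ q2, of 0, simplified]
  have s0: "0 \<le> s" using \<tau> by simp
  have "q powr (- s) \<le> (y / 5) powr (- s)" "q powr (- s) \<le> (1 / 5) powr (- s)"
    using q y s0 by (auto intro!: powr_mono2')
  then have qs: "q powr (- s) \<le> 5 powr s * y powr (- s)" "q powr (- s) \<le> 5 powr s"
    using y by (auto simp: powr_divide powr_minus field_simps)
  have "q powr (- s) \<le> 5 powr s * min (y powr (- \<tau>)) (y powr (- s))"
  proof (cases "y \<le> 1")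
    case True
    have "1 \<le> y powr (- \<tau>)" "1 \<le> y powr (- s)"
      using True y \<tau> powr_mono'[of "- \<tau>" 0 y] powr_mono'[of "- s" 0 y] by auto
    then have "5 powr s * 1 \<le> 5 powr s * min (y powr (- \<tau>)) (y powr (- s))"
      by (intro mult_left_mono) auto
    then show ?thesis using qs(2) by linarith
  next
    case False
    have "y powr (- s) \<le> y powr (- \<tau>)" using False \<tau> by (intro powr_mono) auto
    then show ?thesis using qs(1) by (simp add: min_def)
  qed
  moreover have "(norm (x - z) / r) powr (- s) = (r / ?\<rho>) powr s * q powr (- s)"
    using r z q(3) by (simp add: q_def powr_divide powr_minus field_simps)
  ultimately have "(norm (x - z) / r) powr (- s) \<le> (r / ?\<rho>) powr s * (5 powr s * min (y powr (- \<tau>)) (y powr (- s)))"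
    by (simp add: mult_left_mono)
  moreover have "min ((norm (x - z) / r) powr (- 0)) ((norm (x - z) / r) powr (- s)) \<le> (norm (x - z) / r) powr (- s)"
    by simp
  ultimately have "min ((norm (x - z) / r) powr (- 0)) ((norm (x - z) / r) powr (- s)) \<le> 5 powr s * (r / ?\<rho>) powr s * min (y powr (- \<tau>)) (y powr (- s))"
    by (simp only: mult_ac)
  then have "min ((norm (x - z) / r) powr (- 0)) ((norm (x - z) / r) powr (- s)) * max (y powr (- a)) 1 powr (1 - p) \<le>
      5 powr s * (r / ?\<rho>) powr s * min (y powr (- \<tau>)) (y powr (- s)) * max (y powr (- a)) 1 powr (1 - p)"
    by (rule mult_right_mono) simp
  then show ?thesis by (simp add: test_weight_def y_def mult.assoc)
qed

lemma test_weight_le: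
  assumes "0 \<le> a" "1 \<le> p"
  shows "test_weight p \<tau> s a z r \<rho> x \<le> min ((norm (x - z) / r) powr (- \<tau>)) ((norm (x - z) / r) powr (- s))"
proof -
  have "max ((norm (x - 0) / \<rho>) powr (- a)) 1 powr (1 - p) \<le> 1 powr (1 - p)"
    using assms by (intro powr_mono2') auto
  then show ?thesis
    unfolding test_weight_def by (intro mult_left_le) auto
qed

text \<open>The space splits into \<open>ball z r\<close>, the annulus up to |z|/4 and the rest. On
  the first two |x| is comparable to |z| and the growth in balls about \<open>z\<close> is used; the
  rest reduces to the centred weight by \<open>test_weight_far_le\<close>.\<close>

lemma nn_integral_shifted_test_weight:
  fixes l :: real
  assumes l: "0 < l" "l < s + \<beta>" "\<beta> - l < a * (p - 1) - \<tau>" and \<tau>: "0 \<le> \<tau>" "\<tau> \<le> s" "0 \<le> a"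
    and s: "0 < s" "\<mu> < s" and p: "1 \<le> p"
  shows "\<exists>C\<ge>0. \<forall>(\<phi> :: real^'n \<Rightarrow> ennreal) M z r. \<phi> \<in> borel_measurable lebesgue \<longrightarrow> 0 < r \<longrightarrow> 8 * r < norm z \<longrightarrow>
    (\<forall>t>0. (\<integral>\<^sup>+x\<in>ball 0 t. \<phi> x * ennreal (norm x powr \<beta>) \<partial>lebesgue) \<le> M * ennreal (t powr l)) \<longrightarrow>
    (\<forall>t>0. 2 * t \<le> norm z \<longrightarrow> (\<integral>\<^sup>+x\<in>ball z t. \<phi> x * ennreal (norm x powr \<beta>) \<partial>lebesgue) \<le> M * ennreal (t powr \<mu> * norm z powr (l - \<mu>))) \<longrightarrow>
    (\<integral>\<^sup>+x. \<phi> x * ennreal (test_weight p 0 s a z r (norm z) x) \<partial>lebesgue) \<le> ennreal C * M * ennreal (r powr \<mu> * norm z powr (l - \<mu> - \<beta>))"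
proof -
  \<comment> \<open>On the annulus the function is cut off at |z|/4, so its ball integrals become
    constant for large t. Bounding them for all t \<ge> r takes a growth exponent \<ge> 0, and the
    factor r^(\<mu>-\<kappa>) makes up for the change when \<mu> < 0.\<close>
  define \<kappa> where "\<kappa> = max 0 \<mu>"
  have \<kappa>: "- s + \<kappa> < 0" "- s < 0" "0 \<le> \<kappa>" "\<mu> \<le> \<kappa>" using s by (auto simp: \<kappa>_def)
  obtain C1 where C1: "0 \<le> C1" and far_le: "\<forall>(\<phi> :: real^'n \<Rightarrow> ennreal) M R. \<phi> \<in> borel_measurable lebesgue \<longrightarrow> 0 < R \<longrightarrow>
    (\<forall>t>0. (\<integral>\<^sup>+x\<in>ball 0 t. \<phi> x * ennreal (norm x powr \<beta>) \<partial>lebesgue) \<le> M * ennreal (t powr l)) \<longrightarrow>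
    (\<integral>\<^sup>+x. \<phi> x * ennreal (test_weight p \<tau> s a 0 R R x) \<partial>lebesgue) \<le> ennreal C1 * M * ennreal (R powr (l - \<beta>))"
    using nn_integral_centered_test_weight[OF l \<tau>(2,3)] by (elim exE conjE) (rule that)
  obtain C2 where C2: "0 \<le> C2" and mid_le: "\<forall>(G :: real^'n \<Rightarrow> ennreal) a T M. G \<in> borel_measurable lebesgue \<longrightarrow> 0 < T \<longrightarrow>
    (\<forall>t\<ge>T. (\<integral>\<^sup>+x\<in>ball a t. G x \<partial>lebesgue) \<le> M * ennreal (t powr \<kappa>)) \<longrightarrow>
    (\<integral>\<^sup>+x\<in>- ball a T. ennreal (norm (x - a) powr (- s)) * G x \<partial>lebesgue) \<le> ennreal C2 * M * ennreal (T powr (- s + \<kappa>))"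
    using nn_integral_norm_powr_outside_ball[OF \<kappa>(1,2)] by (elim exE conjE) (rule that)
  \<comment> \<open>Compares |x|^(-\<beta>) with |z|^(-\<beta>) when |z|/2 \<le> |x| \<le> 2|z|, for
    either sign of \<beta>.\<close>
  define c where "c = max ((1/2) powr (- \<beta>)) (2 powr (- \<beta>))"
  have c0: "0 \<le> c" by (simp add: c_def le_max_iff_disj)
  define C where "C = c + c * C2 + 5 powr s * C1"
  show ?thesis
  proof (intro exI[of _ C] conjI allI impI)
    show "0 \<le> C" using c0 C1 C2 by (simp add: C_def)
    fix \<phi> :: "real^'n \<Rightarrow> ennreal" and M z and r :: real
    assume meas: "\<phi> \<in> borel_measurable lebesgue" and r: "0 < r" and z: "8 * r < norm z"
      and h0: "\<forall>t>0. (\<integral>\<^sup>+x\<in>ball 0 t. \<phi> x * ennreal (norm x powr \<beta>) \<partial>lebesgue) \<le> M * ennreal (t powr l)"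
      and h1: "\<forall>t>0. 2 * t \<le> norm z \<longrightarrow> (\<integral>\<^sup>+x\<in>ball z t. \<phi> x * ennreal (norm x powr \<beta>) \<partial>lebesgue) \<le> M * ennreal (t powr \<mu> * norm z powr (l - \<mu>))"
    note [measurable] = meas
    let ?\<rho> = "norm z"
    have \<rho>: "0 < ?\<rho>" using r z by linarith
    define X where "X = r powr \<mu> * ?\<rho> powr (l - \<mu> - \<beta>)"
    define G where "G x = \<phi> x * ennreal (norm (x - 0) powr \<beta>)" for x
    have [measurable]: "G \<in> borel_measurable lebesgue" unfolding G_def by measurable
    have [measurable]: "- ball z r \<in> sets lebesgue" by auto
    have h1': "(\<integral>\<^sup>+x\<in>ball z t. G x \<partial>lebesgue) \<le> M * ennreal (t powr \<mu> * ?\<rho> powr (l - \<mu>))" if "0 < t" "2 * t \<le> ?\<rho>" for t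
      using h1 that by (simp add: G_def)
    define f1 where "f1 x = G x * indicator (ball z r) x" for x
    define f2 where "f2 x = ennreal (norm (x - z) powr (- s)) * (G x * indicator (ball z (?\<rho> / 4)) x) * indicator (- ball z r) x" for x
    define f3 where "f3 x = \<phi> x * ennreal (test_weight p \<tau> s a 0 ?\<rho> ?\<rho> x)" for x
    have [measurable]: "f1 \<in> borel_measurable lebesgue" "f2 \<in> borel_measurable lebesgue" "f3 \<in> borel_measurable lebesgue"
      unfolding f1_def f2_def f3_def by measurable
    have I1: "(\<integral>\<^sup>+x. f1 x \<partial>lebesgue) \<le> M * ennreal (r powr \<mu> * ?\<rho> powr (l - \<mu>))"
      unfolding f1_def using r z by (intro h1') auto
    have I3: "(\<integral>\<^sup>+x. f3 x \<partial>lebesgue) \<le> ennreal C1 * M * ennreal (?\<rho> powr (l - \<beta>))"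
      unfolding f3_def using far_le[rule_format, OF meas \<rho>] h0 by blast
    have I2: "(\<integral>\<^sup>+x. f2 x \<partial>lebesgue) \<le> ennreal C2 * (M * ennreal (r powr (\<mu> - \<kappa>) * ?\<rho> powr (l - \<mu>))) * ennreal (r powr (- s + \<kappa>))"
      unfolding f2_def
    proof (rule mid_le[rule_format, OF _ r])
      show "(\<lambda>x. G x * indicator (ball z (?\<rho> / 4)) x) \<in> borel_measurable lebesgue" by measurable
      fix t :: real assume t: "r \<le> t"
      define t' where "t' = min t (?\<rho> / 4)"
      have t': "0 < t'" "2 * t' \<le> ?\<rho>" "r \<le> t'" "t' \<le> t" using t r z by (auto simp: t'_def)
      have "(\<integral>\<^sup>+x\<in>ball z t. G x * indicator (ball z (?\<rho> / 4)) x \<partial>lebesgue) \<le> (\<integral>\<^sup>+x\<in>ball z t'. G x \<partial>lebesgue)"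
        by (intro nn_integral_mono) (auto simp: t'_def indicator_def)
      also have "\<dots> \<le> M * ennreal (t' powr \<mu> * ?\<rho> powr (l - \<mu>))" by (rule h1'[OF t'(1,2)])
      also have "\<dots> \<le> M * ennreal (r powr (\<mu> - \<kappa>) * t powr \<kappa> * ?\<rho> powr (l - \<mu>))"
      proof (intro mult_left_mono ennreal_leI mult_right_mono)
        have "t' powr \<mu> = t' powr (\<mu> - \<kappa>) * t' powr \<kappa>" by (simp add: powr_add[symmetric])
        also have "\<dots> \<le> r powr (\<mu> - \<kappa>) * t powr \<kappa>"
          using t' r \<kappa> by (intro mult_mono powr_mono2' powr_mono2) auto
        finally show "t' powr \<mu> \<le> r powr (\<mu> - \<kappa>) * t powr \<kappa>" .
      qed auto
      also have "\<dots> = M * ennreal (r powr (\<mu> - \<kappa>) * ?\<rho> powr (l - \<mu>)) * ennreal (t powr \<kappa>)"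
        by (simp add: ennreal_mult mult_ac)
      finally show "(\<integral>\<^sup>+x\<in>ball z t. G x * indicator (ball z (?\<rho> / 4)) x \<partial>lebesgue) \<le> M * ennreal (r powr (\<mu> - \<kappa>) * ?\<rho> powr (l - \<mu>)) * ennreal (t powr \<kappa>)" .
    qed
    have ne: "AE x in lebesgue. x \<noteq> (0::real^'n)"
      using AE_lborel_singleton[of 0] by (rule AE_completion)
    have "(\<integral>\<^sup>+x. \<phi> x * ennreal (test_weight p 0 s a z r ?\<rho> x) \<partial>lebesgue) \<le>
        (\<integral>\<^sup>+x. ennreal (c * ?\<rho> powr (- \<beta>)) * f1 x + ennreal (c * ?\<rho> powr (- \<beta>) * r powr s) * f2 x + ennreal (5 powr s * (r / ?\<rho>) powr s) * f3 x \<partial>lebesgue)"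
    proof (intro nn_integral_mono_AE, use ne in eventually_elim)
      case (elim x)
      have \<phi>G: "\<phi> x \<le> ennreal (c * ?\<rho> powr (- \<beta>)) * G x" if "x \<in> ball z (?\<rho> / 4)"
      proof -
        have "norm x powr (- \<beta>) \<le> c * ?\<rho> powr (- \<beta>)"
          unfolding c_def using \<rho> norm_in_ball_away[OF that] by (intro powr_between(2)) auto
        then have "norm x powr (- \<beta>) * norm x powr \<beta> \<le> c * ?\<rho> powr (- \<beta>) * norm x powr \<beta>"
          by (intro mult_right_mono) auto
        then have "1 \<le> c * ?\<rho> powr (- \<beta>) * norm x powr \<beta>"
          using elim by (simp add: powr_add[symmetric])
        then have "\<phi> x * 1 \<le> \<phi> x * ennreal (c * ?\<rho> powr (- \<beta>) * norm x powr \<beta>)"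
          by (intro mult_left_mono) auto
        then show ?thesis using c0 by (simp add: G_def ennreal_mult mult_ac)
      qed
      have tw: "test_weight p 0 s a z r ?\<rho> x \<le> min ((norm (x - z) / r) powr (- 0)) ((norm (x - z) / r) powr (- s))"
        by (rule test_weight_le[OF \<tau>(3) p])
      consider "x \<in> ball z r" | "x \<notin> ball z r" "x \<in> ball z (?\<rho> / 4)" | "x \<notin> ball z (?\<rho> / 4)" by blast
      then show ?case
      proof cases
        case 1
        then have x: "x \<in> ball z (?\<rho> / 4)" using r z by auto
        have "test_weight p 0 s a z r ?\<rho> x \<le> 1" using tw by (auto split: if_splits)
        then have "\<phi> x * ennreal (test_weight p 0 s a z r ?\<rho> x) \<le> \<phi> x * 1"
          by (intro mult_left_mono) auto
        also have "\<dots> \<le> ennreal (c * ?\<rho> powr (- \<beta>)) * f1 x"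
          using \<phi>G[OF x] 1 by (simp add: f1_def)
        finally show ?thesis by (simp add: add_increasing2 add.assoc)
      next
        case 2
        have "test_weight p 0 s a z r ?\<rho> x \<le> r powr s * norm (x - z) powr (- s)"
          using tw r by (simp add: powr_divide powr_minus field_simps)
        then have "\<phi> x * ennreal (test_weight p 0 s a z r ?\<rho> x) \<le> (ennreal (c * ?\<rho> powr (- \<beta>)) * G x) * ennreal (r powr s * norm (x - z) powr (- s))"
          by (intro mult_mono \<phi>G 2 ennreal_leI) auto
        also have "\<dots> = ennreal (c * ?\<rho> powr (- \<beta>) * r powr s) * f2 x"
          using 2 c0 by (simp add: f2_def ennreal_mult mult_ac)
        finally show ?thesis by (simp add: add_increasing2 add_increasing)
      next
        case 3
        have "\<phi> x * ennreal (test_weight p 0 s a z r ?\<rho> x) \<le> \<phi> x * ennreal (5 powr s * (r / ?\<rho>) powr s * test_weight p \<tau> s a 0 ?\<rho> ?\<rho> x)"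
          using 3 by (intro mult_left_mono ennreal_leI test_weight_far_le r \<rho> elim \<tau>) (auto simp: dist_norm norm_minus_commute)
        also have "\<dots> = ennreal (5 powr s * (r / ?\<rho>) powr s) * f3 x"
          by (simp add: f3_def ennreal_mult' mult_ac)
        finally show ?thesis by (simp add: add_increasing)
      qed
    qed
    also have "\<dots> = ennreal (c * ?\<rho> powr (- \<beta>)) * (\<integral>\<^sup>+x. f1 x \<partial>lebesgue) + ennreal (c * ?\<rho> powr (- \<beta>) * r powr s) * (\<integral>\<^sup>+x. f2 x \<partial>lebesgue) + ennreal (5 powr s * (r / ?\<rho>) powr s) * (\<integral>\<^sup>+x. f3 x \<partial>lebesgue)"
      by (rule nn_integral_add3) measurable
    also have "\<dots> \<le> ennreal (c * ?\<rho> powr (- \<beta>)) * (M * ennreal (r powr \<mu> * ?\<rho> powr (l - \<mu>)))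
        + ennreal (c * ?\<rho> powr (- \<beta>) * r powr s) * (ennreal C2 * (M * ennreal (r powr (\<mu> - \<kappa>) * ?\<rho> powr (l - \<mu>))) * ennreal (r powr (- s + \<kappa>)))
        + ennreal (5 powr s * (r / ?\<rho>) powr s) * (ennreal C1 * M * ennreal (?\<rho> powr (l - \<beta>)))"
      by (intro add_mono mult_left_mono I1 I2 I3) auto
    also have "\<dots> \<le> M * ennreal (c * X) + M * ennreal (c * C2 * X) + M * ennreal (5 powr s * C1 * X)"
    proof (intro add_mono)
      have "?\<rho> powr (- \<beta>) * ?\<rho> powr (l - \<mu>) = ?\<rho> powr (l - \<mu> - \<beta>)" by (simp add: powr_add[symmetric])
      then have X: "?\<rho> powr (- \<beta>) * (r powr \<mu> * ?\<rho> powr (l - \<mu>)) = X" by (simp add: X_def mult_ac)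
      have "ennreal (c * ?\<rho> powr (- \<beta>)) * (M * ennreal (r powr \<mu> * ?\<rho> powr (l - \<mu>))) = M * ennreal (c * (?\<rho> powr (- \<beta>) * (r powr \<mu> * ?\<rho> powr (l - \<mu>))))"
        using c0 by (simp add: ennreal_mult mult_ac)
      then show "ennreal (c * ?\<rho> powr (- \<beta>)) * (M * ennreal (r powr \<mu> * ?\<rho> powr (l - \<mu>))) \<le> M * ennreal (c * X)"
        unfolding X by simp
      have "r powr s * (r powr (\<mu> - \<kappa>) * r powr (- s + \<kappa>)) = r powr \<mu>" by (simp add: powr_add[symmetric])
      then have X2: "?\<rho> powr (- \<beta>) * r powr s * (r powr (\<mu> - \<kappa>) * ?\<rho> powr (l - \<mu>)) * r powr (- s + \<kappa>) = X"
        unfolding X[symmetric] by (simp add: mult_ac)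
      have "ennreal (c * ?\<rho> powr (- \<beta>) * r powr s) * (ennreal C2 * (M * ennreal (r powr (\<mu> - \<kappa>) * ?\<rho> powr (l - \<mu>))) * ennreal (r powr (- s + \<kappa>)))
          = M * ennreal (c * C2 * (?\<rho> powr (- \<beta>) * r powr s * (r powr (\<mu> - \<kappa>) * ?\<rho> powr (l - \<mu>)) * r powr (- s + \<kappa>)))"
        using c0 C2 by (simp add: ennreal_mult mult_ac)
      then show "ennreal (c * ?\<rho> powr (- \<beta>) * r powr s) * (ennreal C2 * (M * ennreal (r powr (\<mu> - \<kappa>) * ?\<rho> powr (l - \<mu>))) * ennreal (r powr (- s + \<kappa>))) \<le> M * ennreal (c * C2 * X)"
        unfolding X2 by simp
      \<comment> \<open>Since r < |z| and \<mu> < s, the far tail decays at least as fast as the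
        required power of r.\<close>
      have "(r / ?\<rho>) powr s * ?\<rho> powr (l - \<beta>) \<le> (r / ?\<rho>) powr \<mu> * ?\<rho> powr (l - \<beta>)"
        using r z \<rho> s by (intro mult_right_mono powr_mono') auto
      also have "\<dots> = r powr \<mu> * (?\<rho> powr (- \<mu>) * ?\<rho> powr (l - \<beta>))"
        using r \<rho> by (simp add: powr_divide powr_minus field_simps)
      also have "?\<rho> powr (- \<mu>) * ?\<rho> powr (l - \<beta>) = ?\<rho> powr (l - \<mu> - \<beta>)" by (simp add: powr_add[symmetric] algebra_simps)
      finally have X3: "(r / ?\<rho>) powr s * ?\<rho> powr (l - \<beta>) \<le> X" by (simp add: X_def)
      have "ennreal (5 powr s * (r / ?\<rho>) powr s) * (ennreal C1 * M * ennreal (?\<rho> powr (l - \<beta>))) = M * ennreal (5 powr s * C1 * ((r / ?\<rho>) powr s * ?\<rho> powr (l - \<beta>)))"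
        using C1 by (simp add: ennreal_mult mult_ac)
      also have "\<dots> \<le> M * ennreal (5 powr s * C1 * X)"
        using C1 X3 by (intro mult_left_mono ennreal_leI) auto
      finally show "ennreal (5 powr s * (r / ?\<rho>) powr s) * (ennreal C1 * M * ennreal (?\<rho> powr (l - \<beta>))) \<le> M * ennreal (5 powr s * C1 * X)" .
    qed
    also have "\<dots> = M * ennreal (C * X)"
    proof -
      have X0: "0 \<le> X" by (simp add: X_def)
      have "C * X = c * X + c * C2 * X + 5 powr s * C1 * X" by (simp add: C_def algebra_simps)
      also have "ennreal \<dots> = ennreal (c * X) + ennreal (c * C2 * X) + ennreal (5 powr s * C1 * X)"
        using X0 c0 C1 C2 by (simp add: ennreal_plus)
      finally show ?thesis by (simp only: distrib_left)
    qed
    also have "\<dots> = ennreal C * M * ennreal X"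
    proof -
      have "0 \<le> C" using c0 C1 C2 by (simp add: C_def)
      then show ?thesis by (simp add: ennreal_mult' mult_ac)
    qed
    finally show "(\<integral>\<^sup>+x. \<phi> x * ennreal (test_weight p 0 s a z r ?\<rho> x) \<partial>lebesgue) \<le> ennreal C * M * ennreal (r powr \<mu> * ?\<rho> powr (l - \<mu> - \<beta>))"
      unfolding X_def .
  qed
qed

section \<open>Choice of the exponents\<close>

text \<open>\<open>\<tau>\<close> makes the weight singular enough to dominate |x|^\<beta> for
  negative \<beta>, and \<open>a\<close> makes it vanish enough at the origin when \<beta> \<ge> l.
  The decay \<open>s\<close> must exceed \<open>\<tau>\<close>, \<open>\<mu>\<close> and l -
  \<beta>; the conditions \<beta> > -n, \<mu> < n and l < n + \<beta> leave room for it below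
  n.\<close>

lemma test_weight_parameters:
  fixes n p \<beta> l \<mu> :: real
  assumes n: "0 < n" and p: "1 \<le> p" and \<beta>: "- n < \<beta>" and \<mu>: "\<mu> < n" and l: "max 0 (\<beta> - n * (p - 1)) < l" "l < n + \<beta>"
  obtains \<tau> s a where "0 \<le> \<tau>" "\<tau> \<le> s" "0 < s" "s < n" "\<mu> < s" "0 \<le> a" "a < n"
    "l < s + \<beta>" "\<beta> - l < a * (p - 1) - \<tau>" "a * (p - 1) - \<tau> \<le> \<beta>"
proof -
  define \<tau> where "\<tau> = max 0 (- \<beta>)"
  define s where "s = (max (max \<tau> \<mu>) (max 0 (l - \<beta>)) + n) / 2"
  have m: "max (max \<tau> \<mu>) (max 0 (l - \<beta>)) < n" using assms by (auto simp: \<tau>_def)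
  then have s: "max (max \<tau> \<mu>) (max 0 (l - \<beta>)) < s" "s < n" by (auto simp: s_def)
  obtain a where a: "0 \<le> a" "a < n" "\<beta> - l < a * (p - 1) - \<tau>" "a * (p - 1) - \<tau> \<le> \<beta>"
  proof (cases "\<beta> < l")
    case True
    show ?thesis by (rule that[of 0]) (use True n l in \<open>auto simp: \<tau>_def\<close>)
  next
    case False
    \<comment> \<open>For \<open>p = 1\<close> the lower bound on \<open>l\<close> gives \<beta> <
      l, the previous case.\<close>
    then have p1: "1 < p" using l p by (cases "p = 1") auto
    \<comment> \<open>The wanted value of a(p-1), halfway between its bounds; they leave a gap
      because l > 0 and l > \<beta> - n(p-1).\<close>
    define G where "G = (\<beta> - l + min \<beta> (n * (p - 1))) / 2"
    have "\<beta> - l < min \<beta> (n * (p - 1))" using l by auto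
    then have G: "\<beta> - l < G" "G < min \<beta> (n * (p - 1))" by (auto simp: G_def)
    have "G / (p - 1) * (p - 1) = G" using p1 by simp
    moreover have "\<tau> = 0" using False l by (auto simp: \<tau>_def)
    moreover have "0 \<le> G / (p - 1)" using False G p1 by auto
    moreover have "G / (p - 1) < n" using G p1 by (simp add: pos_divide_less_eq)
    ultimately show ?thesis using G by (intro that[of "G / (p - 1)"]) auto
  qed
  show ?thesis by (rule that[of \<tau> s a]) (use s a in \<open>auto simp: \<tau>_def\<close>)
qed

section \<open>Transfer to Morrey norms\<close>

text \<open>Since |x|/R < 1, lowering the exponent from \<beta> to a(p-1) - \<tau> only increases
  the power.\<close>

lemma norm_powr_le_centered_test_weight:
  assumes x: "x \<noteq> 0" "norm x < R" and \<tau>: "\<tau> \<le> s" "0 \<le> a" and le: "a * (p - 1) - \<tau> \<le> \<beta>"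
  shows "norm x powr \<beta> \<le> R powr \<beta> * test_weight p \<tau> s a 0 R R x"
proof -
  have R: "0 < R" using x norm_ge_zero[of x] by linarith
  have "norm x powr \<beta> = R powr \<beta> * (norm x / R) powr \<beta>"
    using R by (simp add: powr_divide)
  also have "\<dots> \<le> R powr \<beta> * (norm x / R) powr (a * (p - 1) - \<tau>)"
    using x R le by (intro mult_left_mono powr_mono') auto
  finally show ?thesis by (simp add: test_weight_inside[OF x \<tau>])
qed

text \<open>On the ball the first factor of the weight is 1 off the centre, and |x| \<ge> |z|/2
  keeps the correction at the origin above 2^(-a(p-1)).\<close>

lemma norm_powr_le_shifted_test_weight:
  assumes x: "x \<in> ball z r" "x \<noteq> z" and z: "8 * r < norm z" and a: "0 \<le> a" and s: "0 \<le> s" and p: "1 \<le> p"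
  shows "norm x powr \<beta> \<le> max ((1/2) powr \<beta>) (2 powr \<beta>) * 2 powr (a * (p - 1)) * norm z powr \<beta> * test_weight p 0 s a z r (norm z) x"
proof -
  let ?q = "norm (x - z) / r"
  have r: "0 < r" using x by (metis ball_empty empty_iff not_le)
  have q: "0 < ?q" "?q < 1" using x r by (auto simp: dist_norm norm_minus_commute)
  have nb: "1 / 2 * norm z \<le> norm x" "norm x \<le> 2 * norm z"
    using norm_in_ball_away[OF x(1)] z r by auto
  have \<rho>: "0 < norm z" using r z by linarith
  have "1 \<le> ?q powr (- s)" using q s powr_mono'[of "- s" 0 ?q] x(2) r by auto
  \<comment> \<open>\<open>x \<noteq> z\<close> matters here, since \<open>0 powr 0\<close> is
    0.\<close>
  then have m: "min (?q powr (- 0)) (?q powr (- s)) = 1" using x(2) r by (simp add: min_def)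
  have "(norm x / norm z) powr (- a) \<le> (1 / 2) powr (- a)"
    using nb \<rho> a by (intro powr_mono2') (auto simp: field_simps)
  also have "\<dots> = 2 powr a" by (simp add: powr_divide powr_minus)
  finally have "max ((norm (x - 0) / norm z) powr (- a)) 1 \<le> 2 powr a"
    using a by (auto simp: ge_one_powr_ge_zero)
  then have "(2 powr a) powr (1 - p) \<le> max ((norm (x - 0) / norm z) powr (- a)) 1 powr (1 - p)"
    using p by (intro powr_mono2') auto
  then have "2 powr (a * (p - 1)) * (2 powr a) powr (1 - p) \<le> 2 powr (a * (p - 1)) * test_weight p 0 s a z r (norm z) x"
    unfolding test_weight_def m by (intro mult_left_mono) auto
  moreover have "2 powr (a * (p - 1)) * (2 powr a) powr (1 - p) = (1::real)"
    by (simp add: powr_powr powr_add[symmetric] algebra_simps)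
  ultimately have tw: "1 \<le> 2 powr (a * (p - 1)) * test_weight p 0 s a z r (norm z) x" by simp
  have "norm x powr \<beta> \<le> max ((1/2) powr \<beta>) (2 powr \<beta>) * norm z powr \<beta> * 1"
    using powr_between(2)[OF _ \<rho> nb] by simp
  also have "\<dots> \<le> max ((1/2) powr \<beta>) (2 powr \<beta>) * norm z powr \<beta> * (2 powr (a * (p - 1)) * test_weight p 0 s a z r (norm z) x)"
    by (intro mult_left_mono tw) (auto simp: le_max_iff_disj)
  finally show ?thesis by (simp only: mult_ac)
qed

lemma set_nn_integral_le_scale:
  assumes meas: "u \<in> borel_measurable M" "h \<in> borel_measurable M" "B \<in> sets M"
    and c: "0 \<le> c" and le: "AE x in M. x \<in> B \<longrightarrow> v x \<le> c * u x"
  shows "(\<integral>\<^sup>+x\<in>B. h x * ennreal (v x) \<partial>M) \<le> ennreal c * (\<integral>\<^sup>+x\<in>B. h x * ennreal (u x) \<partial>M)"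
proof -
  note [measurable] = meas
  have "(\<integral>\<^sup>+x\<in>B. h x * ennreal (v x) \<partial>M) \<le> (\<integral>\<^sup>+x. ennreal c * (h x * ennreal (u x) * indicator B x) \<partial>M)"
  proof (intro nn_integral_mono_AE, use le in eventually_elim)
    case (elim x)
    show ?case
    proof (cases "x \<in> B")
      case True
      then have "h x * ennreal (v x) \<le> h x * ennreal (c * u x)"
        using elim by (intro mult_left_mono ennreal_leI) auto
      then show ?thesis using True c by (simp add: ennreal_mult' mult_ac)
    qed simp
  qed
  also have "\<dots> = ennreal c * (\<integral>\<^sup>+x\<in>B. h x * ennreal (u x) \<partial>M)"
    by (rule nn_integral_cmult) measurable
  finally show ?thesis .
qed

text \<open>Stated for p-th powers and an arbitrary bound \<open>M\<close>, possibly infinite, in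
  place of the norm of \<open>f\<close>. Positivity of the normaliser is recorded for the final
  division.\<close>

theorem morrey_transfer:
  fixes \<F> :: "((real^'n \<Rightarrow> ennreal) \<times> (real^'n \<Rightarrow> ennreal)) set" and l1 l2 \<beta> :: real
  assumes U: "uniform_Ap_bound p0 \<F>" and p0: "1 \<le> p0" and p: "1 < p \<or> p = 1 \<and> p0 = 1"
    and meas: "\<And>f g. (f, g) \<in> \<F> \<Longrightarrow> f \<in> borel_measurable lebesgue \<and> g \<in> borel_measurable lebesgue"
    and l12: "l1 + l2 < real CARD('n)" and \<beta>: "- real CARD('n) < \<beta>"
    and L: "max 0 (\<beta> - real CARD('n) * (p - 1)) < l1 + l2 * (1 + \<beta> / real CARD('n))"
      "l1 + l2 * (1 + \<beta> / real CARD('n)) < real CARD('n) + \<beta>"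
  defines "N \<equiv> \<lambda>(x::real^'n) r. r powr l1 * enn2real (wmeas (\<lambda>x. norm x powr \<beta>) (ball x r)) powr (l2 / real CARD('n))"
  shows "(\<forall>x r. 0 < r \<longrightarrow> 0 < N x r) \<and> (\<exists>C>0. \<forall>f g M. (f, g) \<in> \<F> \<longrightarrow>
    (\<forall>x r. 0 < r \<longrightarrow> (\<integral>\<^sup>+y\<in>ball x r. epowr (f y) p * ennreal (norm y powr \<beta>) \<partial>lebesgue) \<le> M * ennreal (N x r)) \<longrightarrow>
    (\<forall>x r. 0 < r \<longrightarrow> (\<integral>\<^sup>+y\<in>ball x r. epowr (g y) p * ennreal (norm y powr \<beta>) \<partial>lebesgue) \<le> ennreal C * (M * ennreal (N x r))))"
proof -
  define l where "l = l1 + l2 * (1 + \<beta> / real CARD('n))"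
  define \<mu> where "\<mu> = l1 + l2"
  have p1: "1 \<le> p" using p by auto
  obtain k1 k2 where k: "0 < k1" "0 < k2" and N: "\<forall>(x::real^'n) r. 0 < r \<longrightarrow>
    (norm x \<le> 8 * r \<longrightarrow> k1 * r powr l \<le> N x r \<and> N x r \<le> k2 * r powr l) \<and>
    (2 * r \<le> norm x \<longrightarrow> k1 * (r powr \<mu> * norm x powr (l - \<mu>)) \<le> N x r \<and> N x r \<le> k2 * (r powr \<mu> * norm x powr (l - \<mu>)))"
    using morrey_normalizer_bounds[OF \<beta>, of l1 l2] unfolding N_def l_def \<mu>_def by blast
  obtain \<tau> s a where par: "0 \<le> \<tau>" "\<tau> \<le> s" "0 < s" "s < real CARD('n)" "\<mu> < s" "0 \<le> a" "a < real CARD('n)"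
    "l < s + \<beta>" "\<beta> - l < a * (p - 1) - \<tau>" "a * (p - 1) - \<tau> \<le> \<beta>"
    by (rule test_weight_parameters[of "real CARD('n)" p \<beta> \<mu> l]) (use p1 l12 \<beta> L in \<open>auto simp: l_def \<mu>_def\<close>)
  have l0: "0 < l" using L by (simp add: l_def)
  obtain A where A: "0 < A" and tw: "\<forall>f g. (f, g) \<in> \<F> \<longrightarrow> (\<forall>z r \<rho> c t. 0 < r \<longrightarrow> 0 < \<rho> \<longrightarrow>
    (\<integral>\<^sup>+x\<in>ball c t. epowr (g x) p * ennreal (test_weight p \<tau> s a z r \<rho> x) \<partial>lebesgue) \<le>
      ennreal A * (\<integral>\<^sup>+x. epowr (f x) p * ennreal (test_weight p \<tau> s a z r \<rho> x) \<partial>lebesgue))"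
    using test_weight_bound[OF U p0 p, of \<tau> s a] meas par by auto
  obtain A' where A': "0 < A'" and tw': "\<forall>f g. (f, g) \<in> \<F> \<longrightarrow> (\<forall>z r \<rho> c t. 0 < r \<longrightarrow> 0 < \<rho> \<longrightarrow>
    (\<integral>\<^sup>+x\<in>ball c t. epowr (g x) p * ennreal (test_weight p 0 s a z r \<rho> x) \<partial>lebesgue) \<le>
      ennreal A' * (\<integral>\<^sup>+x. epowr (f x) p * ennreal (test_weight p 0 s a z r \<rho> x) \<partial>lebesgue))"
    using test_weight_bound[OF U p0 p, of 0 s a] meas par by auto
  obtain C1 where C1: "0 \<le> C1" and cen: "\<forall>(\<phi> :: real^'n \<Rightarrow> ennreal) M R. \<phi> \<in> borel_measurable lebesgue \<longrightarrow> 0 < R \<longrightarrow>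
    (\<forall>t>0. (\<integral>\<^sup>+x\<in>ball 0 t. \<phi> x * ennreal (norm x powr \<beta>) \<partial>lebesgue) \<le> M * ennreal (t powr l)) \<longrightarrow>
    (\<integral>\<^sup>+x. \<phi> x * ennreal (test_weight p \<tau> s a 0 R R x) \<partial>lebesgue) \<le> ennreal C1 * M * ennreal (R powr (l - \<beta>))"
    using nn_integral_centered_test_weight[OF l0 par(8,9,2,6)] by (elim exE conjE) (rule that)
  obtain C2 where C2: "0 \<le> C2" and shi: "\<forall>(\<phi> :: real^'n \<Rightarrow> ennreal) M z r. \<phi> \<in> borel_measurable lebesgue \<longrightarrow> 0 < r \<longrightarrow> 8 * r < norm z \<longrightarrow>
    (\<forall>t>0. (\<integral>\<^sup>+x\<in>ball 0 t. \<phi> x * ennreal (norm x powr \<beta>) \<partial>lebesgue) \<le> M * ennreal (t powr l)) \<longrightarrow>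
    (\<forall>t>0. 2 * t \<le> norm z \<longrightarrow> (\<integral>\<^sup>+x\<in>ball z t. \<phi> x * ennreal (norm x powr \<beta>) \<partial>lebesgue) \<le> M * ennreal (t powr \<mu> * norm z powr (l - \<mu>))) \<longrightarrow>
    (\<integral>\<^sup>+x. \<phi> x * ennreal (test_weight p 0 s a z r (norm z) x) \<partial>lebesgue) \<le> ennreal C2 * M * ennreal (r powr \<mu> * norm z powr (l - \<mu> - \<beta>))"
    using nn_integral_shifted_test_weight[OF l0 par(8,9,1,2,6,3,5) p1] by (elim exE conjE) (rule that)
  define m where "m = max ((1/2) powr \<beta>) (2 powr \<beta>) * 2 powr (a * (p - 1))"
  have m: "0 \<le> m" by (simp add: m_def le_max_iff_disj)
  \<comment> \<open>\<open>B1\<close> serves balls near the origin, with 9^l from the enlarged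
    radius, and \<open>B2\<close> serves distant ones. The quotient k2/k1 arises because the
    normaliser is bounded above for \<open>f\<close> and below for \<open>g\<close>.\<close>
  define B1 where "B1 = A * C1 * k2 * 9 powr l / k1"
  define B2 where "B2 = m * A' * C2 * k2 / k1"
  define C where "C = max 1 (max B1 B2)"
  have Cnn: "0 \<le> C" by (simp add: C_def)
  have B: "0 \<le> B1" "0 \<le> B2" using A A' C1 C2 k m by (auto simp: B1_def B2_def)
  have main: "(\<integral>\<^sup>+y\<in>ball x r. epowr (g y) p * ennreal (norm y powr \<beta>) \<partial>lebesgue) \<le> ennreal C * (M * ennreal (N x r))"
    if fg: "(f, g) \<in> \<F>" and hyp: "\<forall>x r. 0 < r \<longrightarrow> (\<integral>\<^sup>+y\<in>ball x r. epowr (f y) p * ennreal (norm y powr \<beta>) \<partial>lebesgue) \<le> M * ennreal (N x r)"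
      and r: "0 < r" for f g M x r
  proof -
    have [measurable]: "f \<in> borel_measurable lebesgue" "g \<in> borel_measurable lebesgue" using meas[OF fg] by auto
    have ne: "AE y in lebesgue. y \<noteq> (z::real^'n)" for z
      using AE_lborel_singleton[of z] by (rule AE_completion)
    have h0: "\<forall>t>0. (\<integral>\<^sup>+y\<in>ball 0 t. epowr (f y) p * ennreal (norm y powr \<beta>) \<partial>lebesgue) \<le> M * ennreal k2 * ennreal (t powr l)"
    proof (intro allI impI)
      fix t :: real assume t: "0 < t"
      have "(\<integral>\<^sup>+y\<in>ball 0 t. epowr (f y) p * ennreal (norm y powr \<beta>) \<partial>lebesgue) \<le> M * ennreal (N 0 t)"
        using hyp t by blast
      also have "\<dots> \<le> M * ennreal (k2 * t powr l)"
        using N[rule_format, OF t, of 0] t by (intro mult_left_mono ennreal_leI) auto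
      finally show "(\<integral>\<^sup>+y\<in>ball 0 t. epowr (f y) p * ennreal (norm y powr \<beta>) \<partial>lebesgue) \<le> M * ennreal k2 * ennreal (t powr l)"
        using k by (simp add: ennreal_mult mult.assoc)
    qed
    have h1: "\<forall>t>0. 2 * t \<le> norm x \<longrightarrow> (\<integral>\<^sup>+y\<in>ball x t. epowr (f y) p * ennreal (norm y powr \<beta>) \<partial>lebesgue) \<le> M * ennreal k2 * ennreal (t powr \<mu> * norm x powr (l - \<mu>))"
    proof (intro allI impI)
      fix t :: real assume t: "0 < t" "2 * t \<le> norm x"
      have "(\<integral>\<^sup>+y\<in>ball x t. epowr (f y) p * ennreal (norm y powr \<beta>) \<partial>lebesgue) \<le> M * ennreal (N x t)"
        using hyp t by blast
      also have "\<dots> \<le> M * ennreal (k2 * (t powr \<mu> * norm x powr (l - \<mu>)))"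
        using N[rule_format, OF t(1), of x] t by (intro mult_left_mono ennreal_leI) auto
      finally show "(\<integral>\<^sup>+y\<in>ball x t. epowr (f y) p * ennreal (norm y powr \<beta>) \<partial>lebesgue) \<le> M * ennreal k2 * ennreal (t powr \<mu> * norm x powr (l - \<mu>))"
        using k by (simp add: ennreal_mult mult.assoc)
    qed
    show ?thesis
    proof (cases "norm x \<le> 8 * r")
      case True
      \<comment> \<open>For |x| \<le> 8r the ball of radius 9r about 0 contains
        \<open>ball x r\<close> and has a comparable normaliser, so a centred weight
        suffices.\<close>
      define R where "R = 9 * r"
      have R: "0 < R" using r by (simp add: R_def)
      have sub: "ball x r \<subseteq> ball 0 R"
      proof
        fix y assume "y \<in> ball x r"
        then show "y \<in> ball 0 R" using norm_triangle_ineq2[of y x] True by (simp add: R_def dist_norm norm_minus_commute)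
      qed
      have "(\<integral>\<^sup>+y\<in>ball x r. epowr (g y) p * ennreal (norm y powr \<beta>) \<partial>lebesgue) \<le> (\<integral>\<^sup>+y\<in>ball 0 R. epowr (g y) p * ennreal (norm y powr \<beta>) \<partial>lebesgue)"
        using sub by (intro nn_integral_mono) (auto simp: indicator_def)
      also have "\<dots> \<le> ennreal (R powr \<beta>) * (\<integral>\<^sup>+y\<in>ball 0 R. epowr (g y) p * ennreal (test_weight p \<tau> s a 0 R R y) \<partial>lebesgue)"
      proof (rule set_nn_integral_le_scale)
        show "AE y in lebesgue. y \<in> ball (0::real^'n) R \<longrightarrow> norm y powr \<beta> \<le> R powr \<beta> * test_weight p \<tau> s a 0 R R y"
          using ne[of 0] by eventually_elim (use par in \<open>auto intro!: norm_powr_le_centered_test_weight\<close>)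
      qed auto
      also have "\<dots> \<le> ennreal (R powr \<beta>) * (ennreal A * (\<integral>\<^sup>+y. epowr (f y) p * ennreal (test_weight p \<tau> s a 0 R R y) \<partial>lebesgue))"
        using tw fg R by (intro mult_left_mono) auto
      also have "\<dots> \<le> ennreal (R powr \<beta>) * (ennreal A * (ennreal C1 * (M * ennreal k2) * ennreal (R powr (l - \<beta>))))"
        by (intro mult_left_mono cen[rule_format, OF _ R] h0[rule_format]) auto
      also have "\<dots> = M * ennreal (A * C1 * k2 * (R powr \<beta> * R powr (l - \<beta>)))"
        using A C1 k by (simp add: ennreal_mult mult_ac)
      also have "R powr \<beta> * R powr (l - \<beta>) = 9 powr l * r powr l"
      proof -
        have "R powr \<beta> * R powr (l - \<beta>) = R powr l" by (simp add: powr_add[symmetric])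
        then show ?thesis using r by (simp add: R_def powr_mult)
      qed
      also have "M * ennreal (A * C1 * k2 * (9 powr l * r powr l)) \<le> M * ennreal (C * N x r)"
      proof (intro mult_left_mono ennreal_leI)
        have "A * C1 * k2 * (9 powr l * r powr l) = B1 * (k1 * r powr l)"
          using k by (simp add: B1_def)
        also have "\<dots> \<le> C * N x r"
          using N[rule_format, OF r, of x] True B k by (intro mult_mono) (auto simp: C_def)
        finally show "A * C1 * k2 * (9 powr l * r powr l) \<le> C * N x r" .
      qed auto
      also have "\<dots> = ennreal C * (M * ennreal (N x r))"
        using Cnn by (simp add: ennreal_mult' mult_ac)
      finally show ?thesis .
    next
      case False
      then have x: "8 * r < norm x" by simp
      have \<rho>: "0 < norm x" using x r by linarith
      \<comment> \<open>Enlarging a far ball to one about the origin would lose the ratio of the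
        normalisers, so the weight keeps the centre \<open>x\<close>.\<close>
      let ?w = "test_weight p 0 s a x r (norm x)"
      have "(\<integral>\<^sup>+y\<in>ball x r. epowr (g y) p * ennreal (norm y powr \<beta>) \<partial>lebesgue) \<le> ennreal (m * norm x powr \<beta>) * (\<integral>\<^sup>+y\<in>ball x r. epowr (g y) p * ennreal (?w y) \<partial>lebesgue)"
      proof (rule set_nn_integral_le_scale)
        show "AE y in lebesgue. y \<in> ball x r \<longrightarrow> norm y powr \<beta> \<le> m * norm x powr \<beta> * ?w y"
          using ne[of x]
        proof eventually_elim
          case (elim y)
          show ?case unfolding m_def using par p1 by (intro impI norm_powr_le_shifted_test_weight elim x) auto
        qed
      qed (use m in auto)
      also have "\<dots> \<le> ennreal (m * norm x powr \<beta>) * (ennreal A' * (\<integral>\<^sup>+y. epowr (f y) p * ennreal (?w y) \<partial>lebesgue))"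
        using tw' fg r \<rho> by (intro mult_left_mono) auto
      also have "\<dots> \<le> ennreal (m * norm x powr \<beta>) * (ennreal A' * (ennreal C2 * (M * ennreal k2) * ennreal (r powr \<mu> * norm x powr (l - \<mu> - \<beta>))))"
        by (intro mult_left_mono shi[rule_format, OF _ r x] h0[rule_format] h1[rule_format]) auto
      also have "\<dots> = M * ennreal (m * A' * C2 * k2 * (r powr \<mu> * (norm x powr \<beta> * norm x powr (l - \<mu> - \<beta>))))"
        using A' C2 k m by (simp add: ennreal_mult mult_ac)
      also have "norm x powr \<beta> * norm x powr (l - \<mu> - \<beta>) = norm x powr (l - \<mu>)"
        by (simp add: powr_add[symmetric])
      also have "M * ennreal (m * A' * C2 * k2 * (r powr \<mu> * norm x powr (l - \<mu>))) \<le> M * ennreal (C * N x r)"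
      proof (intro mult_left_mono ennreal_leI)
        have "m * A' * C2 * k2 * (r powr \<mu> * norm x powr (l - \<mu>)) = B2 * (k1 * (r powr \<mu> * norm x powr (l - \<mu>)))"
          using k by (simp add: B2_def)
        also have "\<dots> \<le> C * N x r"
          using N[rule_format, OF r, of x] x r B k by (intro mult_mono) (auto simp: C_def)
        finally show "m * A' * C2 * k2 * (r powr \<mu> * norm x powr (l - \<mu>)) \<le> C * N x r" .
      qed auto
      also have "\<dots> = ennreal C * (M * ennreal (N x r))"
        using Cnn by (simp add: ennreal_mult' mult_ac)
      finally show ?thesis .
    qed
  qed
  have "0 < N x r" if r: "0 < r" for x r
  proof (cases "norm x \<le> 8 * r")
    case True
    have "0 < k1 * r powr l" using k r by simp
    then show ?thesis using N[rule_format, OF r, of x] True by linarith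
  next
    case False
    then have "0 < norm x" using r norm_ge_zero[of x] by linarith
    then have "0 < k1 * (r powr \<mu> * norm x powr (l - \<mu>))" using k r by simp
    moreover have "2 * r \<le> norm x" using False r by linarith
    ultimately show ?thesis using N[rule_format, OF r, of x] by linarith
  qed
  moreover have "0 < C" by (simp add: C_def)
  ultimately show ?thesis using main by blast
qed

theorem theorem4p3:
  fixes F :: "((real ^ 'n \<Rightarrow> ennreal) \<times> (real ^ 'n \<Rightarrow> ennreal)) set"
    and \<Phi> :: "ennreal \<Rightarrow> real"
    and p\<^sub>0 p l1 l2 \<beta> :: real
  assumes "1 \<le> p\<^sub>0"
    and "\<forall>(f, g) \<in> F. f \<in> borel_measurable lebesgue \<and> g \<in> borel_measurable lebesgue"
    and "\<forall>u \<in> Ap p\<^sub>0. \<forall>(f, g) \<in> F.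
           wLp_norm p\<^sub>0 u g \<le> ennreal (\<Phi> (Ap_const p\<^sub>0 u)) * wLp_norm p\<^sub>0 u f"
    and "1 < p \<or> (p = 1 \<and> p\<^sub>0 = 1)"
    and "l1 + l2 < real CARD('n)"
    and "\<beta> > - real CARD('n)"
    and "max 0 (\<beta> - real CARD('n) * (p - 1)) < l1 + l2 * (1 + \<beta> / real CARD('n))"
    and "l1 + l2 * (1 + \<beta> / real CARD('n)) < real CARD('n) + \<beta>"
  shows "\<exists>C :: real. \<forall>(f, g) \<in> F.
           morrey_norm p l1 l2 (\<lambda>x. norm x powr \<beta>) g
             \<le> ennreal C * morrey_norm p l1 l2 (\<lambda>x. norm x powr \<beta>) f"
proof -
  have p: "0 < p" using assms(4) by auto
  define N where "N x r = r powr l1 * enn2real (wmeas (\<lambda>x. norm x powr \<beta>) (ball x r)) powr (l2 / real CARD('n))" for x :: "real^'n" and r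
  define I where "I f x r = (\<integral>\<^sup>+y\<in>ball x r. epowr (f y) p * ennreal (norm y powr \<beta>) \<partial>lebesgue)" for f and x :: "real^'n" and r
  have U: "uniform_Ap_bound p\<^sub>0 F" by (rule uniform_Ap_boundI[OF assms(1-3)])
  have meas: "f \<in> borel_measurable lebesgue \<and> g \<in> borel_measurable lebesgue" if "(f, g) \<in> F" for f g
    using assms(2) that by auto
  note transfer = morrey_transfer[OF U assms(1,4) meas assms(5-8), folded N_def I_def]
  have N: "0 < N x r" if "0 < r" for x r by (rule conjunct1[OF transfer, rule_format, OF _ that])
  obtain C where C: "0 < C" and le: "\<forall>f g M. (f, g) \<in> F \<longrightarrow> (\<forall>x r. 0 < r \<longrightarrow> I f x r \<le> M * ennreal (N x r)) \<longrightarrow>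
      (\<forall>x r. 0 < r \<longrightarrow> I g x r \<le> ennreal C * (M * ennreal (N x r)))"
    by (rule exE[OF conjunct2[OF transfer]]) (assumption, elim conjE, rule that)
  have norm_eq: "morrey_norm p l1 l2 (\<lambda>x. norm x powr \<beta>) f = (SUP (x, r) \<in> UNIV \<times> {0<..}. epowr (I f x r / ennreal (N x r)) (1 / p))" for f
    by (simp add: morrey_norm_def N_def I_def)
  \<comment> \<open>Taking p-th roots turns the constant \<open>C\<close> for integrals into C^(1/p)
    for norms.\<close>
  have "morrey_norm p l1 l2 (\<lambda>x. norm x powr \<beta>) g \<le> ennreal (C powr (1 / p)) * morrey_norm p l1 l2 (\<lambda>x. norm x powr \<beta>) f"
    if fg: "(f, g) \<in> F" for f g
  proof -
    define M where "M = epowr (morrey_norm p l1 l2 (\<lambda>x. norm x powr \<beta>) f) p"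
    have "I f x r \<le> M * ennreal (N x r)" if r: "0 < r" for x r
    proof -
      have "epowr (I f x r / ennreal (N x r)) (1 / p) \<le> morrey_norm p l1 l2 (\<lambda>x. norm x powr \<beta>) f"
        unfolding norm_eq using r by (intro SUP_upper2[of "(x, r)"]) auto
      then have "I f x r / ennreal (N x r) \<le> M"
        using p by (simp add: M_def epowr_le_iff)
      then have "I f x r / ennreal (N x r) * ennreal (N x r) \<le> M * ennreal (N x r)"
        by (rule mult_right_mono) simp
      also have "I f x r / ennreal (N x r) * ennreal (N x r) = I f x r"
        using N[OF r, of x] by (simp add: ennreal_divide_times)
      finally show ?thesis .
    qed
    then have gN: "I g x r \<le> ennreal C * (M * ennreal (N x r))" if "0 < r" for x r
      using le fg that by blast
    show ?thesis
      unfolding norm_eq[of g]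
    proof (intro SUP_least, erule SigmaE, simp only: prod.case)
      fix x :: "real^'n" and r :: real assume "r \<in> {0<..}"
      then have r: "0 < r" by simp
      have "I g x r / ennreal (N x r) \<le> ennreal C * M * ennreal (N x r) / ennreal (N x r)"
        using gN[OF r, of x] by (intro divide_right_mono_ennreal) (simp add: mult.assoc)
      also have "\<dots> = ennreal C * M"
        using N[OF r, of x] by (intro mult_divide_eq_ennreal) auto
      finally have "epowr (I g x r / ennreal (N x r)) (1 / p) \<le> epowr (ennreal C * M) (1 / p)"
        using p by (intro epowr_mono) auto
      also have "\<dots> = ennreal (C powr (1 / p)) * morrey_norm p l1 l2 (\<lambda>x. norm x powr \<beta>) f"
        using C p by (simp add: epowr_mult_ennreal M_def epowr_epowr)
      finally show "epowr (I g x r / ennreal (N x r)) (1 / p) \<le> ennreal (C powr (1 / p)) * morrey_norm p l1 l2 (\<lambda>x. norm x powr \<beta>) f" .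
    qed
  qed
  then show ?thesis by (intro exI[of _ "C powr (1 / p)"]) auto
qed

end
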